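(* Let $\mathcal S$ be an IFS on a Euclidean space satisfying the strong separation condition, and let $s=\dim_H E_{\mathcal S}$. Suppose that one of the ratios of $\mathcal S$, say $r$, satisfies: (1) $\mathcal S^G\neq\mathcal S$, where $G$ is the multiplicative semigroup generated by $r$; (2) there exist positive integers $\lambda_1,\lambda_2,\dots,\lambda_m$ such that $r^{s\lambda_1}+r^{s\lambda_2}+\dots+r^{s\lambda_m}=1$. Then there exist infinitely many IFSs $\mathcal S_1,\mathcal S_2,\dots$ on Euclidean spaces satisfying the strong separation condition such that for each $n\ge1$: (i) $\dim_H E_{\mathcal S_n}=s$; (ii) $\operatorname{sgp}\mathcal S_n\sim\operatorname{sgp}\mathcal S$; (iii) $\mathbb Z^+[\mathcal S_n]=\mathbb Z^+[\mathcal S]$; but $E_{\mathcal S_i}$ and $E_{\mathcal S_j}$ are not Lipschitz equivalent whenever $i\ne j$.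
   Context: Two metric spaces are Lipschitz equivalent if there is a bijection $f$ between them and $L\ge 1$ with $L^{-1}d_1(x,y)\le d_2(f(x),f(y))\le L\,d_1(x,y)$ for all $x,y$. An IFS is a finite family $\mathcal S=\{S_1,\dots,S_n\}$, $n\ge 2$, of contracting similarities of a Euclidean space $\mathbb R^d$ ($d$ may depend on the IFS), where $S_i$ has ratio $r_i\in(0,1)$, i.e. $|S_i(x)-S_i(y)|=r_i|x-y|$. $E_{\mathcal S}$ is the unique nonempty compact set with $E_{\mathcal S}=\bigcup_i S_i(E_{\mathcal S})$. $\mathcal S$ satisfies the strong separation condition if the sets $S_i(E_{\mathcal S})$ are pairwise disjoint. $\operatorname{sgp}\mathcal S$ is the multiplicative sub-semigroup of the positive reals generated by the ratios $r_1,\dots,r_n$. For a multiplicative sub-semigroup $G$ of $(0,1)$, $\mathcal S^G=\{S\in\mathcal S: (\rho\cdot\operatorname{sgp}\mathcal S)\cap G\ne\emptyset,\text{ where } \rho \text{ is the ratio of } S\}$. Two multiplicative sub-semigroups $G_1,G_2$ of $(0,1)$ are equivalent, $G_1\sim G_2$, if there are positive integers $u,v$ such that $g_1^u\in G_2$ for all $g_1\in G_1$ and $g_2^v\in G_1$ for all $g_2\in G_2$. For positive numbers $a_1,\dots,a_n$, $\mathbb Z^+[a_1,\dots,a_n]$ is the smallest set of real numbers containing $a_1,\dots,a_n$ and all positive integers and closed under addition and multiplication; $\mathbb Z^+[\mathcal S]=\mathbb Z^+[r_1^s,\dots,r_n^s]$ with $s=\dim_H E_{\mathcal S}$. *)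

theory Defs
  imports "HOL-Analysis.Analysis"
begin

section \<open>Euclidean spaces of variable dimension\<close>

text \<open>
  The dimension of the ambient space has to be existentially quantified, separately for each
  member of a sequence of systems, so it cannot be a type. As in the library's
  \<^const>\<open>Euclidean_space\<close>, the points of the \<open>d\<close>-dimensional space are the functions
  \<open>x :: nat \<Rightarrow> real\<close> with \<open>x i = 0\<close> for \<open>i \<ge> d\<close>. The distance is the usual Euclidean one;
  it is unrelated to the \<^class>\<open>metric_space\<close> instance of the function type.
\<close>

definition eucl :: "nat \<Rightarrow> (nat \<Rightarrow> real) metric" where
  "eucl d = metric (topspace (Euclidean_space d), \<lambda>x y. L2_set (\<lambda>i. x i - y i) {..<d})"

lemma Metric_space_eucl:
  "Metric_space (topspace (Euclidean_space d)) (\<lambda>x y. L2_set (\<lambda>i. x i - y i) {..<d})"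
proof
  fix x y z :: "nat \<Rightarrow> real"
  show "0 \<le> L2_set (\<lambda>i. x i - y i) {..<d}"
    by simp
  show "L2_set (\<lambda>i. x i - y i) {..<d} = L2_set (\<lambda>i. y i - x i) {..<d}"
    by (simp add: L2_set_def power2_commute)
  show "L2_set (\<lambda>i. x i - z i) {..<d}
      \<le> L2_set (\<lambda>i. x i - y i) {..<d} + L2_set (\<lambda>i. y i - z i) {..<d}"
    using L2_set_triangle_ineq[of "\<lambda>i. x i - y i" "\<lambda>i. y i - z i" "{..<d}"] by simp
  assume "x \<in> topspace (Euclidean_space d)" "y \<in> topspace (Euclidean_space d)"
  then have out: "x i = 0 \<and> y i = 0" if "i \<ge> d" for i
    using that by (simp add: topspace_Euclidean_space)
  show "L2_set (\<lambda>i. x i - y i) {..<d} = 0 \<longleftrightarrow> x = y"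
  proof
    assume "L2_set (\<lambda>i. x i - y i) {..<d} = 0"
    then have "x i = y i" if "i < d" for i
      using that by (simp add: L2_set_eq_0_iff)
    with out show "x = y"
      by (metis ext not_less)
  qed (simp add: L2_set_def)
qed

lemma mspace_eucl: "mspace (eucl d) = {x. \<forall>i\<ge>d. x i = 0}"
  using Metric_space.mspace_metric[OF Metric_space_eucl[of d]]
  by (simp add: eucl_def topspace_Euclidean_space)

lemma mdist_eucl: "mdist (eucl d) x y = L2_set (\<lambda>i. x i - y i) {..<d}"
  using Metric_space.mdist_metric[OF Metric_space_eucl[of d]]
  by (simp add: eucl_def)


section \<open>Lipschitz equivalence and Hausdorff dimension\<close>

definition Lipschitz_equivalent :: "'a metric \<Rightarrow> 'b metric \<Rightarrow> bool" where
  "Lipschitz_equivalent m1 m2 \<longleftrightarrow>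
     (\<exists>f L. bij_betw f (mspace m1) (mspace m2) \<and> L \<ge> 1 \<and>
        (\<forall>x\<in>mspace m1. \<forall>y\<in>mspace m1.
           mdist m1 x y / L \<le> mdist m2 (f x) (f y) \<and>
           mdist m2 (f x) (f y) \<le> L * mdist m1 x y))"

text \<open>Only used for bounded sets, for which the supremum is a genuine one.\<close>

definition mdiam :: "'a metric \<Rightarrow> 'a set \<Rightarrow> real" where
  "mdiam m U = (if U = {} then 0 else (SUP (x, y)\<in>U \<times> U. mdist m x y))"

definition Hausdorff_premeasure :: "'a metric \<Rightarrow> real \<Rightarrow> real \<Rightarrow> 'a set \<Rightarrow> ennreal" where
  "Hausdorff_premeasure m t \<delta> A =
     Inf {(\<Sum>i. ennreal (mdiam m (U i) powr t)) | U :: nat \<Rightarrow> 'a set.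
            A \<subseteq> (\<Union>i. U i) \<and>
            (\<forall>i. U i \<subseteq> mspace m \<and> (\<forall>x\<in>U i. \<forall>y\<in>U i. mdist m x y \<le> \<delta>))}"

definition Hausdorff_measure :: "'a metric \<Rightarrow> real \<Rightarrow> 'a set \<Rightarrow> ennreal" where
  "Hausdorff_measure m t A = (SUP \<delta>\<in>{0<..}. Hausdorff_premeasure m t \<delta> A)"

text \<open>
  The exponent \<open>t = 0\<close> is left out because \<open>0 powr 0 = 0\<close>; this does not change the infimum.
  For subsets of \<open>eucl d\<close> every \<open>t > d\<close> is admissible, so the infimum is over a nonempty set.
\<close>

definition Hausdorff_dim :: "'a metric \<Rightarrow> 'a set \<Rightarrow> real" where
  "Hausdorff_dim m A = Inf {t. 0 < t \<and> Hausdorff_measure m t A = 0}"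


section \<open>Iterated function systems\<close>

text \<open>
  A finite family of self-maps of \<open>eucl (ambient_dim S)\<close>. Values outside the carrier are irrelevant.
\<close>

datatype ifs = IFS (ambient_dim: nat) (maps: "((nat \<Rightarrow> real) \<Rightarrow> nat \<Rightarrow> real) list")

definition similarity :: "nat \<Rightarrow> real \<Rightarrow> ((nat \<Rightarrow> real) \<Rightarrow> nat \<Rightarrow> real) \<Rightarrow> bool" where
  "similarity d r f \<longleftrightarrow>
     f \<in> mspace (eucl d) \<rightarrow> mspace (eucl d) \<and>
     (\<forall>x\<in>mspace (eucl d). \<forall>y\<in>mspace (eucl d).
        mdist (eucl d) (f x) (f y) = r * mdist (eucl d) x y)"

text \<open>The ratio is unique for \<open>d \<ge> 1\<close>, which \<open>is_IFS\<close> below requires.\<close>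

definition ratio :: "nat \<Rightarrow> ((nat \<Rightarrow> real) \<Rightarrow> nat \<Rightarrow> real) \<Rightarrow> real" where
  "ratio d f = (THE r. similarity d r f)"

definition is_IFS :: "ifs \<Rightarrow> bool" where
  "is_IFS S \<longleftrightarrow>
     ambient_dim S \<ge> 1 \<and> length (maps S) \<ge> 2 \<and>
     (\<forall>f\<in>set (maps S). \<exists>r. 0 < r \<and> r < 1 \<and> similarity (ambient_dim S) r f)"

definition ratios :: "ifs \<Rightarrow> real set" where
  "ratios S = ratio (ambient_dim S) ` set (maps S)"

definition attractor :: "ifs \<Rightarrow> (nat \<Rightarrow> real) set" where
  "attractor S =
     (THE E. E \<noteq> {} \<and> compactin (mtopology_of (eucl (ambient_dim S))) E \<and>
             E = (\<Union>f\<in>set (maps S). f ` E))"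

abbreviation attractor_space :: "ifs \<Rightarrow> (nat \<Rightarrow> real) metric" where
  "attractor_space S \<equiv> submetric (eucl (ambient_dim S)) (attractor S)"

definition dimH :: "ifs \<Rightarrow> real" where
  "dimH S = Hausdorff_dim (eucl (ambient_dim S)) (attractor S)"

definition strong_separation :: "ifs \<Rightarrow> bool" where
  "strong_separation S \<longleftrightarrow>
     disjoint_family_on (\<lambda>i. (maps S ! i) ` attractor S) {..<length (maps S)}"


section \<open>Semigroups and semirings of ratios\<close>

inductive_set mult_semigroup :: "real set \<Rightarrow> real set" for A :: "real set" where
  base: "a \<in> A \<Longrightarrow> a \<in> mult_semigroup A"
| mult: "a \<in> mult_semigroup A \<Longrightarrow> b \<in> mult_semigroup A \<Longrightarrow> a * b \<in> mult_semigroup A"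

definition sgp :: "ifs \<Rightarrow> real set" where
  "sgp S = mult_semigroup (ratios S)"

text \<open>The subfamily \<open>S\<^sup>G\<close> of the family of maps of \<open>S\<close>.\<close>

definition maps_meeting :: "ifs \<Rightarrow> real set \<Rightarrow> ((nat \<Rightarrow> real) \<Rightarrow> nat \<Rightarrow> real) list" where
  "maps_meeting S G =
     filter (\<lambda>f. (\<lambda>g. ratio (ambient_dim S) f * g) ` sgp S \<inter> G \<noteq> {}) (maps S)"

definition semigroup_equiv :: "real set \<Rightarrow> real set \<Rightarrow> bool" where
  "semigroup_equiv G1 G2 \<longleftrightarrow>
     (\<exists>u v :: nat. u > 0 \<and> v > 0 \<and> (\<forall>g\<in>G1. g ^ u \<in> G2) \<and> (\<forall>g\<in>G2. g ^ v \<in> G1))"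

inductive_set pos_int_semiring :: "real set \<Rightarrow> real set" for A :: "real set" where
  base: "a \<in> A \<Longrightarrow> a \<in> pos_int_semiring A"
| nat: "n > 0 \<Longrightarrow> real n \<in> pos_int_semiring A"
| add: "a \<in> pos_int_semiring A \<Longrightarrow> b \<in> pos_int_semiring A \<Longrightarrow> a + b \<in> pos_int_semiring A"
| mult: "a \<in> pos_int_semiring A \<Longrightarrow> b \<in> pos_int_semiring A \<Longrightarrow> a * b \<in> pos_int_semiring A"

definition ifs_semiring :: "ifs \<Rightarrow> real set" where
  "ifs_semiring S = pos_int_semiring ((\<lambda>r. r powr dimH S) ` ratios S)"

end

(*
  A self-similar set with strong separation is bi-Lipschitz to the space of its codes, where the
  distance of two codes is the product of the ratios along their common prefix. The systems T n
  arise from S by replacing one map of ratio r by maps of the ratios r * r^l, where l runs over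
  the n-fold sums of the given exponents; such a replacement with ratios realised in a space of large
  dimension changes neither the dimension s, nor (up to powers) the semigroup, nor the semiring.

  A ratio is good if it divides a power of r in the semigroup of S; by assumption some ratio is bad.
  Let P n t be the sum of a^t over the good ratios a of T n. For t < s it increases strictly
  with n, while P n s < 1. A bi-Lipschitz map f from T j to T i scales the self-similar measures
  by a constant on some cylinder. There, a word u of good letters is mapped essentially into a
  cylinder whose ratio is that of u up to finitely many factors. As u can be completed to a word
  whose ratio is a power of r, that cylinder has boundedly many bad letters. Comparing the sums of
  the t-th powers of the ratios shows that P j t = 1 implies P i t >= 1, which is absurd for i < j.
*)
theory Submission
  imports Defs "HOL-Probability.Infinite_Product_Measure"
begin

section \<open>Words and sequences\<close>

text \<open>The obstacle is that a bi-Lipschitz map sends a cylinder not to a cylinder but to a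
  finite union of cylinders of bounded depth below one, and controls ratios only up to
  \<open>L\<close>. That a ratio is a power of \<open>r\<close> is an exact relation, which an
  uncontrolled factor destroys. The equality of the exponents \<open>s\<close> on both sides rescues
  it: relative measures of such unions take finitely many values, so the density of the transported
  measure is constant on some cylinder, and s-th roots give exact ratios up to finitely many
  factors. The split map has ratio \<open>r\<close> because its pieces then have powers of
  \<open>r\<close> as ratios and are good, so the bad part of the power sum is left alone. As a bad
  ratio exists, for \<open>n \<ge> 1\<close> the root of \<open>P n t = 1\<close> lies strictly
  below \<open>s\<close>, where the pieces together weigh more than the piece that they replace. The
  map goes from the larger index \<open>j\<close> to the smaller \<open>i\<close> because good words
  of the source are followed into the target, which has too little room for them.\<close>

definition words :: "nat \<Rightarrow> nat \<Rightarrow> nat list set" where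
  "words N n = {w. set w \<subseteq> {..<N} \<and> length w = n}"

definition seqs :: "nat \<Rightarrow> (nat \<Rightarrow> nat) set" where
  "seqs N = {x. \<forall>k. x k < N}"

definition wt :: "(nat \<Rightarrow> real) \<Rightarrow> nat list \<Rightarrow> real" where
  "wt p w = (\<Prod>i\<leftarrow>w. p i)"

definition pre :: "(nat \<Rightarrow> 'a) \<Rightarrow> nat \<Rightarrow> 'a list" where
  "pre x n = map x [0..<n]"

definition cyl :: "nat \<Rightarrow> nat list \<Rightarrow> (nat \<Rightarrow> nat) set" where
  "cyl N w = {x \<in> seqs N. pre x (length w) = w}"

text \<open>For ratios in (0,1) this is an ultrametric in which \<open>cyl N w\<close> is the closed
  ball of radius \<open>wt p w\<close> around each of its points (\<open>udist_le_wt\<close>,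
  \<open>mem_cyl_of_udist_le\<close>). Equal sequences are split off because \<open>LEAST\<close> is
  unspecified for them.\<close>

definition udist :: "(nat \<Rightarrow> real) \<Rightarrow> (nat \<Rightarrow> nat) \<Rightarrow> (nat \<Rightarrow> nat) \<Rightarrow> real" where
  "udist p x y = (if x = y then 0 else wt p (pre x (LEAST k. x k \<noteq> y k)))"

lemma wt_Nil [simp]: "wt p [] = 1"
  and wt_Cons [simp]: "wt p (i # w) = p i * wt p w"
  and wt_append [simp]: "wt p (u @ v) = wt p u * wt p v"
  by (simp_all add: wt_def)

lemma length_pre [simp]: "length (pre x n) = n"
  and nth_pre [simp]: "k < n \<Longrightarrow> pre x n ! k = x k"
  and pre_0 [simp]: "pre x 0 = []"
  by (simp_all add: pre_def)

lemma pre_Suc: "pre x (Suc n) = x 0 # pre (\<lambda>k. x (Suc k)) n"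
  unfolding pre_def by (subst upt_conv_Cons) (auto simp: map_Suc_upt[symmetric] o_def simp del: upt_Suc)

lemma pre_eq_iff: "pre x n = pre y n \<longleftrightarrow> (\<forall>k<n. x k = y k)"
  by (auto simp: pre_def)

lemma pre_add: "pre x (m + n) = pre x m @ pre (\<lambda>k. x (m + k)) n"
  by (rule nth_equalityI) (auto simp: nth_append)

lemma take_pre: "take m (pre x n) = pre x (min m n)"
  by (rule nth_equalityI) auto

lemma pre_mem_words: "x \<in> seqs N \<Longrightarrow> pre x n \<in> words N n"
  by (auto simp: words_def seqs_def pre_def)

lemma finite_words [simp]: "finite (words N n)"
  unfolding words_def by (rule finite_lists_length_eq) simp

lemma words_0 [simp]: "words N 0 = {[]}"
  by (auto simp: words_def)

lemma words_Suc: "words N (Suc n) = (\<lambda>(i, w). i # w) ` ({..<N} \<times> words N n)"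
  by (auto simp: words_def length_Suc_conv image_iff)

lemma sum_wt_words: "(\<Sum>w\<in>words N n. wt p w) = (\<Sum>i<N. p i) ^ n"
proof (induction n)
  case (Suc n)
  have "(\<Sum>w\<in>words N (Suc n). wt p w) = (\<Sum>(i, w)\<in>{..<N} \<times> words N n. p i * wt p w)"
    unfolding words_Suc by (subst sum.reindex) (auto simp: inj_on_def intro!: sum.cong)
  also have "\<dots> = (\<Sum>i<N. p i) * (\<Sum>w\<in>words N n. wt p w)"
    by (simp add: sum_product sum.cartesian_product)
  finally show ?case using Suc by simp
qed simp

text \<open>Setting the weights outside \<open>P\<close> to 0 kills every word with a forbidden
  letter, so \<open>sum_wt_words\<close> applies to the modified weights.\<close>

lemma wt_restrict:
  "(\<Sum>w\<in>{w \<in> words N n. \<forall>i\<in>set w. P i}. wt p w) = (\<Sum>i | i < N \<and> P i. p i) ^ n"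
proof -
  let ?p = "\<lambda>i. if P i then p i else 0"
  have "wt ?p w = (if \<forall>i\<in>set w. P i then wt p w else 0)" for w
    by (induction w) auto
  then have "(\<Sum>w\<in>{w \<in> words N n. \<forall>i\<in>set w. P i}. wt p w) = (\<Sum>w\<in>words N n. wt ?p w)"
    by (simp add: sum.inter_filter)
  also have "\<dots> = (\<Sum>i<N. ?p i) ^ n"
    by (rule sum_wt_words)
  also have "(\<Sum>i<N. ?p i) = (\<Sum>i | i < N \<and> P i. p i)"
    by (rule sum.mono_neutral_cong_right) auto
  finally show ?thesis .
qed

lemma cyl_Nil [simp]: "cyl N [] = seqs N"
  by (auto simp: cyl_def)

lemma cyl_subset_seqs: "cyl N w \<subseteq> seqs N"
  by (auto simp: cyl_def)

lemma cyl_append_subset: "cyl N (u @ v) \<subseteq> cyl N u"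
proof
  fix x assume x: "x \<in> cyl N (u @ v)"
  then have "take (length u) (pre x (length (u @ v))) = u"
    by (simp add: cyl_def)
  then have "pre x (length u) = u"
    by (simp add: take_pre)
  with x show "x \<in> cyl N u" by (simp add: cyl_def)
qed

lemma mem_cyl_iff: "x \<in> cyl N w \<longleftrightarrow> x \<in> seqs N \<and> (\<forall>k<length w. x k = w ! k)"
  by (auto simp: cyl_def list_eq_iff_nth_eq)

lemma mem_cyl_pre: "x \<in> seqs N \<Longrightarrow> x \<in> cyl N (pre x n)"
  by (simp add: cyl_def)

lemma cyl_eq_Union_words: "cyl N w = (\<Union>z\<in>words N n. cyl N (w @ z))"
proof
  show "cyl N w \<subseteq> (\<Union>z\<in>words N n. cyl N (w @ z))"
  proof
    fix x assume x: "x \<in> cyl N w"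
    define z where "z = pre (\<lambda>k. x (length w + k)) n"
    have "z \<in> words N n" using x unfolding z_def
      by (intro pre_mem_words) (auto simp: cyl_def seqs_def)
    moreover have "x \<in> cyl N (w @ z)" using x
      by (auto simp: cyl_def z_def pre_add)
    ultimately show "x \<in> (\<Union>z\<in>words N n. cyl N (w @ z))" by blast
  qed
qed (use cyl_append_subset in blast)

lemma cyl_disjoint: "length u = length v \<Longrightarrow> u \<noteq> v \<Longrightarrow> cyl N u \<inter> cyl N v = {}"
  by (auto simp: cyl_def)

lemma cyl_comparable:
  assumes "x \<in> cyl N u" "x \<in> cyl N v" "length u \<le> length v"
  obtains z where "v = u @ z"
proof -
  have "take (length u) v = u"
    using assms by (metis (mono_tags, lifting) cyl_def mem_Collect_eq min.absorb1 take_pre)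
  then show thesis using that append_take_drop_id[of "length u" v] by metis
qed

lemma udist_self [simp]: "udist p x x = 0"
  by (simp add: udist_def)

lemma udist_eq:
  assumes "\<And>k. k < n \<Longrightarrow> x k = y k" "x n \<noteq> y n"
  shows "udist p x y = wt p (pre x n)"
proof -
  have "(LEAST k. x k \<noteq> y k) = n"
    using assms by (intro Least_equality) (auto simp: not_less[symmetric])
  with assms(2) show ?thesis by (auto simp: udist_def)
qed

lemma neq_seqs_first_difference:
  fixes x y :: "nat \<Rightarrow> 'a"
  assumes "x \<noteq> y"
  obtains n where "\<And>k. k < n \<Longrightarrow> x k = y k" "x n \<noteq> y n"
proof -
  from assms obtain k where "x k \<noteq> y k" by auto
  then show thesis
    using that[of "LEAST k. x k \<noteq> y k"] not_less_Least[of _ "\<lambda>k. x k \<noteq> y k"]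
    by (metis (mono_tags, lifting) LeastI)
qed

section \<open>Weights and diameters of cylinders for fixed ratios\<close>

locale ratio_system =
  fixes N :: nat and p :: "nat \<Rightarrow> real"
  assumes two_le: "2 \<le> N"
    and pos: "i < N \<Longrightarrow> 0 < p i"
    and less_1: "i < N \<Longrightarrow> p i < 1"
begin

definition pmax :: real where "pmax = Max (p ` {..<N})"
definition pmin :: real where "pmin = Min (p ` {..<N})"

lemma nonempty: "p ` {..<N} \<noteq> {}"
  using two_le by (auto simp: lessThan_empty_iff)

lemma le_pmax: "i < N \<Longrightarrow> p i \<le> pmax"
  and pmin_le: "i < N \<Longrightarrow> pmin \<le> p i"
  by (auto simp: pmax_def pmin_def)

lemma pmax_pos: "0 < pmax" and pmax_less_1: "pmax < 1"
  and pmin_pos: "0 < pmin" and pmin_less_1: "pmin < 1"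
proof -
  have "pmax \<in> p ` {..<N}" "pmin \<in> p ` {..<N}"
    unfolding pmax_def pmin_def using nonempty by (intro Max_in Min_in; simp)+
  then show "0 < pmax" "pmax < 1" "0 < pmin" "pmin < 1"
    using pos less_1 by auto
qed

lemma wt_pos: "set w \<subseteq> {..<N} \<Longrightarrow> 0 < wt p w"
  by (induction w) (auto simp: pos)

lemma wt_le_1: "set w \<subseteq> {..<N} \<Longrightarrow> wt p w \<le> 1"
  by (induction w) (auto simp: pos less_1 less_imp_le wt_pos intro!: mult_le_one)

lemma wt_less_1: "set w \<subseteq> {..<N} \<Longrightarrow> w \<noteq> [] \<Longrightarrow> wt p w < 1"
proof (cases w)
  case (Cons i v)
  assume "set w \<subseteq> {..<N}"
  with Cons have "p i * wt p v \<le> p i * 1"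
    by (intro mult_left_mono) (auto simp: wt_le_1 pos less_imp_le)
  with Cons \<open>set w \<subseteq> {..<N}\<close> show ?thesis
    using less_1[of i] by auto
qed simp

lemma wt_le_pmax_power: "set w \<subseteq> {..<N} \<Longrightarrow> wt p w \<le> pmax ^ length w"
  by (induction w) (auto intro!: mult_mono simp: le_pmax pmax_pos less_imp_le wt_pos)

lemma pmin_power_le_wt: "set w \<subseteq> {..<N} \<Longrightarrow> pmin ^ length w \<le> wt p w"
  by (induction w) (auto intro!: mult_mono simp: pmin_le pmin_pos pos less_imp_le)

lemma set_pre_subset: "x \<in> seqs N \<Longrightarrow> set (pre x n) \<subseteq> {..<N}"
  by (auto simp: seqs_def pre_def)

lemma wt_pre_antimono:
  assumes "x \<in> seqs N" "m \<le> n"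
  shows "wt p (pre x n) \<le> wt p (pre x m)"
proof -
  have "pre x n = pre x m @ pre (\<lambda>k. x (m + k)) (n - m)"
    using assms(2) pre_add[of x m "n - m"] by simp
  moreover have "wt p (pre (\<lambda>k. x (m + k)) (n - m)) \<le> 1"
    using assms(1) by (intro wt_le_1 set_pre_subset) (auto simp: seqs_def)
  ultimately show ?thesis
    using wt_pos[OF set_pre_subset[OF assms(1), of m]] by (simp add: mult_left_le)
qed

lemma wt_pre_strict_antimono:
  assumes "x \<in> seqs N" "m < n"
  shows "wt p (pre x n) < wt p (pre x m)"
proof -
  have "pre x n = pre x m @ pre (\<lambda>k. x (m + k)) (n - m)"
    using assms(2) pre_add[of x m "n - m"] by simp
  moreover have "wt p (pre (\<lambda>k. x (m + k)) (n - m)) < 1"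
    using assms by (intro wt_less_1 set_pre_subset) (auto simp: seqs_def pre_def)
  ultimately show ?thesis
    using wt_pos[OF set_pre_subset[OF assms(1), of m]] by simp
qed

lemma udist_le_wt:
  assumes "x \<in> cyl N w" "y \<in> cyl N w"
  shows "udist p x y \<le> wt p w"
proof (cases "x = y")
  case True
  moreover have "set w \<subseteq> {..<N}"
    using assms(1) set_pre_subset[of x "length w"] by (simp add: cyl_def)
  ultimately show ?thesis using wt_pos[of w] by simp
next
  case False
  then obtain n where n: "\<And>k. k < n \<Longrightarrow> x k = y k" "x n \<noteq> y n"
    by (metis neq_seqs_first_difference)
  then have "length w \<le> n"
    using assms unfolding mem_cyl_iff by (metis not_less)
  moreover have "x \<in> seqs N" "pre x (length w) = w"
    using assms by (auto simp: cyl_def)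
  ultimately show ?thesis
    using wt_pre_antimono[of x "length w" n] udist_eq[of n x y, OF n] by simp
qed

text \<open>Weights decrease strictly along prefixes. A sequence outside the cylinder separates from
  \<open>x\<close> before the end of \<open>w\<close>, hence at a distance greater than
  \<open>wt p w\<close>.\<close>

lemma mem_cyl_of_udist_le:
  assumes "x \<in> cyl N w" "y \<in> seqs N" "udist p x y \<le> wt p w"
  shows "y \<in> cyl N w"
proof (rule ccontr)
  assume y: "y \<notin> cyl N w"
  with assms have "x \<noteq> y" by auto
  then obtain n where n: "\<And>k. k < n \<Longrightarrow> x k = y k" "x n \<noteq> y n"
    by (metis neq_seqs_first_difference)
  have "n < length w"
    using y n assms(1,2) unfolding mem_cyl_iff by (metis not_le order_less_le_trans)
  moreover have x: "x \<in> seqs N" "pre x (length w) = w"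
    using assms by (auto simp: cyl_def)
  ultimately have "wt p (pre x (length w)) < wt p (pre x n)"
    by (intro wt_pre_strict_antimono)
  then show False
    using x assms(3) udist_eq[of n x y, OF n] by simp
qed

text \<open>The diameter of a cylinder is attained: at least two letters are available directly
  after \<open>w\<close>.\<close>

lemma ex_branching:
  assumes "set w \<subseteq> {..<N}"
  obtains a b where "a \<in> cyl N w" "b \<in> cyl N w" "udist p a b = wt p w" "a (length w) = 0" "b (length w) = 1"
proof -
  define e where "e j = (\<lambda>k. if k < length w then w ! k else j)" for j :: nat
  have e: "e j \<in> cyl N w" if "j < N" for j
  proof -
    have "w ! k < N" if "k < length w" for k
      using assms nth_mem[OF that] by auto
    then show ?thesis
      using that by (auto simp: mem_cyl_iff seqs_def e_def)
  qed
  have "udist p (e 0) (e 1) = wt p (pre (e 0) (length w))"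
    by (rule udist_eq) (auto simp: e_def)
  also have "pre (e 0) (length w) = w"
    using e[of 0] two_le by (auto simp: cyl_def)
  finally show thesis
    using that[of "e 0" "e 1"] e two_le by (auto simp: e_def)
qed

lemma cyl_nonempty: "set w \<subseteq> {..<N} \<Longrightarrow> cyl N w \<noteq> {}"
  using ex_branching by blast

lemma pmax_power_tendsto_0: "(\<lambda>n. C * pmax ^ n) \<longlonglongrightarrow> 0"
  using tendsto_mult_right_zero[OF LIMSEQ_power_zero[of pmax], of C] pmax_pos pmax_less_1 by simp

lemma ex_pmax_power_le:
  assumes "0 < e"
  obtains n where "C * pmax ^ n < e"
  using order_tendstoD(2)[OF pmax_power_tendsto_0[of C] assms] eventually_happens by fastforce

end

text \<open>This is the Bernoulli measure in which letter \<open>i\<close> has probability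
  \<open>p i powr s\<close>; the hypothesis makes these a probability vector.\<close>

lemma (in ratio_system) ex_self_similar_measure:
  assumes "(\<Sum>i<N. p i powr s) = 1"
  obtains \<mu> where "prob_space \<mu>" "space \<mu> = seqs N"
    "\<And>w. set w \<subseteq> {..<N} \<Longrightarrow> cyl N w \<in> sets \<mu> \<and> measure \<mu> (cyl N w) = wt p w powr s"
proof -
  define P where "P = point_measure {..<N} (\<lambda>i. ennreal (p i powr s))"
  have "prob_space P"
    by (rule prob_spaceI)
      (simp add: P_def space_point_measure emeasure_point_measure_finite assms)
  then interpret Q: prob_space P .
  interpret product_prob_space "\<lambda>_::nat. P" UNIV
    by unfold_locales
  let ?M = "PiM UNIV (\<lambda>_::nat. P)"
  have space: "space ?M = seqs N"
    by (auto simp: space_PiM seqs_def P_def space_point_measure PiE_iff)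
  have "cyl N w \<in> sets ?M \<and> measure ?M (cyl N w) = wt p w powr s" if w: "set w \<subseteq> {..<N}" for w
  proof -
    have lt: "w ! i < N" if "i < length w" for i
      using w nth_mem[OF that] by auto
    have eq: "cyl N w = {x \<in> space ?M. \<forall>i\<in>{..<length w}. x i \<in> {w ! i}}"
      by (auto simp: mem_cyl_iff space)
    have sets: "{w ! i} \<in> sets P" if "i \<in> {..<length w}" for i
      using that lt by (auto simp: P_def sets_point_measure)
    have "emeasure ?M (cyl N w) = (\<Prod>i<length w. emeasure P {w ! i})"
      unfolding eq by (rule emeasure_PiM_Collect) (use sets in auto)
    also have "\<dots> = (\<Prod>i<length w. ennreal (p (w ! i) powr s))"
      using lt by (intro prod.cong refl) (simp add: P_def emeasure_point_measure_finite_if)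
    also have "\<dots> = ennreal (\<Prod>i<length w. p (w ! i) powr s)"
      by (rule prod_ennreal) simp
    also have "(\<Prod>i<length w. p (w ! i) powr s) = wt p w powr s"
      using w
    proof (induction w)
      case (Cons i w)
      then show ?case
        using wt_pos[of w] pos[of i]
        by (simp add: prod.lessThan_Suc_shift powr_mult less_imp_le del: prod.lessThan_Suc)
    qed simp
    finally have "measure ?M (cyl N w) = wt p w powr s"
      by (simp add: measure_def)
    moreover have "cyl N w \<in> sets ?M"
      unfolding eq using sets by measurable
    ultimately show ?thesis by simp
  qed
  with space show thesis
    using that[of ?M] prob_space_axioms by blast
qed

section \<open>Bi-Lipschitz maps between sequence spaces\<close>

locale bilipschitz_coding = E: ratio_system N p + F: ratio_system N' q for N p N' q +
  fixes f :: "(nat \<Rightarrow> nat) \<Rightarrow> nat \<Rightarrow> nat" and L :: real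
  assumes bij: "bij_betw f (seqs N) (seqs N')"
    and L_ge_1: "1 \<le> L"
    and lower: "x \<in> seqs N \<Longrightarrow> y \<in> seqs N \<Longrightarrow> udist p x y \<le> L * udist q (f x) (f y)"
    and upper: "x \<in> seqs N \<Longrightarrow> y \<in> seqs N \<Longrightarrow> udist q (f x) (f y) \<le> L * udist p x y"
begin

lemma inj: "x \<in> seqs N \<Longrightarrow> y \<in> seqs N \<Longrightarrow> f x = f y \<longleftrightarrow> x = y"
  using bij by (auto simp: bij_betw_def inj_on_def)

lemma f_mem: "x \<in> seqs N \<Longrightarrow> f x \<in> seqs N'"
  using bij by (auto simp: bij_betw_def)

lemma f_surj: "y \<in> seqs N' \<Longrightarrow> \<exists>x\<in>seqs N. f x = y"
  using bij unfolding bij_betw_def by (metis imageE)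

text \<open>The longest common prefix of the codes in the image of a cylinder. Maximality makes the
  assignment monotone (\<open>V_append\<close>); the two weight bounds say that it distorts ratios
  by at most \<open>L\<close>.\<close>

definition is_prefix_of_image :: "nat list \<Rightarrow> nat list \<Rightarrow> bool" where
  "is_prefix_of_image w v \<longleftrightarrow> set v \<subseteq> {..<N'} \<and> f ` cyl N w \<subseteq> cyl N' v \<and>
     wt q v \<le> L * wt p w \<and> wt p w \<le> L * wt q v \<and>
     (\<forall>v'. f ` cyl N w \<subseteq> cyl N' v' \<longrightarrow> length v' \<le> length v)"

lemma ex_prefix_of_image:
  assumes w: "set w \<subseteq> {..<N}"
  shows "\<exists>v. is_prefix_of_image w v"
proof -
  let ?A = "f ` cyl N w"
  obtain a b where ab: "a \<in> cyl N w" "b \<in> cyl N w" "udist p a b = wt p w"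
      "a (length w) = 0" "b (length w) = 1"
    by (rule E.ex_branching[OF w]) blast
  then have ab': "a \<in> seqs N" "b \<in> seqs N" "a \<noteq> b"
    by (auto simp: cyl_def)
  define Q where "Q k \<longleftrightarrow> (\<exists>x\<in>?A. \<exists>y\<in>?A. x k \<noteq> y k)" for k
  have "f a \<noteq> f b" using ab' inj by blast
  then have "\<exists>k. Q k" using ab(1,2) unfolding Q_def by blast
  \<comment> \<open>The first coordinate at which the image is not constant. Two image points that
    differ there are at distance exactly \<open>wt q v\<close>, which gives the upper bound; the
    branching pair \<open>a\<close>, \<open>b\<close> gives the lower one.\<close>
  define k where "k = (LEAST k. Q k)"
  have "Q k" unfolding k_def using \<open>\<exists>k. Q k\<close> by (rule LeastI_ex)
  have agree: "x j = y j" if "x \<in> ?A" "y \<in> ?A" "j < k" for x y j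
    using not_less_Least[of j Q] that unfolding k_def Q_def by blast
  define v where "v = pre (f a) k"
  have A: "x \<in> cyl N' v" if "x \<in> ?A" for x
  proof -
    have "x \<in> seqs N'"
      using that f_mem cyl_subset_seqs by blast
    moreover have "pre x k = pre (f a) k"
      unfolding pre_eq_iff using agree[OF that imageI[OF ab(1)]] by blast
    ultimately show ?thesis by (simp add: cyl_def v_def)
  qed
  have v: "set v \<subseteq> {..<N'}"
    unfolding v_def by (intro F.set_pre_subset f_mem ab')
  obtain x y where xy: "x \<in> cyl N w" "y \<in> cyl N w" "f x k \<noteq> f y k"
    using \<open>Q k\<close> unfolding Q_def by blast
  have "wt q v = wt q (pre (f x) k)"
    using A[OF imageI[OF xy(1)]] by (simp add: cyl_def v_def)
  also have "\<dots> = udist q (f x) (f y)"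
    by (rule udist_eq[symmetric]) (use xy agree in blast)+
  also have "\<dots> \<le> L * udist p x y"
    using xy by (intro upper) (auto simp: cyl_def)
  also have "\<dots> \<le> L * wt p w"
    using xy L_ge_1 by (intro mult_left_mono E.udist_le_wt) auto
  finally have up: "wt q v \<le> L * wt p w" .
  have "wt p w \<le> L * udist q (f a) (f b)"
    using lower[OF ab'(1,2)] ab by simp
  also have "\<dots> \<le> L * wt q v"
    using ab A L_ge_1 by (intro mult_left_mono F.udist_le_wt) auto
  finally have lo: "wt p w \<le> L * wt q v" .
  have "length v' \<le> length v" if "?A \<subseteq> cyl N' v'" for v'
  proof (rule ccontr)
    assume "\<not> length v' \<le> length v"
    then have "k < length v'" by (simp add: v_def)
    moreover have "f x \<in> cyl N' v'" "f y \<in> cyl N' v'"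
      using that xy by auto
    ultimately show False using xy(3) by (simp add: mem_cyl_iff)
  qed
  with v A up lo show ?thesis
    unfolding is_prefix_of_image_def by blast
qed

definition V :: "nat list \<Rightarrow> nat list" where
  "V w = (SOME v. is_prefix_of_image w v)"

lemma is_prefix_of_image_V: "set w \<subseteq> {..<N} \<Longrightarrow> is_prefix_of_image w (V w)"
  unfolding V_def by (rule someI_ex[OF ex_prefix_of_image])

lemma
  assumes "set w \<subseteq> {..<N}"
  shows set_V: "set (V w) \<subseteq> {..<N'}"
    and image_subset_V: "f ` cyl N w \<subseteq> cyl N' (V w)"
    and wt_V_le: "wt q (V w) \<le> L * wt p w"
    and wt_le_V: "wt p w \<le> L * wt q (V w)"
    and V_longest: "f ` cyl N w \<subseteq> cyl N' v' \<Longrightarrow> length v' \<le> length (V w)"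
  using is_prefix_of_image_V[OF assms] unfolding is_prefix_of_image_def by simp_all

text \<open>The smaller image lies below \<open>V u\<close> too, so maximality makes
  \<open>V u\<close> the shorter of two prefixes of a common point.\<close>

lemma V_append:
  assumes "set (u @ v) \<subseteq> {..<N}"
  obtains z where "V (u @ v) = V u @ z"
proof -
  have sub: "f ` cyl N (u @ v) \<subseteq> cyl N' (V u)"
    using image_subset_V[of u] assms cyl_append_subset[of N u v] by auto
  obtain x where x: "x \<in> cyl N (u @ v)"
    using E.cyl_nonempty[OF assms] by blast
  have "f x \<in> cyl N' (V u)"
    by (rule subsetD[OF sub imageI[OF x]])
  moreover have "f x \<in> cyl N' (V (u @ v))"
    by (rule subsetD[OF image_subset_V[OF assms] imageI[OF x]])
  ultimately obtain z where "V (u @ v) = V u @ z"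
    by (rule cyl_comparable[OF _ _ V_longest[OF assms sub]])
  then show thesis by (rule that)
qed

text \<open>A sufficiently light cylinder that meets the image is swallowed by it: the preimages of
  its points are within \<open>wt p w\<close> of a point of \<open>cyl N w\<close>, and that
  cylinder is a ball.\<close>

lemma cyl_subset_image:
  assumes "set w \<subseteq> {..<N}" "L * wt q z \<le> wt p w" "y \<in> cyl N' z" "y \<in> f ` cyl N w"
  shows "cyl N' z \<subseteq> f ` cyl N w"
proof
  fix y' assume y': "y' \<in> cyl N' z"
  then obtain x' where x': "x' \<in> seqs N" "f x' = y'"
    using f_surj by (auto simp: cyl_def)
  obtain x where x: "x \<in> cyl N w" "f x = y"
    using assms(4) by blast
  have "udist p x x' \<le> L * udist q (f x) (f x')"
    using x x' by (intro lower) (auto simp: cyl_def)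
  also have "\<dots> \<le> L * wt q z"
    using x x' y' assms(3) L_ge_1 by (intro mult_left_mono F.udist_le_wt) auto
  finally have "x' \<in> cyl N w"
    using x x' assms(2) by (intro E.mem_cyl_of_udist_le[of x w x']) auto
  with x' show "y' \<in> f ` cyl N w" by blast
qed

text \<open>By \<open>cyl_subset_image\<close>, at this depth every cylinder that meets the image
  lies in it. The prefix \<open>v\<close> is left free so that a child of a word can be decomposed
  below the \<open>V\<close> of its parent.\<close>

lemma image_eq_Union:
  assumes w: "set w \<subseteq> {..<N}" and v: "set v \<subseteq> {..<N'}" "f ` cyl N w \<subseteq> cyl N' v"
    and K: "L * (wt q v * F.pmax ^ K) \<le> wt p w"
  shows "f ` cyl N w = (\<Union>z\<in>{z \<in> words N' K. cyl N' (v @ z) \<subseteq> f ` cyl N w}. cyl N' (v @ z))"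
proof
  show "f ` cyl N w \<subseteq> (\<Union>z\<in>{z \<in> words N' K. cyl N' (v @ z) \<subseteq> f ` cyl N w}. cyl N' (v @ z))"
  proof
    fix y assume y: "y \<in> f ` cyl N w"
    then obtain z where z: "z \<in> words N' K" "y \<in> cyl N' (v @ z)"
      using v cyl_eq_Union_words[of N' v K] by blast
    have "L * wt q (v @ z) \<le> L * (wt q v * F.pmax ^ K)"
      using F.wt_le_pmax_power[of z] F.wt_pos[OF v(1)] z(1) L_ge_1
      by (auto simp: words_def intro!: mult_left_mono)
    then have "cyl N' (v @ z) \<subseteq> f ` cyl N w"
      using K w y z by (intro cyl_subset_image) auto
    with z show "y \<in> (\<Union>z\<in>{z \<in> words N' K. cyl N' (v @ z) \<subseteq> f ` cyl N w}. cyl N' (v @ z))"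
      by blast
  qed
qed blast

lemma image_disjoint:
  "length u = length v \<Longrightarrow> u \<noteq> v \<Longrightarrow> f ` cyl N u \<inter> f ` cyl N v = {}"
  using inj_on_image_Int[OF bij_betw_imp_inj_on[OF bij] cyl_subset_seqs cyl_subset_seqs, of u v]
  by (simp add: cyl_disjoint)

text \<open>
  For this \<open>K\<close>, the images of a cylinder and of each of its children are unions of cylinders
  of a common depth \<open>K\<close> below \<open>V w\<close>.
\<close>

definition K :: nat where
  "K = (SOME K. L\<^sup>2 * F.pmax ^ K \<le> E.pmin)"

lemma K: "L\<^sup>2 * F.pmax ^ K \<le> E.pmin"
proof -
  obtain n where "L\<^sup>2 * F.pmax ^ n < E.pmin"
    using F.ex_pmax_power_le[OF E.pmin_pos] by blast
  then have "\<exists>K. L\<^sup>2 * F.pmax ^ K \<le> E.pmin"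
    by (intro exI[of _ n]) simp
  then show ?thesis
    unfolding K_def by (rule someI_ex)
qed

text \<open>Two factors \<open>L\<close> have to be beaten, one from \<open>wt_V_le\<close> and one
  from the condition of \<open>cyl_subset_image\<close>; \<open>E.pmin\<close> pays for the extra
  letter of a child.\<close>

lemma depth_K:
  assumes w: "set w \<subseteq> {..<N}"
  shows "L * (wt q (V w) * F.pmax ^ K) \<le> wt p w"
    and "i < N \<Longrightarrow> L * (wt q (V w) * F.pmax ^ K) \<le> wt p (w @ [i])"
proof -
  have "L * (wt q (V w) * F.pmax ^ K) \<le> L * (L * wt p w * F.pmax ^ K)"
    using wt_V_le[OF w] L_ge_1 F.pmax_pos by (intro mult_left_mono mult_right_mono) auto
  also have "\<dots> = (L\<^sup>2 * F.pmax ^ K) * wt p w"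
    by (simp add: power2_eq_square)
  also have "\<dots> \<le> E.pmin * wt p w"
    using K E.wt_pos[OF w] by (intro mult_right_mono) auto
  finally have *: "L * (wt q (V w) * F.pmax ^ K) \<le> E.pmin * wt p w" .
  also have "\<dots> \<le> 1 * wt p w"
    using E.pmin_less_1 E.wt_pos[OF w] by (intro mult_right_mono) auto
  finally show "L * (wt q (V w) * F.pmax ^ K) \<le> wt p w" by simp
  assume "i < N"
  then have "E.pmin * wt p w \<le> wt p (w @ [i])"
    using E.pmin_le[of i] E.wt_pos[OF w] by simp
  with * show "L * (wt q (V w) * F.pmax ^ K) \<le> wt p (w @ [i])" by simp
qed

text \<open>A point of the image sits in some cylinder of depth \<open>K\<close> below
  \<open>V w\<close>, which is light enough to be swallowed. This yields positivity of
  \<open>m\<close>, and later disjoint cylinders for distinct words of equal length.\<close>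

lemma ex_cyl_subset_image:
  assumes w: "set w \<subseteq> {..<N}"
  obtains z where "z \<in> words N' K" "cyl N' (V w @ z) \<subseteq> f ` cyl N w"
proof -
  obtain x where x: "x \<in> cyl N w"
    using E.cyl_nonempty[OF w] by blast
  then obtain z where z: "z \<in> words N' K" "f x \<in> cyl N' (V w @ z)"
    using image_subset_V[OF w] cyl_eq_Union_words[of N' "V w" K] by blast
  then have set: "set (V w @ z) \<subseteq> {..<N'}"
    using set_V[OF w] by (auto simp: words_def)
  have "L * wt q (V w @ z) \<le> L * (wt q (V w) * F.pmax ^ K)"
    using F.wt_le_pmax_power[of z] F.wt_pos[OF set_V[OF w]] z(1) L_ge_1
    by (auto simp: words_def intro!: mult_left_mono)
  then have "cyl N' (V w @ z) \<subseteq> f ` cyl N w"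
    using depth_K(1)[OF w] w x z by (intro cyl_subset_image) auto
  with z show thesis using that by blast
qed

end

section \<open>Density of the transported self-similar measure\<close>

locale bilipschitz_measure = bilipschitz_coding +
  fixes \<nu> :: "(nat \<Rightarrow> nat) measure" and s :: real
  assumes s_pos: "0 < s"
    and sum_p: "(\<Sum>i<N. p i powr s) = 1"
    and prob: "prob_space \<nu>"
    and cyl_\<nu>: "set w \<subseteq> {..<N'} \<Longrightarrow> cyl N' w \<in> sets \<nu> \<and> measure \<nu> (cyl N' w) = wt q w powr s"
begin

interpretation prob_space \<nu> by (rule prob)

text \<open>The measure \<open>\<nu>\<close> transported to the source by the inverse of
  \<open>f\<close>, on cylinders only.\<close>

definition m :: "nat list \<Rightarrow> real" where
  "m w = measure \<nu> (f ` cyl N w)"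

text \<open>For words of a common length, this is the share of \<open>cyl N' v\<close> that the
  cylinders of \<open>v @ z\<close>, \<open>z \<in> Z\<close>, occupy under \<open>\<nu>\<close>. It
  is independent of \<open>v\<close>, and sets of words of length \<open>K\<close> give finitely
  many values.\<close>

definition mass :: "nat list set \<Rightarrow> real" where
  "mass Z = (\<Sum>z\<in>Z. wt q z powr s)"

lemma image_decomposition:
  assumes w: "set w \<subseteq> {..<N}" and v: "set v \<subseteq> {..<N'}" "f ` cyl N w \<subseteq> cyl N' v"
    and K: "L * (wt q v * F.pmax ^ K) \<le> wt p w"
  shows "f ` cyl N w \<in> sets \<nu>" and "\<exists>Z\<subseteq>words N' K. m w = wt q v powr s * mass Z"
proof -
  let ?Z = "{z \<in> words N' K. cyl N' (v @ z) \<subseteq> f ` cyl N w}"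
  note eq = image_eq_Union[OF assms]
  have meas: "cyl N' (v @ z) \<in> sets \<nu>" if "z \<in> ?Z" for z
    using that v by (intro cyl_\<nu>[THEN conjunct1]) (auto simp: words_def)
  have fin: "finite ?Z"
    by simp
  from meas fin show "f ` cyl N w \<in> sets \<nu>"
    by (subst eq) (rule sets.finite_UN)
  have "disjoint_family_on (\<lambda>z. cyl N' (v @ z)) ?Z"
    unfolding disjoint_family_on_def by (intro ballI impI cyl_disjoint) (auto simp: words_def)
  then have "m w = (\<Sum>z\<in>?Z. measure \<nu> (cyl N' (v @ z)))"
    unfolding m_def using meas fin by (subst eq) (intro finite_measure_finite_Union, auto)
  also have "\<dots> = (\<Sum>z\<in>?Z. wt q v powr s * wt q z powr s)"
  proof (rule sum.cong[OF refl])
    fix z assume "z \<in> ?Z"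
    then have z: "set z \<subseteq> {..<N'}" by (auto simp: words_def)
    with v have "measure \<nu> (cyl N' (v @ z)) = wt q (v @ z) powr s"
      by (intro cyl_\<nu>[THEN conjunct2]) auto
    with F.wt_pos[OF v(1)] F.wt_pos[OF z] show "measure \<nu> (cyl N' (v @ z)) = wt q v powr s * wt q z powr s"
      by (simp add: powr_mult)
  qed
  also have "\<dots> = wt q v powr s * mass ?Z"
    by (simp add: mass_def sum_distrib_left)
  finally show "\<exists>Z\<subseteq>words N' K. m w = wt q v powr s * mass Z"
    by (intro exI[of _ ?Z]) auto
qed

lemma image_measurable: "set w \<subseteq> {..<N} \<Longrightarrow> f ` cyl N w \<in> sets \<nu>"
  by (rule image_decomposition(1)[OF _ set_V image_subset_V depth_K(1)])

lemma m_eq_mass: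
  assumes "set w \<subseteq> {..<N}"
  obtains Z where "Z \<subseteq> words N' K" "m w = wt q (V w) powr s * mass Z"
  using image_decomposition(2)[OF assms set_V[OF assms] image_subset_V[OF assms] depth_K(1)[OF assms]]
  by blast

text \<open>The decomposition is below \<open>V w\<close>, not below \<open>V (w @ [i])\<close>: in
  the quotient by \<open>m w\<close> the factor \<open>wt q (V w) powr s\<close> then cancels, and
  finitely many quotients remain.\<close>

lemma m_child_eq_mass:
  assumes w: "set w \<subseteq> {..<N}" and i: "i < N"
  obtains Z where "Z \<subseteq> words N' K" "m (w @ [i]) = wt q (V w) powr s * mass Z"
proof -
  have "f ` cyl N (w @ [i]) \<subseteq> cyl N' (V w)"
    using image_subset_V[OF w] cyl_append_subset[of N w "[i]"] by auto
  from image_decomposition(2)[OF _ set_V[OF w] this depth_K(2)[OF w i]] w i that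
  show thesis by auto
qed

lemma m_children:
  assumes w: "set w \<subseteq> {..<N}"
  shows "m w = (\<Sum>i<N. m (w @ [i]))"
proof -
  have "f ` cyl N w = (\<Union>i<N. f ` cyl N (w @ [i]))"
    by (subst cyl_eq_Union_words[of N w "Suc 0"]) (auto simp: words_Suc image_UN)
  moreover have "disjoint_family_on (\<lambda>i. f ` cyl N (w @ [i])) {..<N}"
    unfolding disjoint_family_on_def by (auto simp: image_disjoint)
  ultimately show ?thesis
    unfolding m_def using w
    by (simp add: image_measurable finite_measure_finite_Union image_subset_iff)
qed

lemma m_le: "set w \<subseteq> {..<N} \<Longrightarrow> m w \<le> L powr s * wt p w powr s"
proof -
  assume w: "set w \<subseteq> {..<N}"
  have "m w \<le> measure \<nu> (cyl N' (V w))"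
    unfolding m_def using w by (intro finite_measure_mono image_subset_V cyl_\<nu>[THEN conjunct1] set_V)
  also have "\<dots> = wt q (V w) powr s"
    using w by (intro cyl_\<nu>[THEN conjunct2] set_V)
  also have "\<dots> \<le> (L * wt p w) powr s"
    using w s_pos wt_V_le[OF w] F.wt_pos[OF set_V[OF w]] by (intro powr_mono2) auto
  also have "\<dots> = L powr s * wt p w powr s"
    using L_ge_1 E.wt_pos[OF w] by (simp add: powr_mult)
  finally show ?thesis .
qed

lemma m_pos:
  assumes w: "set w \<subseteq> {..<N}"
  shows "0 < m w"
proof -
  obtain z where z: "z \<in> words N' K" "cyl N' (V w @ z) \<subseteq> f ` cyl N w"
    by (rule ex_cyl_subset_image[OF w])
  then have set: "set (V w @ z) \<subseteq> {..<N'}"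
    using set_V[OF w] by (auto simp: words_def)
  have "wt q (V w @ z) powr s \<le> m w"
    unfolding m_def using cyl_\<nu>[OF set] finite_measure_mono[OF z(2) image_measurable[OF w]] by simp
  with F.wt_pos[OF set] show ?thesis
    by (smt (verit) powr_gt_zero)
qed

text \<open>
  The density \<open>m w / wt p w powr s\<close> changes from a word to its children by a factor from a finite
  set. Near its supremum no factor greater than \<open>1\<close> is possible, so all the factors are \<open>1\<close>
  there, since their weighted mean is \<open>1\<close>.
\<close>

lemma ex_constant_density:
  obtains w g where "set w \<subseteq> {..<N}" "0 < g"
    "\<And>u. set u \<subseteq> {..<N} \<Longrightarrow> m (w @ u) = g * wt p (w @ u) powr s"
proof -
  define g where "g w = m w / wt p w powr s" for w
  define W where "W = {w. set w \<subseteq> {..<N}}"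
  define Q where "Q = (\<lambda>(Z, Z', i). mass Z' / mass Z / p i powr s) ` (Pow (words N' K) \<times> Pow (words N' K) \<times> {..<N})"
  have wtp: "0 < wt p w powr s" if "w \<in> W" for w
    using E.wt_pos[of w] that by (auto simp: W_def)
  have g_pos: "0 < g w" if "w \<in> W" for w
    using wtp[OF that] m_pos[of w] that by (simp add: g_def W_def)
  have g_le: "g w \<le> L powr s" if "w \<in> W" for w
    using wtp[OF that] m_le[of w] that by (simp add: g_def W_def divide_le_eq)
  have bdd: "bdd_above (g ` W)"
    using g_le by (intro bdd_aboveI2)
  have "finite Q"
    unfolding Q_def by (intro finite_imageI finite_cartesian_product) auto
  have quot: "g (w @ [i]) / g w \<in> Q" if w: "w \<in> W" and i: "i < N" for w i
  proof -
    have w': "set w \<subseteq> {..<N}" using w by (simp add: W_def)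
    obtain Z where Z: "Z \<subseteq> words N' K" "m w = wt q (V w) powr s * mass Z"
      by (rule m_eq_mass[OF w'])
    obtain Z' where Z': "Z' \<subseteq> words N' K" "m (w @ [i]) = wt q (V w) powr s * mass Z'"
      by (rule m_child_eq_mass[OF w' i])
    have "0 < wt q (V w) powr s" "0 < wt p w powr s" "0 < p i powr s"
      using F.wt_pos[OF set_V[OF w']] wtp[OF w] E.pos[OF i] by auto
    then have "g (w @ [i]) / g w = mass Z' / mass Z / p i powr s"
      using Z Z' E.wt_pos[OF w'] E.pos[OF i]
      by (simp add: g_def powr_mult field_simps)
    with Z Z' i show ?thesis
      unfolding Q_def by (intro image_eqI[of _ _ "(Z, Z', i)"]) auto
  qed
  \<comment> \<open>Finiteness of \<open>Q\<close> leaves a gap: no element lies strictly between 1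
    and \<open>\<eta>\<close>. The 2 only keeps the set nonempty.\<close>
  obtain \<eta> where \<eta>: "1 < \<eta>" "\<And>x. x \<in> Q \<Longrightarrow> x < \<eta> \<Longrightarrow> x \<le> 1"
  proof
    let ?\<eta> = "Min (insert 2 {x \<in> Q. 1 < x})"
    show "1 < ?\<eta>" using \<open>finite Q\<close> by simp
    show "x \<le> 1" if "x \<in> Q" "x < ?\<eta>" for x
      using that \<open>finite Q\<close> by (auto simp: not_less[symmetric])
  qed
  define \<Lambda> where "\<Lambda> = (SUP w\<in>W. g w)"
  have le_\<Lambda>: "g w \<le> \<Lambda>" if "w \<in> W" for w
    unfolding \<Lambda>_def by (rule cSUP_upper[OF that bdd])
  have "[] \<in> W" by (simp add: W_def)
  with le_\<Lambda> g_pos have "0 < \<Lambda>" by fastforce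
  then have "\<Lambda> / \<eta> < \<Lambda>" using \<eta>(1) by (simp add: field_simps)
  then obtain w where w: "w \<in> W" "\<Lambda> / \<eta> < g w"
    unfolding \<Lambda>_def using \<open>[] \<in> W\<close> bdd by (subst (asm) less_cSUP_iff) auto
  have step: "g (v @ [i]) = g v" if v: "v \<in> W" "\<Lambda> / \<eta> < g v" and i: "i < N" for v i
  proof -
    have vW: "v @ [j] \<in> W" if "j < N" for j using v that by (auto simp: W_def)
    have le: "g (v @ [j]) \<le> g v" if "j < N" for j
    proof -
      have "g (v @ [j]) < \<eta> * g v"
        using le_\<Lambda>[OF vW[OF that]] v(2) \<eta>(1) by (simp add: field_simps)
      then have "g (v @ [j]) / g v < \<eta>"
        using g_pos[OF v(1)] by (simp add: field_simps)
      then have "g (v @ [j]) / g v \<le> 1"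
        by (intro \<eta>(2) quot v that)
      then show ?thesis
        using g_pos[OF v(1)] by (simp add: field_simps)
    qed
    have m_g: "m u = g u * wt p u powr s" if "u \<in> W" for u
      using wtp[OF that] by (simp add: g_def)
    have "g v * wt p v powr s = (\<Sum>j<N. g (v @ [j]) * (wt p v powr s * p j powr s))"
      using m_children[of v] m_g[OF v(1)] m_g[OF vW] v E.wt_pos[of v] E.pos
      by (simp add: W_def powr_mult less_imp_le)
    also have "\<dots> = wt p v powr s * (\<Sum>j<N. g (v @ [j]) * p j powr s)"
      by (simp add: sum_distrib_left mult_ac)
    finally have "(\<Sum>j<N. g (v @ [j]) * p j powr s) = g v"
      using wtp[OF v(1)] by simp
    then have "(\<Sum>j<N. (g v - g (v @ [j])) * p j powr s) = 0"
      by (simp add: left_diff_distrib sum_subtractf sum_distrib_left[symmetric] sum_p)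
    then have "(g v - g (v @ [i])) * p i powr s = 0"
      using i le by (subst (asm) sum_nonneg_eq_0_iff) auto
    with E.pos[OF i] show ?thesis by simp
  qed
  have const: "g (w @ u) = g w" if "set u \<subseteq> {..<N}" for u
    using that
  proof (induction u rule: rev_induct)
    case (snoc i u)
    then have "g ((w @ u) @ [i]) = g (w @ u)"
      using w by (intro step) (auto simp: W_def)
    with snoc show ?case by simp
  qed simp
  show thesis
  proof (rule that[of w "g w"])
    show "set w \<subseteq> {..<N}" "0 < g w" using w g_pos by (auto simp: W_def)
    fix u assume u: "set u \<subseteq> {..<N}"
    with w have "w @ u \<in> W" by (auto simp: W_def)
    with const[OF u] wtp[OF this] show "m (w @ u) = g w * wt p (w @ u) powr s"
      by (simp add: g_def field_simps)
  qed
qed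

text \<open>Equating the constant density with the value from \<open>m_eq_mass\<close> and taking
  s-th roots leaves one factor \<open>\<beta>\<close> for each set \<open>Z\<close> of words of
  length \<open>K\<close>. The relation is an equality, as the count of bad letters
  requires.\<close>

lemma ex_finite_ratio_set:
  obtains w B where "set w \<subseteq> {..<N}" "finite B"
    "\<And>u. set u \<subseteq> {..<N} \<Longrightarrow> \<exists>\<beta>\<in>B. wt q (V (w @ u)) = \<beta> * wt p u"
proof -
  obtain w g where w: "set w \<subseteq> {..<N}" and g: "0 < g"
    and m: "\<And>u. set u \<subseteq> {..<N} \<Longrightarrow> m (w @ u) = g * wt p (w @ u) powr s"
    by (rule ex_constant_density) blast
  define B where "B = (\<lambda>Z. (g / mass Z) powr (1 / s) * wt p w) ` Pow (words N' K)"
  show thesis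
  proof (rule that[OF w])
    show "finite B" by (simp add: B_def)
    fix u assume u: "set u \<subseteq> {..<N}"
    then have wu: "set (w @ u) \<subseteq> {..<N}" using w by simp
    obtain Z where Z: "Z \<subseteq> words N' K" "m (w @ u) = wt q (V (w @ u)) powr s * mass Z"
      by (rule m_eq_mass[OF wu])
    have pos: "0 < wt q (V (w @ u))" "0 < wt p (w @ u)"
      using F.wt_pos[OF set_V[OF wu]] E.wt_pos[OF wu] by auto
    then have "0 < mass Z"
      using Z(2) m_pos[OF wu] by (simp add: zero_less_mult_iff)
    then have "wt q (V (w @ u)) powr s = g / mass Z * wt p (w @ u) powr s"
      using Z(2) m[OF u] by (simp add: field_simps)
    moreover have "(a * x powr s) powr (1 / s) = a powr (1 / s) * x" if "0 < a" "0 < x" for a x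
      using that s_pos by (simp add: powr_mult powr_powr)
    ultimately have "(wt q (V (w @ u)) powr s) powr (1 / s) = (g / mass Z) powr (1 / s) * wt p (w @ u)"
      using pos(2) g \<open>0 < mass Z\<close> by (simp only: divide_pos_pos)
    then have "wt q (V (w @ u)) = (g / mass Z) powr (1 / s) * wt p w * wt p u"
      using pos s_pos by (simp add: powr_powr)
    with Z(1) show "\<exists>\<beta>\<in>B. wt q (V (w @ u)) = \<beta> * wt p u"
      by (auto simp: B_def)
  qed
qed

end

section \<open>Letters that cannot occur in a word with a given ratio\<close>

text \<open>A monotone subsequence exists; a decreasing one of natural numbers is constant from its
  minimum on, so its tail is increasing too.\<close>

lemma ex_incseq_subseq:
  fixes c :: "nat \<Rightarrow> nat"
  obtains \<phi> where "strict_mono \<phi>" "incseq (\<lambda>n. c (\<phi> n))"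
proof -
  obtain \<phi> where \<phi>: "strict_mono \<phi>" "monoseq (\<lambda>n. c (\<phi> n))"
    using seq_monosub[of c] by blast
  show thesis
  proof (cases "incseq (\<lambda>n. c (\<phi> n))")
    case False
    with \<phi>(2) have dec: "decseq (\<lambda>n. c (\<phi> n))"
      by (simp add: monoseq_iff)
    obtain n0 where n0: "\<And>n. c (\<phi> n0) \<le> c (\<phi> n)"
      using ex_has_least_nat[of "\<lambda>_. True" 0 "\<lambda>n. c (\<phi> n)"] by auto
    have "c (\<phi> (n0 + n)) = c (\<phi> n0)" for n
      using n0[of "n0 + n"] decseqD[OF dec, of n0 "n0 + n"] by simp
    moreover have "strict_mono (\<lambda>n. \<phi> (n0 + n))"
      using \<phi>(1) by (simp add: strict_mono_def)
    ultimately show thesis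
      by (intro that[of "\<lambda>n. \<phi> (n0 + n)"]) auto
  qed (use that \<phi> in blast)
qed

lemma ex_incseq_subseq_family:
  fixes c :: "nat \<Rightarrow> 'i \<Rightarrow> nat"
  assumes "finite I"
  shows "\<exists>\<phi>. strict_mono \<phi> \<and> (\<forall>i\<in>I. incseq (\<lambda>n. c (\<phi> n) i))"
  using assms
proof induction
  case empty
  show ?case by (intro exI[of _ id]) (auto simp: strict_mono_def)
next
  case (insert j I)
  then obtain \<phi> where \<phi>: "strict_mono \<phi>" "\<forall>i\<in>I. incseq (\<lambda>n. c (\<phi> n) i)"
    by blast
  obtain \<psi> where \<psi>: "strict_mono \<psi>" "incseq (\<lambda>n. c (\<phi> (\<psi> n)) j)"
    using ex_incseq_subseq[of "\<lambda>n. c (\<phi> n) j"] by blast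
  have "incseq (\<lambda>n. c (\<phi> (\<psi> n)) i)" if "i \<in> I" for i
    using \<phi>(2) that strict_mono_mono[OF \<psi>(1)] by (auto simp: incseq_def mono_def)
  with \<psi> \<phi>(1) show ?case
    by (intro exI[of _ "\<lambda>n. \<phi> (\<psi> n)"]) (auto simp: strict_mono_def)
qed

lemma wt_eq_prod_count:
  "set v \<subseteq> {..<N} \<Longrightarrow> wt q v = (\<Prod>i<N. q i ^ count_list v i)"
proof (induction v)
  case (Cons j v)
  have "(\<Prod>i<N. q i ^ count_list (j # v) i) = (\<Prod>i<N. (if i = j then q j else 1) * q i ^ count_list v i)"
    by (intro prod.cong) auto
  also have "\<dots> = q j * wt q v"
    using Cons by (simp add: prod.distrib prod.delta)
  finally show ?case by simp
qed simp

lemma length_filter_eq_sum_count: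
  fixes v :: "nat list"
  shows "set v \<subseteq> {..<N} \<Longrightarrow> length (filter P v) = (\<Sum>i | i < N \<and> P i. count_list v i)"
proof (induction v)
  case (Cons j v)
  have "(\<Sum>i | i < N \<and> P i. count_list (j # v) i)
      = (\<Sum>i | i < N \<and> P i. (if i = j then 1 else 0) + count_list v i)"
    by (intro sum.cong) auto
  also have "\<dots> = (if P j then 1 else 0) + length (filter P v)"
  proof -
    have "finite {i. i < N \<and> P i}" by simp
    from sum.delta[OF this, of j "\<lambda>_. 1 :: nat"] Cons show ?thesis
      by (simp add: sum.distrib)
  qed
  finally show ?case by simp
qed simp

text \<open>
  Dickson's lemma, in the form of monotone subsequences, bounds the number of bad letters in the
  words of ratio \<open>\<beta> * r ^ k\<close>: the difference of two comparable exponent vectors has a ratio in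
  the group generated by \<open>r\<close>.
\<close>

lemma (in ratio_system) ex_bound_bad_letters:
  assumes r: "0 < r" "r < 1" and "finite B"
    and bad: "\<And>e k. \<exists>i<N. bad i \<and> 0 < e i \<Longrightarrow> (\<Prod>i<N. p i ^ e i) \<noteq> r ^ k"
  shows "\<exists>M. \<forall>v \<beta> k. set v \<subseteq> {..<N} \<longrightarrow> \<beta> \<in> B \<longrightarrow> wt p v = \<beta> * r ^ k
    \<longrightarrow> length (filter bad v) \<le> M"
proof -
  have "\<exists>M. \<forall>v k. set v \<subseteq> {..<N} \<and> wt p v = \<beta> * r ^ k \<longrightarrow> length (filter bad v) \<le> M" for \<beta>
  proof (rule ccontr)
    assume "\<not> ?thesis"
    then have "\<forall>n. \<exists>v k. set v \<subseteq> {..<N} \<and> wt p v = \<beta> * r ^ k \<and> n < length (filter bad v)"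
      by (auto simp: not_le)
    then obtain v k where vk: "\<And>n. set (v n) \<subseteq> {..<N}" "\<And>n. wt p (v n) = \<beta> * r ^ k n"
        "\<And>n. n < length (filter bad (v n))"
      by metis
    obtain \<phi> where \<phi>: "strict_mono \<phi>" "\<And>i. i < N \<Longrightarrow> incseq (\<lambda>n. count_list (v (\<phi> n)) i)"
      using ex_incseq_subseq_family[of "{..<N}" "\<lambda>n i. count_list (v n) i"] by auto
    \<comment> \<open>The word \<open>v (\<phi> n)\<close> has more than
      \<open>\<phi> n \<ge> n\<close> bad letters, hence more than
      \<open>v (\<phi> 0)\<close>.\<close>
    define n where "n = length (filter bad (v (\<phi> 0)))"
    let ?v = "v (\<phi> 0)" and ?w = "v (\<phi> n)"
    define e where "e i = count_list ?w i - count_list ?v i" for i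
    have le: "count_list ?v i \<le> count_list ?w i" if "i < N" for i
      using incseqD[OF \<phi>(2)[OF that], of 0 n] by simp
    have "length (filter bad ?v) < length (filter bad ?w)"
      using vk(3)[of "\<phi> n"] strict_mono_imp_increasing[OF \<phi>(1), of n] by (simp add: n_def)
    then have "\<exists>i<N. bad i \<and> count_list ?v i < count_list ?w i"
      unfolding length_filter_eq_sum_count[OF vk(1)]
      by (metis (no_types, lifting) mem_Collect_eq not_le sum_mono)
    then have e: "\<exists>i<N. bad i \<and> 0 < e i"
      by (auto simp: e_def)
    have v_pos: "0 < wt p (v n)" for n
      by (rule wt_pos[OF vk(1)])
    have "wt p ?w = (\<Prod>i<N. p i ^ e i) * wt p ?v"
      unfolding wt_eq_prod_count[OF vk(1)] prod.distrib[symmetric] power_add[symmetric]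
      by (intro prod.cong refl) (simp add: e_def le)
    then have "\<beta> * r ^ k (\<phi> n) = \<beta> * ((\<Prod>i<N. p i ^ e i) * r ^ k (\<phi> 0))"
      unfolding vk(2) by (simp add: mult_ac)
    moreover have "\<beta> \<noteq> 0"
      using v_pos[of 0] vk(2)[of 0] by auto
    ultimately have eq: "r ^ k (\<phi> n) = (\<Prod>i<N. p i ^ e i) * r ^ k (\<phi> 0)"
      by simp
    \<comment> \<open>The surplus letters have a product of at most 1, so the exponent of
      \<open>r\<close> cannot drop, and the quotient is a power of \<open>r\<close> with a natural
      exponent, which \<open>bad\<close> excludes.\<close>
    have "(\<Prod>i<N. p i ^ e i) \<le> 1"
      by (intro prod_le_1) (auto simp: pos less_1 less_imp_le power_le_one)
    then have "r ^ k (\<phi> n) \<le> r ^ k (\<phi> 0)"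
      unfolding eq using r by (intro mult_left_le_one_le) (auto intro!: prod_nonneg simp: pos less_imp_le)
    then have "k (\<phi> 0) \<le> k (\<phi> n)"
      using r by (simp add: power_decreasing_iff)
    then have "(\<Prod>i<N. p i ^ e i) = r ^ (k (\<phi> n) - k (\<phi> 0))"
      using eq r by (simp add: power_diff field_simps)
    with bad[OF e] show False by blast
  qed
  then obtain M where M: "\<And>\<beta> v k. set v \<subseteq> {..<N} \<Longrightarrow> wt p v = \<beta> * r ^ k
      \<Longrightarrow> length (filter bad v) \<le> M \<beta>"
    by metis
  have "M \<beta> \<le> (\<Sum>\<beta>\<in>B. M \<beta>)" if "\<beta> \<in> B" for \<beta>
    using member_le_sum[OF that, of M] \<open>finite B\<close> by simp
  with M show ?thesis
    by (intro exI[of _ "\<Sum>\<beta>\<in>B. M \<beta>"]) (meson le_trans)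
qed

section \<open>Comparison of power sums over the good letters\<close>

lemma (in ratio_system) wt_powr:
  "set w \<subseteq> {..<N} \<Longrightarrow> wt (\<lambda>i. p i powr t) w = wt p w powr t"
proof (induction w)
  case (Cons i w)
  then show ?case
    using wt_pos[of w] pos[of i] by (simp add: powr_mult)
qed simp

text \<open>All words of length \<open>j\<close> together weigh the j-th power of the sum, so the
  bound is the tail of a geometric series. \<open>Y\<close> may contain nested words.\<close>

lemma sum_wt_long_words_le:
  assumes a: "\<And>i. i < N \<Longrightarrow> 0 \<le> a i" "(\<Sum>i<N. a i) < 1"
    and Y: "finite Y" "\<And>y. y \<in> Y \<Longrightarrow> set y \<subseteq> {..<N} \<and> n \<le> length y"
  shows "(\<Sum>y\<in>Y. wt a y) \<le> (\<Sum>i<N. a i) ^ n / (1 - (\<Sum>i<N. a i))"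
proof -
  let ?Q = "\<Sum>i<N. a i"
  define m where "m = Max (insert n (length ` Y))"
  have nonneg: "0 \<le> wt a y" if "set y \<subseteq> {..<N}" for y
    using that a(1) by (induction y) auto
  have Q: "0 \<le> ?Q"
    using a(1) by (intro sum_nonneg) auto
  have "n \<le> m" unfolding m_def using Y(1) by (intro Max_ge) auto
  have Y_sub: "Y \<subseteq> (\<Union>j\<in>{n..m}. words N j)"
    using Y by (auto simp: words_def m_def intro!: Max_ge)
  have "(\<Sum>y\<in>Y. wt a y) \<le> (\<Sum>y\<in>(\<Union>j\<in>{n..m}. words N j). wt a y)"
  proof (intro sum_mono2 Y_sub)
    show "finite (\<Union>j\<in>{n..m}. words N j)" by simp
    show "0 \<le> wt a y" if "y \<in> (\<Union>j\<in>{n..m}. words N j) - Y" for y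
      using that by (intro nonneg) (auto simp: words_def)
  qed
  also have "\<dots> = (\<Sum>j=n..m. \<Sum>y\<in>words N j. wt a y)"
    by (intro sum.UNION_disjoint) (auto simp: words_def finite_words[unfolded words_def])
  also have "\<dots> = (\<Sum>j=n..m. ?Q ^ j)"
    by (simp add: sum_wt_words)
  also have "\<dots> = (?Q ^ n - ?Q ^ Suc m) / (1 - ?Q)"
    using a(2) \<open>n \<le> m\<close> by (simp add: sum_gp)
  also have "\<dots> \<le> ?Q ^ n / (1 - ?Q)"
    using a(2) Q by (intro divide_right_mono) auto
  finally show ?thesis .
qed

lemma (in bilipschitz_measure) good_sum_transfer:
  assumes r: "0 < r" "r < 1" and t: "0 < t"
    and complete: "\<And>u. set u \<subseteq> {i. i < N \<and> good i} \<Longrightarrow> \<exists>c k. set c \<subseteq> {..<N} \<and> wt p (u @ c) = r ^ k"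
    and bad: "\<And>e k. \<exists>i<N'. bad i \<and> 0 < e i \<Longrightarrow> (\<Prod>i<N'. q i ^ e i) \<noteq> r ^ k"
    and sum_good: "1 \<le> (\<Sum>i | i < N \<and> good i. p i powr t)"
  shows "1 \<le> (\<Sum>i | i < N' \<and> \<not> bad i. q i powr t)"
proof (rule ccontr)
  assume "\<not> ?thesis"
  then have less: "(\<Sum>i | i < N' \<and> \<not> bad i. q i powr t) < 1" by simp
  obtain w B where w: "set w \<subseteq> {..<N}" and B: "finite B"
      "\<And>u. set u \<subseteq> {..<N} \<Longrightarrow> \<exists>\<beta>\<in>B. wt q (V (w @ u)) = \<beta> * wt p u"
    by (rule ex_finite_ratio_set) blast
  obtain M where M: "\<And>v \<beta> k. set v \<subseteq> {..<N'} \<Longrightarrow> \<beta> \<in> B \<Longrightarrow> wt q v = \<beta> * r ^ k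
      \<Longrightarrow> length (filter bad v) \<le> M"
    using F.ex_bound_bad_letters[where bad = bad, OF r B(1) bad] by metis
  have "\<exists>z. z \<in> words N' K \<and> cyl N' (V (w @ u) @ z) \<subseteq> f ` cyl N (w @ u)" if "set u \<subseteq> {..<N}" for u
    using ex_cyl_subset_image[of "w @ u"] w that by (metis le_sup_iff set_append)
  then obtain z where z: "\<And>u. set u \<subseteq> {..<N} \<Longrightarrow> z u \<in> words N' K"
      "\<And>u. set u \<subseteq> {..<N} \<Longrightarrow> cyl N' (V (w @ u) @ z u) \<subseteq> f ` cyl N (w @ u)"
    by metis
  define y where "y u = V (w @ u) @ z u" for u
  have set_z: "set (z u) \<subseteq> {..<N'}" if "set u \<subseteq> {..<N}" for u
    using z(1)[OF that] by (auto simp: words_def)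
  have set_y: "set (y u) \<subseteq> {..<N'}" if "set u \<subseteq> {..<N}" for u
    using set_z[OF that] set_V[of "w @ u"] w that by (simp add: y_def)
  \<comment> \<open>Completing \<open>u\<close> by \<open>c\<close> makes the ratio a power of
    \<open>r\<close>, so \<open>M\<close> applies to the completed word. Its \<open>V\<close>
    extends \<open>V (w @ u)\<close>, which thus has no more bad letters; the \<open>K\<close>
    letters of \<open>z u\<close> may all be bad.\<close>
  have bad_y: "length (filter bad (y u)) \<le> M + K" if u: "set u \<subseteq> {i. i < N \<and> good i}" for u
  proof -
    have uN: "set u \<subseteq> {..<N}" using u by auto
    obtain c k where c: "set c \<subseteq> {..<N}" "wt p (u @ c) = r ^ k"
      using complete[OF u] by blast
    have wuc: "set ((w @ u) @ c) \<subseteq> {..<N}" using w uN c by simp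
    obtain x where x: "V ((w @ u) @ c) = V (w @ u) @ x"
      by (rule V_append[OF wuc])
    obtain \<beta> where "\<beta> \<in> B" "wt q (V (w @ (u @ c))) = \<beta> * r ^ k"
      using B(2)[of "u @ c"] uN c by auto
    then have "length (filter bad (V ((w @ u) @ c))) \<le> M"
      by (intro M[OF set_V[OF wuc], of \<beta> k]) simp_all
    moreover have "length (filter bad (z u)) \<le> K"
      using z(1)[OF uN] length_filter_le[of bad "z u"] by (simp add: words_def)
    ultimately show ?thesis
      using x by (simp add: y_def)
  qed
  \<comment> \<open>The losses collected: the \<open>K\<close> letters of \<open>z u\<close>, the
    fixed prefix \<open>w\<close> and the distortion \<open>L\<close>.\<close>
  define c0 where "c0 = F.pmin ^ K * wt p w / L"
  have c0: "0 < c0"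
    using F.pmin_pos E.wt_pos[OF w] L_ge_1 by (simp add: c0_def)
  have wt_y: "c0 * wt p u \<le> wt q (y u)" "wt q (y u) \<le> L * E.pmax ^ length u"
    if u: "set u \<subseteq> {..<N}" for u
  proof -
    have wu: "set (w @ u) \<subseteq> {..<N}" using w u by simp
    have "c0 * wt p u = F.pmin ^ K * (wt p (w @ u) / L)"
      by (simp add: c0_def)
    also have "\<dots> \<le> wt q (z u) * wt q (V (w @ u))"
      using F.pmin_power_le_wt[OF set_z[OF u]] z(1)[OF u] wt_le_V[OF wu] L_ge_1 F.pmin_pos E.wt_pos[OF wu]
        F.wt_pos[OF set_z[OF u]]
      by (intro mult_mono) (auto simp: words_def field_simps)
    finally show "c0 * wt p u \<le> wt q (y u)"
      by (simp add: y_def mult_ac)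
    have "wt q (y u) \<le> wt q (V (w @ u))"
      using F.wt_le_1[OF set_z[OF u]] F.wt_pos[OF set_V[OF wu]] by (simp add: y_def mult_left_le)
    also have "\<dots> \<le> L * (wt p w * wt p u)"
      using wt_V_le[OF wu] by simp
    also have "\<dots> \<le> L * (1 * E.pmax ^ length u)"
      using E.wt_le_1[OF w] E.wt_le_pmax_power[OF u] E.wt_pos[OF u] L_ge_1
      by (intro mult_left_mono mult_mono) auto
    finally show "wt q (y u) \<le> L * E.pmax ^ length u" by simp
  qed
  \<comment> \<open>Distinct words of equal length have disjoint images, and the nonempty cylinder
    of \<open>y u\<close> lies in the image belonging to \<open>u\<close>.\<close>
  have y_inj: "inj_on y (words N n)" for n
  proof (rule inj_onI, rule ccontr)
    fix u u' assume u: "u \<in> words N n" "u' \<in> words N n" "y u = y u'" "u \<noteq> u'"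
    then have "cyl N' (y u) \<subseteq> f ` cyl N (w @ u) \<inter> f ` cyl N (w @ u')"
      using z(2)[of u] z(2)[of u'] by (auto simp: words_def y_def)
    also have "\<dots> = {}"
      using u by (intro image_disjoint) (auto simp: words_def)
    finally show False
      using F.cyl_nonempty[OF set_y, of u] u by (auto simp: words_def)
  qed
  define P where "P = (\<Sum>i | i < N' \<and> bad i. q i powr t)"
  define G where "G = (\<Sum>i | i < N' \<and> \<not> bad i. q i powr t)"
  \<comment> \<open>The bad letters then contribute at most half of the gap \<open>1 - G\<close>;
    the \<open>+ 1\<close> prevents a zero denominator when there are none.\<close>
  define \<epsilon> where "\<epsilon> = (1 - G) / (2 * (P + 1))"
  have nonneg: "0 \<le> P" "0 \<le> G"
    by (auto simp: P_def G_def intro!: sum_nonneg)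
  with less have \<epsilon>: "0 < \<epsilon>" "\<epsilon> \<le> 1"
    by (auto simp: \<epsilon>_def G_def[symmetric] field_simps)
  define a where "a i = q i powr t * (if bad i then \<epsilon> else 1)" for i
  define Q where "Q = (\<Sum>i<N'. a i)"
  have "{..<N'} = {i. i < N' \<and> \<not> bad i} \<union> {i. i < N' \<and> bad i}" by auto
  then have "Q = (\<Sum>i\<in>{i. i < N' \<and> \<not> bad i} \<union> {i. i < N' \<and> bad i}. a i)"
    by (simp add: Q_def)
  also have "\<dots> = G + P * \<epsilon>"
    by (subst sum.union_disjoint) (auto simp: a_def G_def P_def sum_distrib_right)
  also have "\<dots> \<le> G + (1 - G) / 2"
    using nonneg less by (simp add: \<epsilon>_def G_def[symmetric] field_simps mult_left_mono)
  also have "\<dots> < 1" using less by (simp add: G_def[symmetric] field_simps)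
  finally have "Q < 1" .
  have "0 \<le> Q"
    using \<epsilon> by (auto simp: Q_def a_def intro!: sum_nonneg)
  have wt_a: "wt q v powr t * \<epsilon> ^ length (filter bad v) = wt a v" if "set v \<subseteq> {..<N'}" for v
    using that
  proof (induction v)
    case (Cons i v)
    then show ?case
      using F.wt_pos[of v] F.pos[of i] by (auto simp: a_def powr_mult)
  qed simp
  \<comment> \<open>The ratio loses the factor \<open>c0\<close>, and \<open>\<epsilon>\<close>
    occurs at most \<open>M + K\<close> times.\<close>
  define D where "D = (1 / c0) powr t * (1 / \<epsilon>) ^ (M + K)"
  have "0 \<le> D" using \<epsilon> by (simp add: D_def)
  have term_le: "wt p u powr t \<le> D * wt a (y u)" if u: "set u \<subseteq> {i. i < N \<and> good i}" for u
  proof -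
    have uN: "set u \<subseteq> {..<N}" using u by auto
    have "wt p u powr t \<le> (1 / c0 * wt q (y u)) powr t"
      using wt_y(1)[OF uN] c0 t E.wt_pos[OF uN] by (intro powr_mono2) (auto simp: field_simps)
    also have "\<dots> = (1 / c0) powr t * wt q (y u) powr t"
      by (rule powr_mult)
    also have "\<dots> \<le> (1 / c0) powr t * ((1 / \<epsilon>) ^ (M + K) * wt a (y u))"
    proof (intro mult_left_mono)
      have "\<epsilon> ^ (M + K) \<le> \<epsilon> ^ length (filter bad (y u))"
        using \<epsilon> bad_y[OF u] by (intro power_decreasing) auto
      then have "wt q (y u) powr t * \<epsilon> ^ (M + K) \<le> wt a (y u)"
        unfolding wt_a[OF set_y[OF uN], symmetric] by (intro mult_left_mono) auto
      then show "wt q (y u) powr t \<le> (1 / \<epsilon>) ^ (M + K) * wt a (y u)"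
        using \<epsilon> by (simp add: power_divide field_simps)
    qed simp
    finally show ?thesis by (simp add: D_def)
  qed
  have "(\<lambda>n. D * (Q ^ n / (1 - Q))) \<longlonglongrightarrow> D * (0 / (1 - Q))"
    using \<open>0 \<le> Q\<close> \<open>Q < 1\<close> by (intro tendsto_intros LIMSEQ_power_zero) auto
  then have "\<forall>\<^sub>F n in sequentially. D * (Q ^ n / (1 - Q)) < 1"
    by (rule order_tendstoD) simp
  then obtain n0 where n0: "D * (Q ^ n0 / (1 - Q)) < 1"
    using eventually_happens by fastforce
  \<comment> \<open>A word shorter than \<open>n0\<close> has ratio at least
    \<open>F.pmin ^ n0\<close>, while \<open>y u\<close> has ratio at most
    \<open>L * E.pmax ^ n\<close>. For this \<open>n\<close> every \<open>y u\<close> is therefore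
    long.\<close>
  obtain n where n: "L * E.pmax ^ n < F.pmin ^ n0"
    using E.ex_pmax_power_le[of "F.pmin ^ n0" L] F.pmin_pos by auto
  define U where "U = {u \<in> words N n. \<forall>i\<in>set u. good i}"
  have U: "set u \<subseteq> {i. i < N \<and> good i}" "set u \<subseteq> {..<N}" "length u = n" if "u \<in> U" for u
    using that by (auto simp: U_def words_def)
  have long: "n0 \<le> length (y u)" if "u \<in> U" for u
  proof (rule ccontr)
    assume "\<not> n0 \<le> length (y u)"
    then have "F.pmin ^ n0 \<le> F.pmin ^ length (y u)"
      using F.pmin_pos F.pmin_less_1 by (intro power_decreasing) auto
    also have "\<dots> \<le> wt q (y u)"
      by (rule F.pmin_power_le_wt[OF set_y[OF U(2)[OF that]]])
    also have "\<dots> \<le> L * E.pmax ^ n"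
      using wt_y(2)[OF U(2)[OF that]] U(3)[OF that] by simp
    finally show False using n by simp
  qed
  have "1 \<le> (\<Sum>i | i < N \<and> good i. p i powr t) ^ n"
    using sum_good by simp
  also have "\<dots> = (\<Sum>u\<in>U. wt (\<lambda>i. p i powr t) u)"
    unfolding U_def by (rule wt_restrict[symmetric])
  also have "\<dots> \<le> (\<Sum>u\<in>U. D * wt a (y u))"
    using E.wt_powr term_le U by (intro sum_mono) auto
  also have "\<dots> = D * (\<Sum>v\<in>y ` U. wt a v)"
    using inj_on_subset[OF y_inj[of n], of U] by (simp add: sum.reindex sum_distrib_left U_def)
  also have "\<dots> \<le> D * (Q ^ n0 / (1 - Q))"
    unfolding Q_def
  proof (rule mult_left_mono[OF sum_wt_long_words_le \<open>0 \<le> D\<close>])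
    show "0 \<le> a i" for i using \<epsilon> by (simp add: a_def)
    show "(\<Sum>i<N'. a i) < 1" using \<open>Q < 1\<close> by (simp add: Q_def)
    show "finite (y ` U)" by (simp add: U_def)
    show "set v \<subseteq> {..<N'} \<and> n0 \<le> length v" if "v \<in> y ` U" for v
      using that set_y U(2) long by blast
  qed
  also have "\<dots> < 1" by (rule n0)
  finally show False by simp
qed

section \<open>Sets coded by sequences\<close>

text \<open>A bi-Lipschitz parametrisation by the code space. Both the dimension and the Lipschitz
  comparison depend on a self-similar set through this alone.\<close>

definition coded :: "nat \<Rightarrow> (nat \<Rightarrow> real) \<Rightarrow> 'a metric \<Rightarrow> 'a set \<Rightarrow> bool" where
  "coded N p m A \<longleftrightarrow> A \<subseteq> mspace m \<and>
     (\<exists>\<pi> c C. bij_betw \<pi> (seqs N) A \<and> 0 < c \<and> 0 < C \<and>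
        (\<forall>x\<in>seqs N. \<forall>y\<in>seqs N. c * udist p x y \<le> mdist m (\<pi> x) (\<pi> y) \<and>
           mdist m (\<pi> x) (\<pi> y) \<le> C * udist p x y))"

lemma coded_cong:
  assumes "\<And>i. i < N \<Longrightarrow> p i = q i" "coded N p m A"
  shows "coded N q m A"
proof -
  have "wt p w = wt q w" if "set w \<subseteq> {..<N}" for w
    using that by (induction w) (simp_all add: assms(1))
  then have "udist p x y = udist q x y" if "x \<in> seqs N" for x y
    using pre_mem_words[OF that] by (simp add: udist_def words_def)
  with assms(2) show ?thesis
    by (simp add: coded_def)
qed

lemma Lipschitz_equivalent_sym:
  assumes "Lipschitz_equivalent m1 m2"
  shows "Lipschitz_equivalent m2 m1"
proof -
  obtain f L where f: "bij_betw f (mspace m1) (mspace m2)" "1 \<le> L"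
    "\<And>x y. x \<in> mspace m1 \<Longrightarrow> y \<in> mspace m1 \<Longrightarrow>
       mdist m1 x y / L \<le> mdist m2 (f x) (f y) \<and> mdist m2 (f x) (f y) \<le> L * mdist m1 x y"
    using assms unfolding Lipschitz_equivalent_def by blast
  let ?g = "inv_into (mspace m1) f"
  have g: "bij_betw ?g (mspace m2) (mspace m1)"
    by (rule bij_betw_inv_into[OF f(1)])
  have "mdist m2 x y / L \<le> mdist m1 (?g x) (?g y) \<and> mdist m1 (?g x) (?g y) \<le> L * mdist m2 x y"
    if "x \<in> mspace m2" "y \<in> mspace m2" for x y
    using f(2) f(3)[of "?g x" "?g y"] that bij_betw_apply[OF g] bij_betw_inv_into_right[OF f(1)]
    by (simp add: field_simps)
  with g f(2) show ?thesis
    unfolding Lipschitz_equivalent_def by blast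
qed

lemma bilipschitz_coding_of_Lipschitz_equivalent:
  assumes E: "ratio_system N p" "coded N p m1 A1" and F: "ratio_system N' q" "coded N' q m2 A2"
    and equiv: "Lipschitz_equivalent (submetric m1 A1) (submetric m2 A2)"
  obtains f L where "bilipschitz_coding N p N' q f L"
proof -
  obtain \<pi> c C where \<pi>: "bij_betw \<pi> (seqs N) A1" "0 < c" "0 < C"
    "\<And>x y. x \<in> seqs N \<Longrightarrow> y \<in> seqs N \<Longrightarrow> c * udist p x y \<le> mdist m1 (\<pi> x) (\<pi> y)"
    "\<And>x y. x \<in> seqs N \<Longrightarrow> y \<in> seqs N \<Longrightarrow> mdist m1 (\<pi> x) (\<pi> y) \<le> C * udist p x y"
    using E(2) unfolding coded_def by blast
  obtain \<rho> b B where \<rho>: "bij_betw \<rho> (seqs N') A2" "0 < b" "0 < B"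
    "\<And>x y. x \<in> seqs N' \<Longrightarrow> y \<in> seqs N' \<Longrightarrow> b * udist q x y \<le> mdist m2 (\<rho> x) (\<rho> y)"
    "\<And>x y. x \<in> seqs N' \<Longrightarrow> y \<in> seqs N' \<Longrightarrow> mdist m2 (\<rho> x) (\<rho> y) \<le> B * udist q x y"
    using F(2) unfolding coded_def by blast
  have A: "A1 \<inter> mspace m1 = A1" "A2 \<inter> mspace m2 = A2" "mspace m1 \<inter> A1 = A1" "mspace m2 \<inter> A2 = A2"
    using E(2) F(2) by (auto simp: coded_def)
  obtain g L where g: "bij_betw g A1 A2" "1 \<le> L"
    "\<And>x y. x \<in> A1 \<Longrightarrow> y \<in> A1 \<Longrightarrow> mdist m1 x y / L \<le> mdist m2 (g x) (g y)"
    "\<And>x y. x \<in> A1 \<Longrightarrow> y \<in> A1 \<Longrightarrow> mdist m2 (g x) (g y) \<le> L * mdist m1 x y"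
    using equiv unfolding Lipschitz_equivalent_def by (auto simp: A)
  define h where "h = inv_into (seqs N') \<rho>"
  have h: "bij_betw h A2 (seqs N')"
    unfolding h_def by (rule bij_betw_inv_into[OF \<rho>(1)])
  define f where "f = h \<circ> (g \<circ> \<pi>)"
  have bij: "bij_betw f (seqs N) (seqs N')"
    unfolding f_def by (intro bij_betw_trans[OF _ h] bij_betw_trans[OF \<pi>(1) g(1)])
  have \<rho>f: "\<rho> (f x) = g (\<pi> x)" if "x \<in> seqs N" for x
    unfolding f_def h_def o_def
    using that \<pi>(1) g(1) by (intro bij_betw_inv_into_right[OF \<rho>(1)]) (auto simp: bij_betw_def)
  \<comment> \<open>In each direction the composite costs \<open>L\<close> times the upper constant
    of one coding over the lower constant of the other.\<close>
  define K where "K = max 1 (max (L * B / c) (L * C / b))"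
  have K: "1 \<le> K" "L * B / c \<le> K" "L * C / b \<le> K"
    by (auto simp: K_def)
  interpret E: ratio_system N p by (rule E)
  interpret F: ratio_system N' q by (rule F)
  have nonneg: "0 \<le> udist p x y" if "x \<in> seqs N" for x y
    using E.wt_pos[OF E.set_pre_subset[OF that]] by (auto simp: udist_def less_imp_le)
  have nonneg': "0 \<le> udist q x y" if "x \<in> seqs N'" for x y
    using F.wt_pos[OF F.set_pre_subset[OF that]] by (auto simp: udist_def less_imp_le)
  show thesis
  proof (rule that, unfold_locales)
    show "bij_betw f (seqs N) (seqs N')" "1 \<le> K" by fact+
    fix x y assume xy: "x \<in> seqs N" "y \<in> seqs N"
    then have fxy: "f x \<in> seqs N'" "f y \<in> seqs N'" and \<pi>xy: "\<pi> x \<in> A1" "\<pi> y \<in> A1"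
      using bij \<pi>(1) by (auto simp: bij_betw_def)
    have "c * udist p x y \<le> mdist m1 (\<pi> x) (\<pi> y)"
      by (rule \<pi>(4)[OF xy])
    also have "\<dots> \<le> L * mdist m2 (\<rho> (f x)) (\<rho> (f y))"
      using g(3)[OF \<pi>xy] g(2) xy by (simp add: \<rho>f field_simps)
    also have "\<dots> \<le> L * (B * udist q (f x) (f y))"
      using \<rho>(5)[OF fxy] g(2) by (intro mult_left_mono) auto
    finally have "udist p x y \<le> L * B / c * udist q (f x) (f y)"
      using \<pi>(2) by (simp add: field_simps)
    also have "\<dots> \<le> K * udist q (f x) (f y)"
      by (intro mult_right_mono K nonneg' fxy)
    finally show "udist p x y \<le> K * udist q (f x) (f y)" .
    have "b * udist q (f x) (f y) \<le> mdist m2 (g (\<pi> x)) (g (\<pi> y))"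
      using \<rho>(4)[OF fxy] xy by (simp add: \<rho>f)
    also have "\<dots> \<le> L * mdist m1 (\<pi> x) (\<pi> y)"
      by (rule g(4)[OF \<pi>xy])
    also have "\<dots> \<le> L * (C * udist p x y)"
      using \<pi>(5)[OF xy] g(2) by (intro mult_left_mono) auto
    finally have "udist q (f x) (f y) \<le> L * C / b * udist p x y"
      using \<rho>(2) by (simp add: field_simps)
    also have "\<dots> \<le> K * udist p x y"
      by (intro mult_right_mono K nonneg xy)
    finally show "udist q (f x) (f y) \<le> K * udist p x y" .
  qed
qed

section \<open>Similarity dimension and Hausdorff dimension of coded sets\<close>

context ratio_system
begin

lemma sum_powr_strict_antimono:
  assumes "s < t"
  shows "(\<Sum>i<N. p i powr t) < (\<Sum>i<N. p i powr s)"
  using assms two_le pos less_1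
  by (intro sum_strict_mono) (auto intro!: powr_less_mono' simp: lessThan_empty_iff)

text \<open>Moran's equation is solved by the intermediate value theorem: the sum is
  \<open>N \<ge> 2\<close> at 0 and at most \<open>N * pmax ^ n < 1\<close> at a large integer
  \<open>n\<close>.\<close>

lemma ex_similarity_dimension:
  obtains s where "0 < s" "(\<Sum>i<N. p i powr s) = 1"
proof -
  obtain n where n: "real N * pmax ^ n < 1"
    using ex_pmax_power_le[of 1 "real N"] by auto
  have "(\<Sum>i<N. p i powr real n) \<le> (\<Sum>i<N. pmax ^ n)"
    using pos le_pmax by (intro sum_mono) (auto simp: powr_realpow less_imp_le intro!: power_mono)
  with n have "(\<Sum>i<N. p i powr real n) \<le> 1" by simp
  moreover have "1 \<le> (\<Sum>i<N. p i powr 0)"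
    using two_le pos by (simp add: less_imp_neq[symmetric])
  moreover have "continuous_on {0..real n} (\<lambda>t. \<Sum>i<N. p i powr t)"
    using pos by (intro continuous_intros) (auto simp: less_imp_neq[symmetric])
  ultimately obtain s where s: "0 \<le> s" "(\<Sum>i<N. p i powr s) = 1"
    using IVT2'[of "\<lambda>t. \<Sum>i<N. p i powr t" "real n" 1 0] by auto
  moreover have "s \<noteq> 0"
    using s(2) two_le pos by (auto simp: less_imp_neq[symmetric])
  ultimately show thesis using that[of s] by simp
qed

text \<open>The images of the cylinders of length \<open>n\<close> cover \<open>A\<close> with
  diameters at most \<open>C * wt p w\<close>. The t-th powers sum to at most
  \<open>C powr t * Q ^ n\<close>, and \<open>Q < 1\<close> because \<open>s < t\<close>.\<close>

lemma Hausdorff_measure_coded_eq_0: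
  assumes "coded N p m A" and s: "(\<Sum>i<N. p i powr s) = 1" and t: "s < t" "0 < t"
  shows "Hausdorff_measure m t A = 0"
proof -
  obtain \<pi> C where \<pi>: "bij_betw \<pi> (seqs N) A" "0 < C" and A: "A \<subseteq> mspace m"
    and up: "\<And>x y. x \<in> seqs N \<Longrightarrow> y \<in> seqs N \<Longrightarrow> mdist m (\<pi> x) (\<pi> y) \<le> C * udist p x y"
    using assms(1) unfolding coded_def by blast
  have dist_le: "mdist m (\<pi> x) (\<pi> y) \<le> C * wt p w" if "x \<in> cyl N w" "y \<in> cyl N w" for x y w
  proof -
    have "mdist m (\<pi> x) (\<pi> y) \<le> C * udist p x y"
      using that by (intro up) (auto simp: cyl_def)
    also have "\<dots> \<le> C * wt p w"
      using that \<pi>(2) by (intro mult_left_mono udist_le_wt) auto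
    finally show ?thesis .
  qed
  define Q where "Q = (\<Sum>i<N. p i powr t)"
  have Q: "0 \<le> Q" "Q < 1"
    using sum_powr_strict_antimono[OF t(1)] s by (auto simp: Q_def intro!: sum_nonneg)
  have bound: "Hausdorff_premeasure m t \<delta> A \<le> ennreal (C powr t * Q ^ n)" if n: "C * pmax ^ n < \<delta>" for \<delta> n
  proof -
    obtain h where h: "bij_betw h {0..<card (words N n)} (words N n)"
      using ex_bij_betw_nat_finite[OF finite_words] by blast
    let ?k = "card (words N n)"
    \<comment> \<open>The finite cover is padded to a sequence by empty sets, which contribute
      nothing: their \<open>mdiam\<close> is 0 and \<open>0 powr t = 0\<close>.\<close>
    define U where "U i = (if i < ?k then \<pi> ` cyl N (h i) else {})" for i
    have hw: "h i \<in> words N n" if "i < ?k" for i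
      using h that by (auto simp: bij_betw_def)
    have set_h: "set (h i) \<subseteq> {..<N}" "length (h i) = n" if "i < ?k" for i
      using hw[OF that] by (auto simp: words_def)
    have "A = (\<Union>i. U i)"
    proof -
      have "A = \<pi> ` cyl N []"
        using \<pi>(1) by (simp add: bij_betw_def)
      also have "\<dots> = (\<Union>w\<in>words N n. \<pi> ` cyl N w)"
        by (subst cyl_eq_Union_words[of N "[]" n]) auto
      also have "\<dots> = (\<Union>i\<in>{0..<?k}. \<pi> ` cyl N (h i))"
        by (subst bij_betw_imp_surj_on[OF h, symmetric]) simp
      finally show ?thesis
        by (auto simp: U_def)
    qed
    moreover have "U i \<subseteq> mspace m \<and> (\<forall>x\<in>U i. \<forall>y\<in>U i. mdist m x y \<le> \<delta>)" for i
    proof (cases "i < ?k")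
      case True
      have "U i \<subseteq> mspace m"
        using \<open>A = (\<Union>i. U i)\<close> A by blast
      moreover have "mdist m x y \<le> \<delta>" if "x \<in> U i" "y \<in> U i" for x y
      proof -
        have "mdist m x y \<le> C * wt p (h i)"
          using that True dist_le by (auto simp: U_def)
        also have "\<dots> \<le> C * pmax ^ n"
          using wt_le_pmax_power[OF set_h(1)[OF True]] set_h(2)[OF True] \<pi>(2) by (intro mult_left_mono) auto
        finally show ?thesis using n by simp
      qed
      ultimately show ?thesis by blast
    qed (simp add: U_def)
    ultimately have "Hausdorff_premeasure m t \<delta> A \<le> (\<Sum>i. ennreal (mdiam m (U i) powr t))"
      unfolding Hausdorff_premeasure_def by (intro Inf_lower) auto
    also have "\<dots> = (\<Sum>i<?k. ennreal (mdiam m (U i) powr t))"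
      by (rule suminf_finite) (auto simp: U_def mdiam_def)
    also have "\<dots> \<le> (\<Sum>i<?k. ennreal (C powr t * wt (\<lambda>i. p i powr t) (h i)))"
    proof (intro sum_mono ennreal_leI)
      fix i assume "i \<in> {..<?k}"
      then have i: "i < ?k" by simp
      have ne: "U i \<noteq> {}"
        using cyl_nonempty[OF set_h(1)[OF i]] i by (simp add: U_def)
      have "mdiam m (U i) = (SUP (x, y)\<in>U i \<times> U i. mdist m x y)"
        using ne by (simp add: mdiam_def)
      also have "\<dots> \<le> C * wt p (h i)"
        using ne i dist_le by (intro cSUP_least) (auto simp: U_def)
      finally have "mdiam m (U i) \<le> C * wt p (h i)" .
      moreover have "0 \<le> mdiam m (U i)"
      proof -
        obtain x where "x \<in> U i" using ne by blast
        have "bdd_above ((\<lambda>(x, y). mdist m x y) ` (U i \<times> U i))"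
          using i dist_le by (intro bdd_aboveI[of _ "C * wt p (h i)"]) (auto simp: U_def)
        then have "mdist m x x \<le> mdiam m (U i)"
          using ne \<open>x \<in> U i\<close> cSUP_upper[of "(x, x)" "U i \<times> U i" "\<lambda>(x, y). mdist m x y"]
          by (simp add: mdiam_def)
        then show ?thesis
          by (rule order_trans[OF mdist_nonneg])
      qed
      ultimately have "mdiam m (U i) powr t \<le> (C * wt p (h i)) powr t"
        using t by (intro powr_mono2) auto
      then show "mdiam m (U i) powr t \<le> C powr t * wt (\<lambda>i. p i powr t) (h i)"
        by (simp add: powr_mult wt_powr[OF set_h(1)[OF i]])
    qed
    also have "\<dots> = ennreal (\<Sum>i<?k. C powr t * wt (\<lambda>i. p i powr t) (h i))"
    proof (intro sum_ennreal)
      fix i assume "i \<in> {..<?k}"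
      then show "0 \<le> C powr t * wt (\<lambda>i. p i powr t) (h i)"
        using wt_powr[OF set_h(1)] by simp
    qed
    also have "(\<Sum>i<?k. C powr t * wt (\<lambda>i. p i powr t) (h i)) = C powr t * Q ^ n"
      using sum.reindex_bij_betw[OF h, of "wt (\<lambda>i. p i powr t)"] sum_wt_words[where p = "\<lambda>i. p i powr t"]
      by (simp add: sum_distrib_left[symmetric] atLeast0LessThan Q_def)
    finally show ?thesis .
  qed
  have "Hausdorff_premeasure m t \<delta> A = 0" if "0 < \<delta>" for \<delta>
  proof -
    have "Hausdorff_premeasure m t \<delta> A \<le> 0 + ennreal e" if "0 < e" for e
    proof -
      have "(\<lambda>n. C powr t * Q ^ n) \<longlonglongrightarrow> C powr t * 0"
        using Q by (intro tendsto_intros LIMSEQ_power_zero) auto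
      then have "\<forall>\<^sub>F n in sequentially. C powr t * Q ^ n < e"
        using that by (intro order_tendstoD) auto
      moreover have "\<forall>\<^sub>F n in sequentially. C * pmax ^ n < \<delta>"
        by (rule order_tendstoD(2)[OF pmax_power_tendsto_0 \<open>0 < \<delta>\<close>])
      ultimately have "\<forall>\<^sub>F n in sequentially. C powr t * Q ^ n < e \<and> C * pmax ^ n < \<delta>"
        by (rule eventually_conj)
      then obtain n where "C powr t * Q ^ n < e" "C * pmax ^ n < \<delta>"
        using eventually_happens by fastforce
      with bound[of n \<delta>] show ?thesis
        by (simp add: order_trans[OF _ ennreal_leI])
    qed
    then have "Hausdorff_premeasure m t \<delta> A \<le> 0"
      by (rule ennreal_le_epsilon)
    then show ?thesis by simp
  qed
  then show ?thesis
    unfolding Hausdorff_measure_def by (intro antisym SUP_least) auto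
qed

text \<open>
  Mass distribution: a set either meets the coded set in at most one point or meets it inside a
  single cylinder whose weight is bounded by a multiple of the diameter of the set.
\<close>

lemma Hausdorff_measure_coded_pos:
  assumes "coded N p m A" and s: "(\<Sum>i<N. p i powr s) = 1" and t: "0 < t" "t \<le> s"
  shows "0 < Hausdorff_measure m t A"
proof -
  obtain \<pi> c where \<pi>: "bij_betw \<pi> (seqs N) A" "0 < c"
    and low: "\<And>x y. x \<in> seqs N \<Longrightarrow> y \<in> seqs N \<Longrightarrow> c * udist p x y \<le> mdist m (\<pi> x) (\<pi> y)"
    using assms(1) unfolding coded_def by blast
  obtain \<mu> where \<mu>: "prob_space \<mu>" "space \<mu> = seqs N"
    "\<And>w. set w \<subseteq> {..<N} \<Longrightarrow> cyl N w \<in> sets \<mu> \<and> measure \<mu> (cyl N w) = wt p w powr s"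
    using ex_self_similar_measure[OF s] by metis
  interpret prob_space \<mu> by (rule \<mu>)
  note pre_set = set_pre_subset
  have singleton: "{x} \<in> sets \<mu> \<and> emeasure \<mu> {x} = 0" if x: "x \<in> seqs N" for x
  proof -
    have eq: "{x} = (\<Inter>n. cyl N (pre x n))"
    proof
      show "(\<Inter>n. cyl N (pre x n)) \<subseteq> {x}"
      proof
        fix y assume y: "y \<in> (\<Inter>n. cyl N (pre x n))"
        have "y k = x k" for k
        proof -
          have "y \<in> cyl N (pre x (Suc k))" using y by blast
          then have "pre x (Suc k) ! k = y k"
            unfolding mem_cyl_iff by (metis length_pre lessI)
          then show ?thesis by simp
        qed
        then show "y \<in> {x}" by auto
      qed
    qed (use x in \<open>auto simp: mem_cyl_pre\<close>)
    have sets: "{x} \<in> sets \<mu>"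
      unfolding eq using \<mu>(3) pre_set[OF x] by (intro sets.countable_INT) auto
    have le: "measure \<mu> {x} \<le> (pmax powr s) ^ n" for n
    proof -
      have "measure \<mu> {x} \<le> measure \<mu> (cyl N (pre x n))"
        using x \<mu>(3)[OF pre_set[OF x]] by (intro finite_measure_mono) (auto simp: mem_cyl_pre)
      also have "\<dots> = wt p (pre x n) powr s"
        using \<mu>(3)[OF pre_set[OF x]] by simp
      also have "\<dots> \<le> (pmax ^ n) powr s"
        using wt_le_pmax_power[OF pre_set[OF x, of n]] wt_pos[OF pre_set[OF x, of n]] t
        by (intro powr_mono2) auto
      also have "\<dots> = (pmax powr s) ^ n"
        using pmax_pos by (simp add: powr_power powr_realpow[symmetric] powr_powr mult.commute)
      finally show ?thesis .
    qed
    have "pmax powr s < 1"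
      using powr_less_mono2[of s pmax 1] pmax_pos pmax_less_1 t by simp
    then have "(\<lambda>n. (pmax powr s) ^ n) \<longlonglongrightarrow> 0"
      by (intro LIMSEQ_power_zero) auto
    then have "measure \<mu> {x} \<le> 0"
      by (rule LIMSEQ_le_const) (use le in blast)
    with sets show ?thesis
      by (simp add: emeasure_eq_measure measure_le_0_iff)
  qed
  \<comment> \<open>The set of codes of the points of \<open>U\<close> may fail to be measurable, so
    the estimate is for a measurable superset.\<close>
  have cover: "\<exists>B\<in>sets \<mu>. {x \<in> seqs N. \<pi> x \<in> U} \<subseteq> B \<and> emeasure \<mu> B \<le> ennreal (1 / c powr t) * ennreal (mdiam m U powr t)"
    if U: "\<forall>x\<in>U. \<forall>y\<in>U. mdist m x y \<le> 1" for U
  proof -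
    let ?B = "{x \<in> seqs N. \<pi> x \<in> U}"
    consider "?B = {}" | x where "?B = {x}" | x y where "x \<in> ?B" "y \<in> ?B" "x \<noteq> y"
      by blast
    then show ?thesis
    proof cases
      case 1
      then show ?thesis by (intro bexI[of _ "{}"]) auto
    next
      case (2 x)
      then have "x \<in> seqs N" by blast
      with 2 singleton show ?thesis by (intro bexI[of _ "{x}"]) auto
    next
      case (3 x0 y0)
      define D where "D k \<longleftrightarrow> (\<exists>x\<in>?B. \<exists>y\<in>?B. x k \<noteq> y k)" for k
      define k where "k = (LEAST k. D k)"
      have "\<exists>k. D k" using 3 unfolding D_def by blast
      then have "D k" unfolding k_def by (rule LeastI_ex)
      then obtain x y where xy: "x \<in> ?B" "y \<in> ?B" "x k \<noteq> y k"
        unfolding D_def by blast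
      have agree: "x' j = y' j" if "x' \<in> ?B" "y' \<in> ?B" "j < k" for x' y' j
        using not_less_Least[of j D] that unfolding k_def D_def by blast
      let ?w = "pre x k"
      have w: "set ?w \<subseteq> {..<N}"
        using xy by (intro set_pre_subset) auto
      have sub: "?B \<subseteq> cyl N ?w"
      proof
        fix z assume z: "z \<in> ?B"
        then have "pre z k = pre x k"
          unfolding pre_eq_iff using agree[OF z xy(1)] by blast
        with z show "z \<in> cyl N ?w" by (simp add: cyl_def)
      qed
      have "udist p x y = wt p ?w"
        using xy(3) agree[OF xy(1,2)] by (rule udist_eq[rotated])
      then have "c * wt p ?w \<le> mdist m (\<pi> x) (\<pi> y)"
        using low[of x y] xy by simp
      also have "\<dots> \<le> mdiam m U"
      proof -
        have "bdd_above ((\<lambda>(x, y). mdist m x y) ` (U \<times> U))"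
          using U by (intro bdd_aboveI[of _ 1]) auto
        then show ?thesis
          using xy cSUP_upper[of "(\<pi> x, \<pi> y)" "U \<times> U" "\<lambda>(x, y). mdist m x y"]
          by (auto simp: mdiam_def)
      qed
      finally have diam: "wt p ?w \<le> mdiam m U / c"
        using \<pi>(2) by (simp add: field_simps)
      have "emeasure \<mu> (cyl N ?w) = ennreal (wt p ?w powr s)"
        using \<mu>(3)[OF w] by (simp add: emeasure_eq_measure)
      \<comment> \<open>Here \<open>t \<le> s\<close> enters, as weights are at most 1.\<close>
      also have "wt p ?w powr s \<le> wt p ?w powr t"
        using t wt_pos[OF w] wt_le_1[OF w] by (intro powr_mono') auto
      also have "\<dots> \<le> (mdiam m U / c) powr t"
        using diam t wt_pos[OF w] by (intro powr_mono2) auto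
      also have "\<dots> = 1 / c powr t * mdiam m U powr t"
        using diam wt_pos[OF w] \<pi>(2) by (simp add: powr_divide)
      also have "ennreal \<dots> = ennreal (1 / c powr t) * ennreal (mdiam m U powr t)"
        by (intro ennreal_mult) auto
      finally have "emeasure \<mu> (cyl N ?w) \<le> ennreal (1 / c powr t) * ennreal (mdiam m U powr t)"
        by (simp add: ennreal_leI)
      with sub \<mu>(3)[OF w] show ?thesis by (intro bexI[of _ "cyl N ?w"]) simp_all
    qed
  qed
  \<comment> \<open>One scale suffices, since the measure is the supremum over all scales; the bound
    1 on distances makes \<open>mdiam\<close> a genuine supremum.\<close>
  have "ennreal (c powr t) \<le> Hausdorff_premeasure m t 1 A"
    unfolding Hausdorff_premeasure_def
  proof (rule Inf_greatest)
    fix S assume "S \<in> {(\<Sum>i. ennreal (mdiam m (U i) powr t)) |U. A \<subseteq> (\<Union>i. U i) \<and>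
      (\<forall>i. U i \<subseteq> mspace m \<and> (\<forall>x\<in>U i. \<forall>y\<in>U i. mdist m x y \<le> 1))}"
    then obtain U :: "nat \<Rightarrow> 'a set" where S: "S = (\<Sum>i. ennreal (mdiam m (U i) powr t))"
      and A: "A \<subseteq> (\<Union>i. U i)" and U: "\<And>i. \<forall>x\<in>U i. \<forall>y\<in>U i. mdist m x y \<le> 1"
      by auto
    have "\<forall>i. \<exists>B. B \<in> sets \<mu> \<and> {x \<in> seqs N. \<pi> x \<in> U i} \<subseteq> B \<and>
        emeasure \<mu> B \<le> ennreal (1 / c powr t) * ennreal (mdiam m (U i) powr t)"
      using cover[OF U] unfolding Bex_def by (rule allI)
    from choice[OF this] obtain B where B: "\<And>i. B i \<in> sets \<mu>" "\<And>i. {x \<in> seqs N. \<pi> x \<in> U i} \<subseteq> B i"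
      "\<And>i. emeasure \<mu> (B i) \<le> ennreal (1 / c powr t) * ennreal (mdiam m (U i) powr t)"
      by auto
    have "seqs N \<subseteq> (\<Union>i. B i)"
    proof
      fix x assume x: "x \<in> seqs N"
      then obtain i where "\<pi> x \<in> U i"
        using A \<pi>(1) by (auto simp: bij_betw_def)
      with B(2) x show "x \<in> (\<Union>i. B i)" by blast
    qed
    then have "1 \<le> emeasure \<mu> (\<Union>i. B i)"
      using emeasure_mono[of "space \<mu>" "\<Union>i. B i" \<mu>] B(1) by (simp add: \<mu>(2) emeasure_space_1[unfolded \<mu>(2)])
    also have "\<dots> \<le> (\<Sum>i. emeasure \<mu> (B i))"
      using B(1) by (intro emeasure_subadditive_countably) auto
    also have "\<dots> \<le> (\<Sum>i. ennreal (1 / c powr t) * ennreal (mdiam m (U i) powr t))"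
      using B(3) by (intro suminf_le) auto
    also have "\<dots> = ennreal (1 / c powr t) * S"
      by (simp add: S)
    finally have "ennreal (c powr t) * 1 \<le> ennreal (c powr t) * (ennreal (1 / c powr t) * S)"
      by (intro mult_left_mono) auto
    also have "\<dots> = ennreal (c powr t * (1 / c powr t)) * S"
      by (subst ennreal_mult) (auto simp: mult.assoc)
    also have "\<dots> = S"
      using \<pi>(2) by simp
    finally show "ennreal (c powr t) \<le> S" by simp
  qed
  also have "\<dots> \<le> Hausdorff_measure m t A"
    unfolding Hausdorff_measure_def by (rule SUP_upper) simp
  finally have "ennreal (c powr t) \<le> Hausdorff_measure m t A" .
  moreover have "0 < ennreal (c powr t)"
    using \<pi>(2) by simp
  ultimately show ?thesis
    by (rule less_le_trans[rotated])
qed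

lemma Hausdorff_dim_coded:
  assumes "coded N p m A" "0 < s" "(\<Sum>i<N. p i powr s) = 1"
  shows "Hausdorff_dim m A = s"
proof -
  have "{t. 0 < t \<and> Hausdorff_measure m t A = 0} = {s<..}"
  proof (intro set_eqI iffI; clarsimp)
    show "s < t" if "0 < t" "Hausdorff_measure m t A = 0" for t
      using Hausdorff_measure_coded_pos[OF assms(1,3), of t] that by (auto simp: not_less[symmetric])
    show "0 < t \<and> Hausdorff_measure m t A = 0" if "s < t" for t
      using Hausdorff_measure_coded_eq_0[OF assms(1,3), of t] that assms(2) by simp
  qed
  then show ?thesis
    by (simp add: Hausdorff_dim_def)
qed

end

section \<open>Attractors of systems of similarities\<close>

locale similarity_system = Metric_space M d + ratio_system N p
  for M :: "'a set" and d :: "'a \<Rightarrow> 'a \<Rightarrow> real" and N p +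
  fixes F :: "nat \<Rightarrow> 'a \<Rightarrow> 'a"
  assumes complete: mcomplete
    and M_nonempty: "M \<noteq> {}"
    and F_mem: "i < N \<Longrightarrow> a \<in> M \<Longrightarrow> F i a \<in> M"
    and dist_F: "i < N \<Longrightarrow> a \<in> M \<Longrightarrow> b \<in> M \<Longrightarrow> d (F i a) (F i b) = p i * d a b"
begin

text \<open>The composition of \<open>F (x 0)\<close>, ..., \<open>F (x (n - 1))\<close> with
  \<open>F (x 0)\<close> outermost, so that a longer prefix selects a smaller piece of the
  attractor.\<close>

primrec path :: "nat \<Rightarrow> (nat \<Rightarrow> nat) \<Rightarrow> 'a \<Rightarrow> 'a" where
  "path 0 x a = a"
| "path (Suc n) x a = F (x 0) (path n (\<lambda>k. x (Suc k)) a)"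

definition base :: 'a where
  "base = (SOME a. a \<in> M)"

definition code :: "(nat \<Rightarrow> nat) \<Rightarrow> 'a" where
  "code x = (SOME l. limitin mtopology (\<lambda>n. path n x base) l sequentially)"

definition E :: "'a set" where
  "E = code ` seqs N"

lemma base_mem: "base \<in> M"
  using M_nonempty by (simp add: base_def some_in_eq)

lemma shift_mem: "x \<in> seqs N \<Longrightarrow> (\<lambda>k. x (m + k)) \<in> seqs N" "x \<in> seqs N \<Longrightarrow> (\<lambda>k. x (Suc k)) \<in> seqs N"
  by (auto simp: seqs_def)

lemma head_less: "x \<in> seqs N \<Longrightarrow> x k < N"
  by (simp add: seqs_def)

lemma path_mem: "x \<in> seqs N \<Longrightarrow> a \<in> M \<Longrightarrow> path n x a \<in> M"
proof (induction n arbitrary: x)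
  case (Suc n)
  then show ?case
    using F_mem[OF head_less[OF Suc.prems(1)]] Suc.IH[OF shift_mem(2)[OF Suc.prems(1)]] by simp
qed simp

lemma dist_path:
  assumes "x \<in> seqs N" "a \<in> M" "b \<in> M"
  shows "d (path n x a) (path n x b) = wt p (pre x n) * d a b"
  using assms
proof (induction n arbitrary: x)
  case (Suc n)
  then show ?case
    using shift_mem(2)[OF Suc.prems(1)] head_less[OF Suc.prems(1)]
    by (simp add: pre_Suc dist_F path_mem)
qed simp

lemma path_add: "path (m + n) x a = path m x (path n (\<lambda>k. x (m + k)) a)"
  by (induction m arbitrary: x) auto

lemma wt_pre_le: "x \<in> seqs N \<Longrightarrow> wt p (pre x n) \<le> pmax ^ n"
  using wt_le_pmax_power[OF set_pre_subset, of x n] by simp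

lemma ex_path_bound:
  obtains R where "0 < R" "\<And>x n. x \<in> seqs N \<Longrightarrow> d base (path n x base) \<le> R"
proof -
  define D where "D = Max ((\<lambda>i. d base (F i base)) ` {..<N})"
  have D: "d base (F i base) \<le> D" if "i < N" for i
    unfolding D_def using that by (intro Max_ge) auto
  have "0 \<le> D" using D[of 0] two_le by (intro order_trans[OF nonneg D[of 0]]) auto
  \<comment> \<open>A radius that the recursion \<open>R \<mapsto> D + pmax * R\<close> does not
    increase; the \<open>+ 1\<close> keeps it positive when \<open>D = 0\<close>.\<close>
  define R where "R = (D + 1) / (1 - pmax)"
  have R: "D + pmax * R \<le> R"
  proof -
    have "(1 - pmax) * R = D + 1"
      using pmax_less_1 by (simp add: R_def)
    then show ?thesis by (simp add: algebra_simps)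
  qed
  have "0 < R"
    using \<open>0 \<le> D\<close> pmax_less_1 by (simp add: R_def)
  have "d base (path n x base) \<le> R" if "x \<in> seqs N" for x n
    using that
  proof (induction n arbitrary: x)
    case 0
    then show ?case using base_mem \<open>0 < R\<close> by simp
  next
    case (Suc n)
    let ?b = "path n (\<lambda>k. x (Suc k)) base"
    have b: "?b \<in> M" by (intro path_mem shift_mem(2)[OF Suc.prems] base_mem)
    have "d base (path (Suc n) x base) \<le> d base (F (x 0) base) + d (F (x 0) base) (F (x 0) ?b)"
      using head_less[OF Suc.prems, of 0] b by (auto intro!: triangle F_mem base_mem)
    also have "\<dots> \<le> D + pmax * R"
    proof (intro add_mono D head_less[OF Suc.prems])
      have "d (F (x 0) base) (F (x 0) ?b) = p (x 0) * d base ?b"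
        using b by (intro dist_F head_less[OF Suc.prems] base_mem)
      also have "\<dots> \<le> pmax * R"
        using Suc.IH[OF shift_mem(2)[OF Suc.prems]] le_pmax[OF head_less[OF Suc.prems]] pmax_pos by (intro mult_mono) auto
      finally show "d (F (x 0) base) (F (x 0) ?b) \<le> pmax * R" .
    qed
    finally show ?case using R by simp
  qed
  with \<open>0 < R\<close> that show thesis by blast
qed

lemma limitin_code:
  assumes x: "x \<in> seqs N"
  shows "limitin mtopology (\<lambda>n. path n x base) (code x) sequentially"
proof -
  obtain R where R: "0 < R" "\<And>x n. x \<in> seqs N \<Longrightarrow> d base (path n x base) \<le> R"
    by (rule ex_path_bound) blast
  have close: "d (path n x base) (path n' x base) \<le> R * pmax ^ n" if "n \<le> n'" for n n'
  proof -
    have "path n' x base = path n x (path (n' - n) (\<lambda>k. x (n + k)) base)"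
      using path_add[of n "n' - n" x base] that by simp
    then have "d (path n x base) (path n' x base) = wt p (pre x n) * d base (path (n' - n) (\<lambda>k. x (n + k)) base)"
      using x shift_mem(1)[OF x] by (simp add: dist_path base_mem path_mem)
    also have "\<dots> \<le> pmax ^ n * R"
      using R(2)[OF shift_mem(1)[OF x]] wt_pre_le[OF x] pmax_pos by (intro mult_mono) auto
    finally show ?thesis by (simp add: mult.commute)
  qed
  have "MCauchy (\<lambda>n. path n x base)"
    unfolding MCauchy_def
  proof (intro conjI allI impI)
    show "range (\<lambda>n. path n x base) \<subseteq> M"
      using x by (auto intro: path_mem base_mem)
    fix \<epsilon> :: real assume "0 < \<epsilon>"
    then obtain k where k: "R * pmax ^ k < \<epsilon>"
      by (rule ex_pmax_power_le)
    have "d (path n x base) (path n' x base) < \<epsilon>" if "k \<le> n" "n \<le> n'" for n n'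
    proof -
      have "d (path n x base) (path n' x base) \<le> R * pmax ^ n"
        by (rule close[OF that(2)])
      also have "\<dots> \<le> R * pmax ^ k"
        using that pmax_pos pmax_less_1 R(1) by (intro mult_left_mono power_decreasing) auto
      finally show ?thesis using k by simp
    qed
    note close' = this
    show "\<exists>k. \<forall>n n'. k \<le> n \<longrightarrow> k \<le> n' \<longrightarrow> d (path n x base) (path n' x base) < \<epsilon>"
    proof (intro exI allI impI)
      fix n n' assume n: "k \<le> n" "k \<le> n'"
      show "d (path n x base) (path n' x base) < \<epsilon>"
      proof (cases "n \<le> n'")
        case True
        then show ?thesis by (rule close'[OF n(1)])
      next
        case False
        then show ?thesis by (subst commute) (intro close' n(2), simp)
      qed
    qed
  qed
  then show ?thesis
    unfolding code_def by (rule someI_ex[OF complete[unfolded mcomplete_def, rule_format]])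
qed

lemma code_mem: "x \<in> seqs N \<Longrightarrow> code x \<in> M"
  using limitin_code limitin_mspace by blast

lemma ex_code_bound:
  obtains R where "0 < R" "\<And>x n. x \<in> seqs N \<Longrightarrow> d (path n x base) (code x) \<le> R * pmax ^ n"
proof -
  obtain R where R: "0 < R" "\<And>x n. x \<in> seqs N \<Longrightarrow> d base (path n x base) \<le> R"
    by (rule ex_path_bound) blast
  have "d (path n x base) (code x) \<le> R * pmax ^ n" if x: "x \<in> seqs N" for x n
  proof (rule field_le_epsilon)
    fix e :: real assume "0 < e"
    with limitin_code[OF x] obtain k where k: "\<And>m. k \<le> m \<Longrightarrow> d (path m x base) (code x) < e"
      unfolding limit_metric_sequentially by blast
    let ?m = "n + k"
    have "path ?m x base = path n x (path k (\<lambda>k. x (n + k)) base)"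
      by (rule path_add)
    then have "d (path n x base) (path ?m x base) = wt p (pre x n) * d base (path k (\<lambda>k. x (n + k)) base)"
      using x shift_mem(1)[OF x] by (simp add: dist_path base_mem path_mem)
    also have "\<dots> \<le> pmax ^ n * R"
      using R(2)[OF shift_mem(1)[OF x]] wt_pre_le[OF x] pmax_pos by (intro mult_mono) auto
    finally have "d (path n x base) (path ?m x base) \<le> R * pmax ^ n" by (simp add: mult.commute)
    moreover have "d (path n x base) (code x) \<le> d (path n x base) (path ?m x base) + d (path ?m x base) (code x)"
      using x by (intro triangle path_mem base_mem code_mem)
    ultimately show "d (path n x base) (code x) \<le> R * pmax ^ n + e"
      using k[of ?m] by simp
  qed
  with R(1) that show thesis by blast
qed

text \<open>The same path approaches \<open>code x\<close> and \<open>l\<close> at a geometric rate.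
  The index \<open>Suc n\<close> lets one map be peeled off in \<open>code_shift\<close>.\<close>

lemma code_unique:
  assumes x: "x \<in> seqs N" and l: "l \<in> M"
    and le: "\<And>n. d (path (Suc n) x base) l \<le> C * pmax ^ n"
  shows "code x = l"
proof -
  obtain R where R: "0 < R" "\<And>x n. x \<in> seqs N \<Longrightarrow> d (path n x base) (code x) \<le> R * pmax ^ n"
    by (rule ex_code_bound) blast
  have "d (code x) l \<le> (R + C) * pmax ^ n" for n
  proof -
    have "d (code x) l \<le> d (code x) (path (Suc n) x base) + d (path (Suc n) x base) l"
      using x l by (intro triangle path_mem base_mem code_mem)
    also have "\<dots> \<le> R * pmax ^ Suc n + C * pmax ^ n"
      using R(2)[OF x, of "Suc n"] le[of n] by (simp add: commute del: path.simps)
    also have "\<dots> \<le> R * pmax ^ n + C * pmax ^ n"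
      using R(1) pmax_pos pmax_less_1 by (intro add_right_mono mult_left_mono power_decreasing) auto
    finally show ?thesis by (simp add: algebra_simps)
  qed
  then have "d (code x) l \<le> 0"
    by (intro LIMSEQ_le_const[OF pmax_power_tendsto_0]) blast
  then show ?thesis
    using x l by (metis code_mem mdist_pos_less not_less)
qed

lemma code_shift:
  assumes x: "x \<in> seqs N"
  shows "code x = F (x 0) (code (\<lambda>k. x (Suc k)))"
proof -
  obtain R where R: "0 < R" "\<And>x n. x \<in> seqs N \<Longrightarrow> d (path n x base) (code x) \<le> R * pmax ^ n"
    by (rule ex_code_bound) blast
  let ?y = "\<lambda>k. x (Suc k)"
  have y: "?y \<in> seqs N" by (rule shift_mem(2)[OF x])
  show ?thesis
  proof (rule code_unique[OF x])
    show "F (x 0) (code ?y) \<in> M"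
      by (rule F_mem[OF head_less[OF x] code_mem[OF y]])
    fix n
    have "d (path (Suc n) x base) (F (x 0) (code ?y)) = p (x 0) * d (path n ?y base) (code ?y)"
      using dist_F[OF head_less[OF x] path_mem[OF y base_mem] code_mem[OF y]] by simp
    also have "\<dots> \<le> 1 * (R * pmax ^ n)"
      using R(2)[OF y] less_imp_le[OF less_1[OF head_less[OF x]]] by (intro mult_mono) simp_all
    finally show "d (path (Suc n) x base) (F (x 0) (code ?y)) \<le> R * pmax ^ n" by simp
  qed
qed

lemma code_eq_path: "x \<in> seqs N \<Longrightarrow> code x = path n x (code (\<lambda>k. x (n + k)))"
proof (induction n arbitrary: x)
  case (Suc n)
  then show ?case
    using code_shift[of x] Suc.IH[OF shift_mem(2)[of x]] by simp
qed simp

lemma path_cong: "(\<And>k. k < n \<Longrightarrow> x k = y k) \<Longrightarrow> path n x a = path n y a"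
proof (induction n arbitrary: x y)
  case (Suc n)
  have "path n (\<lambda>k. x (Suc k)) a = path n (\<lambda>k. y (Suc k)) a"
    by (rule Suc.IH) (use Suc.prems in auto)
  with Suc.prems[of 0] show ?case by simp
qed simp

lemma dist_code_eq:
  assumes "x \<in> seqs N" "y \<in> seqs N" "\<And>k. k < n \<Longrightarrow> x k = y k"
  shows "d (code x) (code y) = wt p (pre x n) * d (code (\<lambda>k. x (n + k))) (code (\<lambda>k. y (n + k)))"
proof -
  have "path n x a = path n y a" for a
    by (rule path_cong[OF assms(3)])
  then have "d (code x) (code y) = d (path n x (code (\<lambda>k. x (n + k)))) (path n x (code (\<lambda>k. y (n + k))))"
    using code_eq_path[OF assms(1), of n] code_eq_path[OF assms(2), of n] by metis
  also have "\<dots> = wt p (pre x n) * d (code (\<lambda>k. x (n + k))) (code (\<lambda>k. y (n + k)))"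
    by (intro dist_path code_mem shift_mem(1)[OF assms(1)] shift_mem(1)[OF assms(2)] assms(1))
  finally show ?thesis .
qed

lemma ex_diameter_bound:
  obtains R where "0 < R" "\<And>x y. x \<in> seqs N \<Longrightarrow> y \<in> seqs N \<Longrightarrow> d (code x) (code y) \<le> R"
proof -
  obtain R where R: "0 < R" "\<And>x n. x \<in> seqs N \<Longrightarrow> d (path n x base) (code x) \<le> R * pmax ^ n"
    by (rule ex_code_bound) blast
  have "d (code x) (code y) \<le> 2 * R" if "x \<in> seqs N" "y \<in> seqs N" for x y
    using triangle'[OF code_mem[OF that(1)] base_mem code_mem[OF that(2)]] R(2)[OF that(1), of 0] R(2)[OF that(2), of 0]
    by (simp add: commute)
  with R(1) that[of "2 * R"] show thesis by simp
qed

lemma ex_upper_bound: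
  obtains C where "0 < C"
    "\<And>x y. x \<in> seqs N \<Longrightarrow> y \<in> seqs N \<Longrightarrow> d (code x) (code y) \<le> C * udist p x y"
    "\<And>x y n. x \<in> seqs N \<Longrightarrow> y \<in> cyl N (pre x n) \<Longrightarrow> d (code x) (code y) \<le> C * pmax ^ n"
proof -
  obtain R where R: "0 < R" "\<And>x y. x \<in> seqs N \<Longrightarrow> y \<in> seqs N \<Longrightarrow> d (code x) (code y) \<le> R"
    by (rule ex_diameter_bound) blast
  have le: "d (code x) (code y) \<le> R * wt p (pre x n)"
    if "x \<in> seqs N" "y \<in> seqs N" "\<And>k. k < n \<Longrightarrow> x k = y k" for x y n
  proof -
    have "d (code x) (code y) = wt p (pre x n) * d (code (\<lambda>k. x (n + k))) (code (\<lambda>k. y (n + k)))"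
      by (rule dist_code_eq[OF that])
    also have "\<dots> \<le> wt p (pre x n) * R"
      by (intro mult_left_mono R(2) shift_mem(1)[OF that(1)] shift_mem(1)[OF that(2)]
          less_imp_le[OF wt_pos] set_pre_subset that(1))
    finally show ?thesis by (simp add: mult.commute)
  qed
  show thesis
  proof (rule that[OF R(1)])
    fix x y assume xy: "x \<in> seqs N" "y \<in> seqs N"
    show "d (code x) (code y) \<le> R * udist p x y"
    proof (cases "x = y")
      case False
      then obtain n where n: "\<And>k. k < n \<Longrightarrow> x k = y k" "x n \<noteq> y n"
        by (metis neq_seqs_first_difference)
      with le[OF xy n(1)] udist_eq[of n x y, OF n] show ?thesis by simp
    qed (use xy code_mem in simp)
  next
    fix x y n assume xy: "x \<in> seqs N" "y \<in> cyl N (pre x n)"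
    then have "d (code x) (code y) \<le> R * wt p (pre x n)"
      by (intro le) (auto simp: mem_cyl_iff)
    also have "\<dots> \<le> R * pmax ^ n"
      using wt_pre_le[OF xy(1)] R(1) by (intro mult_left_mono) auto
    finally show "d (code x) (code y) \<le> R * pmax ^ n" .
  qed
qed

text \<open>\<open>code\<close> is continuous on a product of finite discrete spaces, which is
  compact by Tychonoff; the cylinders are basic open sets there.\<close>

lemma compactin_E: "compactin mtopology E"
proof -
  let ?X = "product_topology (\<lambda>_::nat. discrete_topology {..<N}) UNIV"
  have top: "topspace ?X = seqs N"
    by (auto simp: seqs_def PiE_iff)
  obtain C where C: "0 < C"
    "\<And>x y n. x \<in> seqs N \<Longrightarrow> y \<in> cyl N (pre x n) \<Longrightarrow> d (code x) (code y) \<le> C * pmax ^ n"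
    by (rule ex_upper_bound) blast
  have "continuous_map ?X mtopology code"
    unfolding continuous_map_to_metric top
  proof (intro ballI allI impI)
    fix x and \<epsilon> :: real assume x: "x \<in> seqs N" and "0 < \<epsilon>"
    obtain n where n: "C * pmax ^ n < \<epsilon>"
      by (rule ex_pmax_power_le[OF \<open>0 < \<epsilon>\<close>])
    define S where "S k = (if k < n then {x k} else {..<N})" for k
    have eq: "cyl N (pre x n) = PiE UNIV S"
    proof (rule set_eqI, rule iffI)
      fix y assume "y \<in> PiE UNIV S"
      then have y: "y k \<in> S k" for k by (auto simp: PiE_iff)
      have "y k < N" for k
        using y[of k] head_less[OF x, of k] by (simp add: S_def split: if_splits)
      moreover have "y k = x k" if "k < n" for k
        using y[of k] that by (simp add: S_def)
      ultimately show "y \<in> cyl N (pre x n)"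
        by (simp add: mem_cyl_iff seqs_def)
    qed (auto simp: mem_cyl_iff S_def seqs_def)
    have "{k. S k \<noteq> {..<N}} \<subseteq> {..<n}"
      by (auto simp: S_def)
    then have "finite {k. S k \<noteq> {..<N}}"
      using finite_subset by blast
    then have "openin ?X (PiE UNIV S)"
      using head_less[OF x] by (subst openin_PiE_gen) (simp add: S_def)
    moreover have "code y \<in> mball (code x) \<epsilon>" if "y \<in> cyl N (pre x n)" for y
      using C(2)[OF x that] n x that cyl_subset_seqs[of N "pre x n"] by (auto simp: code_mem)
    ultimately show "\<exists>U. openin ?X U \<and> x \<in> U \<and> (\<forall>y\<in>U. code y \<in> mball (code x) \<epsilon>)"
      using eq mem_cyl_pre[OF x, of n] by (intro exI[of _ "cyl N (pre x n)"]) simp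
  qed
  moreover have "compactin ?X (topspace ?X)"
    unfolding compact_space_def[symmetric] by (simp add: compact_space_product_topology compact_space_discrete_topology)
  ultimately show ?thesis
    unfolding E_def top[symmetric] by (rule image_compactin[rotated])
qed

lemma E_nonempty: "E \<noteq> {}"
  using cyl_nonempty[of "[]"] by (simp add: E_def)

lemma E_subset: "E \<subseteq> M"
  by (auto simp: E_def code_mem)

lemma E_eq_Union: "E = (\<Union>i<N. F i ` E)"
proof
  show "E \<subseteq> (\<Union>i<N. F i ` E)"
  proof
    fix a assume "a \<in> E"
    then obtain x where x: "x \<in> seqs N" "a = code x" by (auto simp: E_def)
    then show "a \<in> (\<Union>i<N. F i ` E)"
      using code_shift[OF x(1)] shift_mem(2)[OF x(1)] head_less[OF x(1), of 0] by (auto simp: E_def)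
  qed
  show "(\<Union>i<N. F i ` E) \<subseteq> E"
  proof
    fix a assume "a \<in> (\<Union>i<N. F i ` E)"
    then obtain i x where ix: "i < N" "x \<in> seqs N" "a = F i (code x)" by (auto simp: E_def)
    then have "case_nat i x \<in> seqs N"
      by (auto simp: seqs_def split: nat.split)
    moreover from code_shift[OF this] ix have "a = code (case_nat i x)"
      by simp
    ultimately show "a \<in> E"
      unfolding E_def by blast
  qed
qed

text \<open>A path started in \<open>K\<close> stays in \<open>K\<close> and still converges to
  \<open>code x\<close>. Besides uniqueness of the attractor, this serves to confine attractors to
  explicit boxes.\<close>

lemma E_subset_invariant:
  assumes "closedin mtopology K" "K \<noteq> {}" and inv: "\<And>i. i < N \<Longrightarrow> F i ` K \<subseteq> K"
  shows "E \<subseteq> K"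
proof
  fix a assume "a \<in> E"
  then obtain x where x: "x \<in> seqs N" "a = code x" by (auto simp: E_def)
  obtain b where b: "b \<in> K" using assms(2) by blast
  have KM: "K \<subseteq> M" using assms(1) by (simp add: closedin_metric)
  have path_K: "path n x b \<in> K" for n
    using x(1)
  proof (induction n arbitrary: x)
    case (Suc n)
    then show ?case
      using inv[OF head_less[OF Suc.prems]] Suc.IH[OF shift_mem(2)[OF Suc.prems]] by auto
  qed (use b in simp)
  obtain R where R: "0 < R" "\<And>x n. x \<in> seqs N \<Longrightarrow> d (path n x base) (code x) \<le> R * pmax ^ n"
    by (rule ex_code_bound) blast
  have le: "d (code x) (path n x b) \<le> (R + d base b) * pmax ^ n" for n
  proof -
    have "d (code x) (path n x b) \<le> d (code x) (path n x base) + d (path n x base) (path n x b)"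
      using x b KM by (intro triangle path_mem base_mem code_mem) auto
    also have "\<dots> \<le> R * pmax ^ n + pmax ^ n * d base b"
      using R(2)[OF x(1), of n] wt_pre_le[OF x(1), of n] x b KM
      by (intro add_mono) (auto simp: commute dist_path base_mem subset_iff intro!: mult_right_mono)
    finally show ?thesis by (simp add: algebra_simps)
  qed
  show "a \<in> K"
  proof (rule ccontr)
    assume "a \<notin> K"
    then obtain r where r: "0 < r" "disjnt K (mball a r)"
      using assms(1) x code_mem unfolding closedin_metric by blast
    obtain n where "(R + d base b) * pmax ^ n < r"
      by (rule ex_pmax_power_le[OF r(1)])
    then have "path n x b \<in> mball a r"
      using le[of n] path_K[of n] KM x code_mem by auto
    with r path_K show False by (auto simp: disjnt_iff)
  qed
qed

text \<open>For \<open>K \<subseteq> E\<close> a point is followed backwards: it is the image of a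
  point of \<open>K\<close>, and so on. The indices form a code, and boundedness of \<open>K\<close>
  makes its path converge to the point.\<close>

lemma attractor_unique:
  assumes K: "K \<noteq> {}" "compactin mtopology K" "K = (\<Union>i<N. F i ` K)"
  shows "K = E"
proof
  have KM: "K \<subseteq> M"
    using compactin_subset_topspace[OF K(2)] by simp
  show "E \<subseteq> K"
  proof (rule E_subset_invariant)
    show "closedin mtopology K"
      by (rule compactin_imp_closedin[OF Hausdorff_space_mtopology K(2)])
    show "F i ` K \<subseteq> K" if "i < N" for i
      using K(3) that by blast
  qed (rule K(1))
  show "K \<subseteq> E"
  proof
    fix a assume a: "a \<in> K"
    have "\<forall>b\<in>K. \<exists>i c. i < N \<and> c \<in> K \<and> b = F i c"
      using K(3) by blast
    then obtain I Z where IZ: "\<And>b. b \<in> K \<Longrightarrow> I b < N \<and> Z b \<in> K \<and> b = F (I b) (Z b)"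
      by metis
    define z where "z n = (Z ^^ n) a" for n
    have zK: "z n \<in> K" for n
      by (induction n) (auto simp: z_def a IZ)
    define x where "x n = I (z n)" for n
    have x: "x \<in> seqs N"
      using IZ zK by (auto simp: seqs_def x_def)
    have z_path: "z m = path n (\<lambda>k. x (m + k)) (z (m + n))" for m n
    proof (induction n arbitrary: m)
      case (Suc n)
      have "z m = F (x m) (z (Suc m))"
        using IZ[OF zK[of m]] by (simp add: x_def z_def)
      also have "z (Suc m) = path n (\<lambda>k. x (Suc m + k)) (z (Suc m + n))"
        by (rule Suc.IH)
      finally show ?case by simp
    qed simp
    obtain c B where cB: "K \<subseteq> mcball c B"
      using compactin_imp_mbounded[OF K(2)] unfolding mbounded_def by blast
    have B: "d base b \<le> d base c + B" if "b \<in> K" for b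
      using cB that triangle[of base c b] base_mem by fastforce
    have "code x = a"
    proof (rule code_unique[OF x])
      show "a \<in> M" using a KM by blast
      fix n
      have "a = path (Suc n) x (z (Suc n))"
        using z_path[of 0 "Suc n"] by (simp add: z_def)
      then have "d (path (Suc n) x base) a = wt p (pre x (Suc n)) * d base (z (Suc n))"
        using x zK KM by (metis base_mem dist_path subsetD)
      also have "\<dots> \<le> pmax ^ Suc n * (d base c + B)"
        using wt_pre_le[OF x, of "Suc n"] B[OF zK] pmax_pos by (intro mult_mono) auto
      finally show "d (path (Suc n) x base) a \<le> (pmax * (d base c + B)) * pmax ^ n"
        by (simp add: mult_ac)
    qed
    with x show "a \<in> E" by (auto simp: E_def)
  qed
qed

lemma ex_compact_distance:
  assumes A: "compactin mtopology A" and B: "compactin mtopology B" and "A \<inter> B = {}"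
  obtains \<delta> where "0 < \<delta>" "\<And>a b. a \<in> A \<Longrightarrow> b \<in> B \<Longrightarrow> \<delta> \<le> d a b"
proof (rule ccontr)
  assume "\<not> thesis"
  with that have no: "\<And>\<delta>. 0 < \<delta> \<Longrightarrow> \<exists>a\<in>A. \<exists>b\<in>B. d a b < \<delta>"
    by (meson not_less)
  then have "\<forall>n. \<exists>a b. a \<in> A \<and> b \<in> B \<and> d a b < inverse (real (Suc n))"
    by (meson inverse_positive_iff_positive of_nat_0_less_iff zero_less_Suc)
  then obtain a b where ab: "\<And>n. a n \<in> A" "\<And>n. b n \<in> B" "\<And>n. d (a n) (b n) < inverse (real (Suc n))"
    by metis
  have AM: "A \<subseteq> M" "B \<subseteq> M"
    using A B compactin_subset_topspace by fastforce+
  obtain l r where l: "l \<in> A" "strict_mono r" "limitin mtopology (a \<circ> r) l sequentially"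
    using A ab(1) unfolding compactin_sequentially by (metis image_subsetI)
  have "closedin mtopology B"
    by (rule compactin_imp_closedin[OF Hausdorff_space_mtopology B])
  moreover have "l \<in> M - B" using l(1) AM assms(3) by blast
  ultimately obtain e where e: "0 < e" "disjnt B (mball l e)"
    unfolding closedin_metric by blast
  obtain n0 where n0: "\<And>n. n0 \<le> n \<Longrightarrow> d (a (r n)) l < e / 2"
    using l(3) e(1) unfolding limit_metric_sequentially by (metis comp_apply half_gt_zero)
  obtain n1 where n1: "inverse (real (Suc n1)) < e / 2"
    using reals_Archimedean[of "e / 2"] e(1) by auto
  define n where "n = max n0 n1"
  have "inverse (real (Suc (r n))) \<le> inverse (real (Suc n1))"
    using strict_mono_imp_increasing[OF l(2), of n] by (intro le_imp_inverse_le) (auto simp: n_def)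
  then have "d (a (r n)) (b (r n)) < e / 2"
    using ab(3)[of "r n"] n1 by linarith
  moreover have "d l (b (r n)) \<le> d l (a (r n)) + d (a (r n)) (b (r n))"
    using l(1) ab AM by (intro triangle) auto
  ultimately have "d l (b (r n)) < e"
    using n0[of n] by (simp add: n_def commute)
  then have "b (r n) \<in> mball l e"
    using l(1) ab AM by auto
  with e(2) ab(2) show False by (auto simp: disjnt_iff)
qed

lemma compactin_F_E: "i < N \<Longrightarrow> compactin mtopology (F i ` E)"
proof (rule image_compactin[OF compactin_E])
  assume i: "i < N"
  show "continuous_map mtopology mtopology (F i)"
    unfolding continuous_map_to_metric topspace_mtopology
  proof (intro ballI allI impI)
    fix a and \<epsilon> :: real assume a: "a \<in> M" "0 < \<epsilon>"
    have "F i b \<in> mball (F i a) \<epsilon>" if "b \<in> mball a \<epsilon>" for b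
    proof -
      have "p i * d a b \<le> 1 * d a b"
        using less_1[OF i] by (intro mult_right_mono) auto
      with that a i show ?thesis by (auto simp: dist_F F_mem)
    qed
    with a show "\<exists>U. openin mtopology U \<and> a \<in> U \<and> (\<forall>b\<in>U. F i b \<in> mball (F i a) \<epsilon>)"
      by (intro exI[of _ "mball a \<epsilon>"]) auto
  qed
qed

text \<open>Stripping the common prefix of two codes scales the distance exactly
  (\<open>dist_code_eq\<close>), and the remaining points lie in different first-level pieces. These
  are finitely many disjoint compact sets, so they have a common positive gap
  \<open>c\<close>.\<close>

lemma coded_E:
  assumes m: "mspace m = M" "mdist m = d"
    and ssc: "\<And>i j. i < N \<Longrightarrow> j < N \<Longrightarrow> i \<noteq> j \<Longrightarrow> F i ` E \<inter> F j ` E = {}"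
  shows "coded N p m E"
proof -
  have "\<exists>\<delta>>0. \<forall>a\<in>F i ` E. \<forall>b\<in>F j ` E. \<delta> \<le> d a b" if "i < N" "j < N" "i \<noteq> j" for i j
    using ex_compact_distance[OF compactin_F_E[OF that(1)] compactin_F_E[OF that(2)] ssc[OF that]] by metis
  then obtain \<delta> where \<delta>: "\<And>i j. i < N \<Longrightarrow> j < N \<Longrightarrow> i \<noteq> j \<Longrightarrow> 0 < \<delta> i j"
    "\<And>i j a b. i < N \<Longrightarrow> j < N \<Longrightarrow> i \<noteq> j \<Longrightarrow> a \<in> F i ` E \<Longrightarrow> b \<in> F j ` E \<Longrightarrow> \<delta> i j \<le> d a b"
    by metis
  define D where "D = (\<lambda>(i, j). \<delta> i j) ` {(i, j). i < N \<and> j < N \<and> i \<noteq> j}"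
  have "{(i, j). i < N \<and> j < N \<and> i \<noteq> j} \<subseteq> {..<N} \<times> {..<N}" by auto
  then have "finite D"
    unfolding D_def by (intro finite_imageI) (rule finite_subset, auto)
  define c where "c = Min (insert 1 D)"
  have c: "0 < c" "\<And>i j. i < N \<Longrightarrow> j < N \<Longrightarrow> i \<noteq> j \<Longrightarrow> c \<le> \<delta> i j"
  proof -
    have "\<forall>e\<in>D. 0 < e" using \<delta>(1) by (auto simp: D_def)
    with \<open>finite D\<close> show "0 < c" by (simp add: c_def)
    fix i j assume "i < N" "j < N" "i \<noteq> j"
    then have "\<delta> i j \<in> D" by (auto simp: D_def)
    with \<open>finite D\<close> show "c \<le> \<delta> i j"
      unfolding c_def by (intro Min_le) auto
  qed
  obtain C where C: "0 < C"
    "\<And>x y. x \<in> seqs N \<Longrightarrow> y \<in> seqs N \<Longrightarrow> d (code x) (code y) \<le> C * udist p x y"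
    by (rule ex_upper_bound) blast
  have low: "c * udist p x y \<le> d (code x) (code y)" if xy: "x \<in> seqs N" "y \<in> seqs N" for x y
  proof (cases "x = y")
    case False
    then obtain n where n: "\<And>k. k < n \<Longrightarrow> x k = y k" "x n \<noteq> y n"
      by (metis neq_seqs_first_difference)
    let ?x = "\<lambda>k. x (n + k)" and ?y = "\<lambda>k. y (n + k)"
    have mem: "code ?x \<in> F (x n) ` E" "code ?y \<in> F (y n) ` E"
      using code_shift[OF shift_mem(1)[OF xy(1), of n]] code_shift[OF shift_mem(1)[OF xy(2), of n]]
        shift_mem(1)[OF xy(1), of "Suc n"] shift_mem(1)[OF xy(2), of "Suc n"]
      by (auto simp: E_def)
    have "c \<le> \<delta> (x n) (y n)"
      by (intro c(2) head_less[OF xy(1)] head_less[OF xy(2)] n(2))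
    also have "\<dots> \<le> d (code ?x) (code ?y)"
      by (intro \<delta>(2) head_less[OF xy(1)] head_less[OF xy(2)] n(2) mem)
    finally have "c * wt p (pre x n) \<le> wt p (pre x n) * d (code ?x) (code ?y)"
      using wt_pos[OF set_pre_subset[OF xy(1), of n]] by (simp add: mult.commute)
    also have "\<dots> = d (code x) (code y)"
      by (rule dist_code_eq[OF xy n(1), symmetric])
    also have "wt p (pre x n) = udist p x y"
      by (rule udist_eq[of n x y, OF n, symmetric])
    finally show ?thesis .
  qed (use xy code_mem in simp)
  have "inj_on code (seqs N)"
  proof (rule inj_onI, rule ccontr)
    fix x y assume xy: "x \<in> seqs N" "y \<in> seqs N" "code x = code y" "x \<noteq> y"
    then have "c * udist p x y \<le> 0"
      using low[OF xy(1,2)] code_mem by simp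
    moreover have "0 < udist p x y"
      using xy wt_pos[OF set_pre_subset[OF xy(1)]] by (simp add: udist_def)
    ultimately show False using c(1) by (simp add: mult_le_0_iff)
  qed
  then have "bij_betw code (seqs N) E"
    by (simp add: bij_betw_def E_def)
  with E_subset c(1) C low show ?thesis
    unfolding coded_def m by blast
qed

end

section \<open>Iterated function systems on Euclidean spaces\<close>

lemma mcomplete_eucl: "Metric_space.mcomplete (mspace (eucl d)) (mdist (eucl d))"
proof -
  interpret Metric_space "mspace (eucl d)" "mdist (eucl d)"
    by (rule Metric_space_mspace_mdist)
  show ?thesis
    unfolding mcomplete_def
  proof (intro allI impI)
    fix \<sigma> assume \<sigma>: "MCauchy \<sigma>"
    have "Cauchy (\<lambda>n. \<sigma> n i)" if "i < d" for i
    proof (rule metric_CauchyI)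
      fix e :: real assume "0 < e"
      then obtain k where k: "\<And>n n'. k \<le> n \<Longrightarrow> k \<le> n' \<Longrightarrow> mdist (eucl d) (\<sigma> n) (\<sigma> n') < e"
        using \<sigma> unfolding MCauchy_def by metis
      have "dist (\<sigma> m i) (\<sigma> n i) < e" if "k \<le> m" "k \<le> n" for m n
      proof -
        have "\<bar>\<sigma> m i - \<sigma> n i\<bar> \<le> L2_set (\<lambda>i. \<bar>\<sigma> m i - \<sigma> n i\<bar>) {..<d}"
          using \<open>i < d\<close> by (intro member_le_L2_set) auto
        then show ?thesis
          using k[OF that] by (simp add: dist_real_def mdist_eucl L2_set_def)
      qed
      then show "\<exists>k. \<forall>m\<ge>k. \<forall>n\<ge>k. dist (\<sigma> m i) (\<sigma> n i) < e" by blast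
    qed
    then have lim: "(\<lambda>n. \<sigma> n i) \<longlonglongrightarrow> lim (\<lambda>n. \<sigma> n i)" if "i < d" for i
      using that by (simp add: Cauchy_convergent_iff convergent_LIMSEQ_iff)
    define l where "l i = (if i < d then lim (\<lambda>n. \<sigma> n i) else 0)" for i
    have "(\<lambda>n. L2_set (\<lambda>i. \<sigma> n i - l i) {..<d}) \<longlonglongrightarrow> L2_set (\<lambda>i. l i - l i) {..<d}"
      unfolding L2_set_def by (intro tendsto_intros) (auto simp: l_def lim)
    then have "(\<lambda>n. mdist (eucl d) (\<sigma> n) l) \<longlonglongrightarrow> 0"
      by (simp add: mdist_eucl L2_set_def)
    moreover have "l \<in> mspace (eucl d)"
      by (simp add: mspace_eucl l_def)
    moreover have "\<sigma> n \<in> mspace (eucl d)" for n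
      using \<sigma> by (auto simp: MCauchy_def)
    ultimately show "\<exists>l. limitin mtopology \<sigma> l sequentially"
      by (auto simp: limitin_metric_dist_null)
  qed
qed

lemma coordinate_le_mdist_eucl: "i < d \<Longrightarrow> \<bar>x i - y i\<bar> \<le> mdist (eucl d) x y"
proof -
  assume "i < d"
  then have "\<bar>x i - y i\<bar> \<le> L2_set (\<lambda>i. \<bar>x i - y i\<bar>) {..<d}"
    by (intro member_le_L2_set) auto
  then show ?thesis by (simp add: mdist_eucl L2_set_def)
qed

text \<open>In positive dimension the origin and a unit vector are at distance 1, so the distance of
  their images determines the ratio.\<close>

lemma ratio_eq:
  assumes "1 \<le> d" "similarity d r f"
  shows "ratio d f = r"
proof -
  define e where "e k = (if k = 0 then 1 else 0 :: real)" for k :: nat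
  have mem: "(\<lambda>_. 0) \<in> mspace (eucl d)" "e \<in> mspace (eucl d)"
    using assms(1) by (auto simp: mspace_eucl e_def)
  have "(\<Sum>i<d. (0 - e i)\<^sup>2) = (\<Sum>i<d. if i = 0 then 1 else 0)"
    by (intro sum.cong) (auto simp: e_def)
  then have "mdist (eucl d) (\<lambda>_. 0) e = 1"
    using assms(1) by (simp add: mdist_eucl L2_set_def)
  then have "r' = mdist (eucl d) (f (\<lambda>_. 0)) (f e)" if "similarity d r' f" for r'
    using that mem by (auto simp: similarity_def)
  with assms(2) show ?thesis
    unfolding ratio_def by (intro the_equality) auto
qed

lemma is_IFS_D:
  assumes "is_IFS S" "i < length (maps S)"
  shows "similarity (ambient_dim S) (ratio (ambient_dim S) (maps S ! i)) (maps S ! i)"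
    and "0 < ratio (ambient_dim S) (maps S ! i)" "ratio (ambient_dim S) (maps S ! i) < 1"
proof -
  have "maps S ! i \<in> set (maps S)" using assms(2) by simp
  then obtain r where "0 < r" "r < 1" "similarity (ambient_dim S) r (maps S ! i)"
    using assms(1) unfolding is_IFS_def by blast
  moreover from this have "ratio (ambient_dim S) (maps S ! i) = r"
    using assms(1) by (intro ratio_eq) (auto simp: is_IFS_def)
  ultimately show "similarity (ambient_dim S) (ratio (ambient_dim S) (maps S ! i)) (maps S ! i)"
    "0 < ratio (ambient_dim S) (maps S ! i)" "ratio (ambient_dim S) (maps S ! i) < 1" by simp_all
qed

lemma similarity_system_IFS:
  assumes "is_IFS S"
  shows "similarity_system (mspace (eucl (ambient_dim S))) (mdist (eucl (ambient_dim S)))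
    (length (maps S)) (\<lambda>i. ratio (ambient_dim S) (maps S ! i)) (\<lambda>i. maps S ! i)"
proof -
  have "(\<lambda>_. 0) \<in> mspace (eucl (ambient_dim S))"
    by (simp add: mspace_eucl)
  with assms is_IFS_D[OF assms] show ?thesis
    unfolding similarity_system_def similarity_system_axioms_def ratio_system_def
    using Metric_space_mspace_mdist[of "eucl (ambient_dim S)"] mcomplete_eucl[of "ambient_dim S"]
    by (auto simp: is_IFS_def similarity_def)
qed

lemma attractor_eq:
  assumes "is_IFS S"
  shows "attractor S = similarity_system.E (mspace (eucl (ambient_dim S))) (mdist (eucl (ambient_dim S)))
    (length (maps S)) (\<lambda>i. maps S ! i)"
proof -
  interpret similarity_system "mspace (eucl (ambient_dim S))" "mdist (eucl (ambient_dim S))"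
    "length (maps S)" "\<lambda>i. ratio (ambient_dim S) (maps S ! i)" "\<lambda>i. maps S ! i"
    by (rule similarity_system_IFS[OF assms])
  have eq: "(\<Union>f\<in>set (maps S). f ` A) = (\<Union>i<length (maps S). (maps S ! i) ` A)" for A
    unfolding set_conv_nth by auto
  show ?thesis
    unfolding attractor_def mtopology_of_def eq
    using E_nonempty compactin_E E_eq_Union attractor_unique by (intro the_equality) blast+
qed

lemma coded_attractor:
  assumes "is_IFS S" "strong_separation S"
  shows "coded (length (maps S)) (\<lambda>i. ratio (ambient_dim S) (maps S ! i)) (eucl (ambient_dim S)) (attractor S)"
proof -
  interpret similarity_system "mspace (eucl (ambient_dim S))" "mdist (eucl (ambient_dim S))"
    "length (maps S)" "\<lambda>i. ratio (ambient_dim S) (maps S ! i)" "\<lambda>i. maps S ! i"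
    by (rule similarity_system_IFS[OF assms(1)])
  show ?thesis
    unfolding attractor_eq[OF assms(1)]
    using assms(2) unfolding strong_separation_def attractor_eq[OF assms(1)] disjoint_family_on_def
    by (intro coded_E) auto
qed

lemma ratio_system_IFS:
  "is_IFS S \<Longrightarrow> ratio_system (length (maps S)) (\<lambda>i. ratio (ambient_dim S) (maps S ! i))"
  using similarity_system_IFS unfolding similarity_system_def by blast

lemma dimH_eq:
  assumes "is_IFS S" "strong_separation S" "0 < s"
    and "(\<Sum>i<length (maps S). ratio (ambient_dim S) (maps S ! i) powr s) = 1"
  shows "dimH S = s"
  unfolding dimH_def
  by (rule ratio_system.Hausdorff_dim_coded[OF ratio_system_IFS[OF assms(1)] coded_attractor[OF assms(1,2)] assms(3,4)])

lemma sum_powr_dimH: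
  assumes "is_IFS S" "strong_separation S"
  shows "0 < dimH S" "(\<Sum>i<length (maps S). ratio (ambient_dim S) (maps S ! i) powr dimH S) = 1"
proof -
  obtain s where "0 < s" "(\<Sum>i<length (maps S). ratio (ambient_dim S) (maps S ! i) powr s) = 1"
    by (rule ratio_system.ex_similarity_dimension[OF ratio_system_IFS[OF assms(1)]])
  with dimH_eq[OF assms] show "0 < dimH S"
    "(\<Sum>i<length (maps S). ratio (ambient_dim S) (maps S ! i) powr dimH S) = 1" by simp_all
qed

text \<open>
  Any finite list of at least two ratios is realised with strong separation in a space of large
  dimension \<open>Suc n\<close>: the linear parts are multiples of the cyclic shift of the coordinates, and
  the translation parts \<open>real i\<close> in the first coordinate separate the pieces as soon as the
  products of \<open>Suc n\<close> ratios are small.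
\<close>

definition shift_map :: "nat \<Rightarrow> real \<Rightarrow> real \<Rightarrow> (nat \<Rightarrow> real) \<Rightarrow> nat \<Rightarrow> real" where
  "shift_map n a b x = (\<lambda>k. case k of 0 \<Rightarrow> a * x n + b | Suc j \<Rightarrow> if j < n then a * x j else 0)"

lemma similarity_shift_map:
  assumes "0 \<le> a"
  shows "similarity (Suc n) a (shift_map n a b)"
  unfolding similarity_def
proof (intro conjI ballI)
  show "shift_map n a b \<in> mspace (eucl (Suc n)) \<rightarrow> mspace (eucl (Suc n))"
    by (auto simp: shift_map_def mspace_eucl split: nat.split)
  fix x y
  have "(\<Sum>k<Suc n. (shift_map n a b x k - shift_map n a b y k)\<^sup>2)
      = (a * x n - a * y n)\<^sup>2 + (\<Sum>j<n. (a * x j - a * y j)\<^sup>2)"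
    by (simp add: sum.lessThan_Suc_shift shift_map_def del: sum.lessThan_Suc)
  also have "\<dots> = a\<^sup>2 * (\<Sum>k<Suc n. (x k - y k)\<^sup>2)"
    by (simp add: sum_distrib_left power_mult_distrib right_diff_distrib[symmetric] distrib_left)
  finally show "mdist (eucl (Suc n)) (shift_map n a b x) (shift_map n a b y) = a * mdist (eucl (Suc n)) x y"
    using assms by (simp add: mdist_eucl L2_set_def real_sqrt_mult del: sum.lessThan_Suc)
qed

lemma closedin_eucl_box:
  "closedin (mtopology_of (eucl d)) {x \<in> mspace (eucl d). \<forall>k<d. 0 \<le> x k \<and> x k \<le> b k}"
proof -
  interpret Metric_space "mspace (eucl d)" "mdist (eucl d)"
    by (rule Metric_space_mspace_mdist)
  let ?K = "{x \<in> mspace (eucl d). \<forall>k<d. 0 \<le> x k \<and> x k \<le> b k}"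
  have "\<exists>r>0. disjnt ?K (mball x r)" if "x \<in> mspace (eucl d) - ?K" for x
  proof -
    have "\<exists>k<d. x k < 0 \<or> b k < x k"
      using that by (auto simp: not_le[symmetric])
    then obtain k where k: "k < d" "x k < 0 \<or> b k < x k" by blast
    define r where "r = (if x k < 0 then - x k else x k - b k)"
    have "0 < r" using k(2) by (auto simp: r_def)
    moreover have "y \<notin> mball x r" if "y \<in> ?K" for y
      using that k coordinate_le_mdist_eucl[OF k(1), of x y] by (auto simp: r_def split: if_splits)
    ultimately show ?thesis by (auto simp: disjnt_iff)
  qed
  then show ?thesis
    unfolding mtopology_of_def closedin_metric by blast
qed

lemma ex_IFS_with_ratios:
  assumes len: "2 \<le> length ps" and ps: "\<And>a. a \<in> set ps \<Longrightarrow> 0 < a \<and> a < 1"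
  obtains T where "is_IFS T" "strong_separation T"
    "map (ratio (ambient_dim T)) (maps T) = ps"
proof -
  let ?N = "length ps"
  interpret R: ratio_system ?N "\<lambda>i. ps ! i"
    using len ps by unfold_locales auto
  \<comment> \<open>In \<open>Suc n\<close> steps the cyclic shift brings the first coordinate back,
    shrunk by a product of \<open>Suc n\<close> ratios, at most \<open>c\<close>. The factor
    \<open>?N + 1\<close> is what yields \<open>c * B < 1\<close> below.\<close>
  obtain n where n: "(real ?N + 1) * R.pmax ^ n < 1"
    using R.ex_pmax_power_le[of 1] by auto
  define c where "c = R.pmax ^ Suc n"
  have c: "0 < c" "(real ?N + 1) * c < 1"
  proof -
    show "0 < c" using R.pmax_pos by (simp add: c_def)
    have "c \<le> R.pmax ^ n"
      unfolding c_def using R.pmax_pos R.pmax_less_1 by (intro power_decreasing) auto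
    then have "(real ?N + 1) * c \<le> (real ?N + 1) * R.pmax ^ n"
      by (intro mult_left_mono) auto
    with n show "(real ?N + 1) * c < 1" by (rule le_less_trans[rotated])
  qed
  then have "c < 1"
    by (smt (verit) mult_le_cancel_right1 of_nat_0_le_iff)
  \<comment> \<open>The bound for the first coordinate, a fixed point of
    \<open>B \<mapsto> ?N + c * B\<close>: the translation is at most \<open>?N\<close>, the
    returning part at most \<open>c * B\<close>.\<close>
  define B where "B = real ?N / (1 - c)"
  have B: "0 \<le> B" "real ?N + c * B = B" "c * B < 1"
  proof -
    show "0 \<le> B" using \<open>c < 1\<close> by (simp add: B_def)
    have "(1 - c) * B = real ?N" using \<open>c < 1\<close> by (simp add: B_def)
    then show "real ?N + c * B = B" by (simp add: algebra_simps)
    have "c * real ?N < 1 - c" using c(2) by (simp add: algebra_simps)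
    then show "c * B < 1" using \<open>c < 1\<close> by (simp add: B_def field_simps)
  qed
  define T where "T = IFS (Suc n) (map (\<lambda>i. shift_map n (ps ! i) (real i)) [0..<?N])"
  have T: "ambient_dim T = Suc n" "length (maps T) = ?N"
    "\<And>i. i < ?N \<Longrightarrow> maps T ! i = shift_map n (ps ! i) (real i)"
    by (simp_all add: T_def)
  have sim: "similarity (Suc n) (ps ! i) (maps T ! i)" if "i < ?N" for i
    using that R.pos[OF that] T(3) by (simp add: similarity_shift_map)
  have IFS: "is_IFS T"
    unfolding is_IFS_def T(1,2)
  proof (intro conjI ballI)
    fix f assume "f \<in> set (maps T)"
    then obtain i where "i < ?N" "f = maps T ! i" by (auto simp: in_set_conv_nth T(2))
    with sim R.pos R.less_1 show "\<exists>r>0. r < 1 \<and> similarity (Suc n) r f" by blast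
  qed (use len in simp_all)
  have ratio: "ratio (ambient_dim T) (maps T ! i) = ps ! i" if "i < ?N" for i
    using sim[OF that] by (simp add: T(1) ratio_eq)
  interpret similarity_system "mspace (eucl (ambient_dim T))" "mdist (eucl (ambient_dim T))"
    "length (maps T)" "\<lambda>i. ratio (ambient_dim T) (maps T ! i)" "\<lambda>i. maps T ! i"
    by (rule similarity_system_IFS[OF IFS])
  \<comment> \<open>Coordinate \<open>k\<close> carries a first coordinate of \<open>k\<close> steps
    earlier, whence the factor \<open>R.pmax ^ k\<close>.\<close>
  define Box where "Box = {x \<in> mspace (eucl (Suc n)). \<forall>k<Suc n. 0 \<le> x k \<and> x k \<le> R.pmax ^ k * B}"
  have "attractor T \<subseteq> Box"
    unfolding attractor_eq[OF IFS]
  proof (rule E_subset_invariant)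
    show "closedin mtopology Box"
      using closedin_eucl_box[of "Suc n" "\<lambda>k. R.pmax ^ k * B"]
      by (simp add: Box_def mtopology_of_def T(1))
    have "(\<lambda>_. 0) \<in> Box"
      using B(1) R.pmax_pos by (simp add: Box_def mspace_eucl)
    then show "Box \<noteq> {}" by blast
    fix i assume "i < length (maps T)"
    then have i: "i < ?N" by (simp add: T(2))
    show "(maps T ! i) ` Box \<subseteq> Box"
    proof
      fix y assume "y \<in> (maps T ! i) ` Box"
      then obtain x where x: "x \<in> Box" "y = shift_map n (ps ! i) (real i) x"
        using T(3)[OF i] by auto
      have le: "0 \<le> ps ! i * x k \<and> ps ! i * x k \<le> R.pmax ^ Suc k * B" if "k < Suc n" for k
      proof
        have xk: "0 \<le> x k" "x k \<le> R.pmax ^ k * B" using x(1) that by (auto simp: Box_def)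
        then show "0 \<le> ps ! i * x k" using R.pos[OF i] by simp
        have "ps ! i * x k \<le> R.pmax * (R.pmax ^ k * B)"
          using xk R.le_pmax[OF i] R.pmax_pos by (intro mult_mono) auto
        then show "ps ! i * x k \<le> R.pmax ^ Suc k * B" by simp
      qed
      have "y \<in> mspace (eucl (Suc n))"
        using x(2) by (auto simp: shift_map_def mspace_eucl split: nat.split)
      moreover have "0 \<le> y k \<and> y k \<le> R.pmax ^ k * B" if "k < Suc n" for k
      proof (cases k)
        case 0
        have "ps ! i * x n + real i \<le> c * B + real ?N"
          using le[of n] i by (simp add: c_def)
        with le[of n] B(2) show ?thesis by (simp add: x(2) shift_map_def 0)
      next
        case (Suc j)
        with that le[of j] show ?thesis by (simp add: x(2) shift_map_def)
      qed
      ultimately show "y \<in> Box" by (simp add: Box_def)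
    qed
  qed
  then have in_Box: "0 \<le> ps ! i * x n \<and> ps ! i * x n < 1" if "x \<in> attractor T" "i < ?N" for x i
  proof -
    have xn: "0 \<le> x n" "x n \<le> R.pmax ^ n * B"
      using that \<open>attractor T \<subseteq> Box\<close> by (auto simp: Box_def)
    have "ps ! i * x n \<le> R.pmax * (R.pmax ^ n * B)"
      using xn R.le_pmax[OF that(2)] R.pmax_pos by (intro mult_mono) auto
    also have "\<dots> < 1" using B(3) by (simp add: c_def)
    finally show ?thesis using xn R.pos[OF that(2)] by simp
  qed
  have disj: "(maps T ! i) ` attractor T \<inter> (maps T ! j) ` attractor T = {}" if "i < j" "j < ?N" for i j
  proof (rule ccontr)
    assume "\<not> ?thesis"
    then obtain x y where xy: "x \<in> attractor T" "y \<in> attractor T" "(maps T ! i) x = (maps T ! j) y"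
      by blast
    \<comment> \<open>The first coordinates of the two pieces lie in the disjoint intervals [i, i+1)
      and [j, j+1).\<close>
    have "ps ! i * x n + real i = ps ! j * y n + real j"
      using fun_cong[OF xy(3), of 0] that by (simp add: T(3) shift_map_def)
    moreover have "real i + 1 \<le> real j" using that by linarith
    ultimately show False
      using in_Box[OF xy(1), of i] in_Box[OF xy(2), of j] that by simp
  qed
  have "strong_separation T"
    unfolding strong_separation_def disjoint_family_on_def T(2)
    using disj by (metis Int_commute lessThan_iff linorder_neqE_nat)
  moreover have "map (ratio (ambient_dim T)) (maps T) = ps"
    using ratio T(2) by (intro nth_equalityI) auto
  ultimately show thesis using that IFS by blast
qed

section \<open>Semigroups and semirings\<close>

lemma mult_semigroup_subset:
  assumes "A \<subseteq> mult_semigroup B"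
  shows "mult_semigroup A \<subseteq> mult_semigroup B"
proof
  fix x assume "x \<in> mult_semigroup A"
  then show "x \<in> mult_semigroup B"
    using assms by induction (auto intro: mult_semigroup.mult)
qed

lemma power_mem_mult_semigroup:
  "x \<in> mult_semigroup A \<Longrightarrow> 0 < n \<Longrightarrow> x ^ n \<in> mult_semigroup A"
proof (induction n)
  case (Suc n)
  then show ?case
    by (cases "n = 0") (auto intro: mult_semigroup.mult)
qed simp

lemma mult_semigroup_singleton: "mult_semigroup {r} = {r ^ k |k. 0 < k}"
proof
  show "mult_semigroup {r} \<subseteq> {r ^ k |k. 0 < k}"
  proof
    fix x assume "x \<in> mult_semigroup {r}"
    then show "x \<in> {r ^ k |k. 0 < k}"
    proof induction
      case (base a)
      then show ?case by (auto intro!: exI[of _ "1::nat"])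
    next
      case (mult a b)
      then obtain j k where "a = r ^ j" "b = r ^ k" "0 < j" by auto
      then show ?case by (auto simp: power_add[symmetric] intro!: exI[of _ "j + k"])
    qed
  qed
  have "r ^ k \<in> mult_semigroup {r}" if "0 < k" for k
    using that by (intro power_mem_mult_semigroup mult_semigroup.base) simp_all
  then show "{r ^ k |k. 0 < k} \<subseteq> mult_semigroup {r}" by blast
qed

text \<open>The 1 accounts for vanishing exponents; the semigroup itself need not contain
  it.\<close>

lemma prod_power_mem_mult_semigroup:
  assumes "finite I" "q ` I \<subseteq> A"
  shows "(\<Prod>i\<in>I. q i ^ e i) \<in> insert 1 (mult_semigroup A)"
  using assms
proof (induction I)
  case (insert i I)
  have "q i ^ e i \<in> insert 1 (mult_semigroup A)"
  proof (cases "e i = 0")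
    case False
    then have "q i ^ e i \<in> mult_semigroup A"
      using insert.prems by (intro power_mem_mult_semigroup mult_semigroup.base) auto
    then show ?thesis by simp
  qed simp
  with insert show ?case
    by (auto intro: mult_semigroup.mult)
qed simp

lemma mult_semigroup_eq_wt:
  assumes "h \<in> mult_semigroup (p ` {..<N})"
  obtains c where "set c \<subseteq> {..<N}" "wt p c = h"
proof -
  have "\<exists>c. set c \<subseteq> {..<N} \<and> wt p c = h"
    using assms
  proof induction
    case (base a)
    then obtain i where "i < N" "a = p i" by auto
    then show ?case by (intro exI[of _ "[i]"]) simp
  next
    case (mult a b)
    then obtain u v where "set u \<subseteq> {..<N}" "wt p u = a" "set v \<subseteq> {..<N}" "wt p v = b" by blast
    then show ?case by (intro exI[of _ "u @ v"]) simp
  qed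
  then show thesis using that by blast
qed

lemma pos_int_semiring_subset:
  assumes "A \<subseteq> pos_int_semiring B"
  shows "pos_int_semiring A \<subseteq> pos_int_semiring B"
proof
  fix x assume "x \<in> pos_int_semiring A"
  then show "x \<in> pos_int_semiring B"
    using assms by induction (auto intro: pos_int_semiring.intros)
qed

lemma power_mem_pos_int_semiring:
  "x \<in> pos_int_semiring A \<Longrightarrow> x ^ Suc n \<in> pos_int_semiring A"
  by (induction n) (auto intro: pos_int_semiring.mult)

lemma sum_list_mem_pos_int_semiring:
  "xs \<noteq> [] \<Longrightarrow> set xs \<subseteq> pos_int_semiring A \<Longrightarrow> sum_list xs \<in> pos_int_semiring A"
proof (induction xs)
  case (Cons x xs)
  then show ?case
    by (cases "xs = []") (auto intro: pos_int_semiring.add)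
qed simp

section \<open>Splitting a map\<close>

text \<open>The exponents of the \<open>n\<close>-fold products of the system with ratios \<open>r ^ l k\<close>, \<open>1 \<le> k \<le> m\<close>.\<close>

primrec fold_sums :: "(nat \<Rightarrow> nat) \<Rightarrow> nat \<Rightarrow> nat \<Rightarrow> nat list" where
  "fold_sums l m 0 = [0]"
| "fold_sums l m (Suc n) = concat (map (\<lambda>a. map (\<lambda>k. a + l k) [1..<Suc m]) (fold_sums l m n))"

lemma sum_list_power_fold_sums:
  fixes x :: real
  shows "(\<Sum>a\<leftarrow>fold_sums l m n. x ^ a) = (\<Sum>k=1..m. x ^ l k) ^ n"
proof (induction n)
  case (Suc n)
  have inner: "(\<Sum>k\<leftarrow>[1..<Suc m]. x ^ (a + l k)) = x ^ a * (\<Sum>k=1..m. x ^ l k)" for a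
    by (simp add: power_add sum_list_const_mult interv_sum_list_conv_sum_set_nat atLeastLessThanSuc_atLeastAtMost
        del: upt_Suc)
  have concat: "(\<Sum>a\<leftarrow>concat (map h xs). f a) = (\<Sum>y\<leftarrow>xs. \<Sum>a\<leftarrow>h y. f a)"
    for f :: "nat \<Rightarrow> real" and h :: "nat \<Rightarrow> nat list" and xs
    by (induction xs) simp_all
  have "(\<Sum>a\<leftarrow>fold_sums l m (Suc n). x ^ a) = (\<Sum>a\<leftarrow>fold_sums l m n. \<Sum>k\<leftarrow>[1..<Suc m]. x ^ (a + l k))"
    by (simp add: concat o_def del: upt_Suc)
  also have "\<dots> = (\<Sum>a\<leftarrow>fold_sums l m n. x ^ a) * (\<Sum>k=1..m. x ^ l k)"
    unfolding inner by (rule sum_list_mult_const)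
  finally show ?case using Suc by simp
qed simp

text \<open>Take \<open>k = 1\<close> in each of the \<open>n\<close> rounds. This names one power
  of \<open>r\<close> that is certainly a ratio after the splitting.\<close>

lemma mult_mem_fold_sums: "1 \<le> m \<Longrightarrow> n * l 1 \<in> set (fold_sums l m n)"
  proof (induction n)
  case (Suc n)
  then have "n * l 1 + l 1 \<in> set (map (\<lambda>k. n * l 1 + l k) [1..<Suc m])"
    unfolding set_map by (intro image_eqI[of _ _ 1]) auto
  with Suc show ?case
    by (auto simp: add.commute simp del: upt_Suc intro!: bexI[of _ "n * l (Suc 0)"])
qed simp

text \<open>Only one map of ratio \<open>r\<close> is replaced; others of the same ratio stay. The
  exponent is \<open>Suc a\<close> because the pieces are \<open>r\<close> times the n-fold
  products.\<close>

definition split_list :: "(nat \<Rightarrow> nat) \<Rightarrow> nat \<Rightarrow> real \<Rightarrow> real list \<Rightarrow> nat \<Rightarrow> real list" where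
  "split_list l m r rs n = remove1 r rs @ map (\<lambda>a. r ^ Suc a) (fold_sums l m n)"

locale split_system =
  fixes l :: "nat \<Rightarrow> nat" and m :: nat and r s :: real and rs :: "real list"
  assumes length_rs: "2 \<le> length rs"
    and rs: "a \<in> set rs \<Longrightarrow> 0 < a \<and> a < 1"
    and r_mem: "r \<in> set rs"
    and s_pos: "0 < s"
    and sum_rs: "(\<Sum>a\<leftarrow>rs. a powr s) = 1"
    and l_pos: "k \<in> {1..m} \<Longrightarrow> 0 < l k"
    and sum_l: "(\<Sum>k=1..m. r powr (s * real (l k))) = 1"
    and ex_bad: "\<exists>a\<in>set rs. \<forall>g\<in>mult_semigroup (set rs). a * g \<notin> mult_semigroup {r}"
begin

abbreviation ratio_list :: "nat \<Rightarrow> real list" where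
  "ratio_list \<equiv> split_list l m r rs"

text \<open>Stated with the semigroup of the original ratios, so that goodness of a number does not
  vary with \<open>n\<close>.\<close>

definition good :: "real \<Rightarrow> bool" where
  "good a \<longleftrightarrow> (\<exists>g\<in>mult_semigroup (set rs). a * g \<in> mult_semigroup {r})"

definition Q :: "real \<Rightarrow> real" where
  "Q t = (\<Sum>k=1..m. (r powr t) ^ l k)"

lemma r: "0 < r" "r < 1"
  using rs r_mem by auto

lemma Q_s: "Q s = 1"
  using sum_l r by (simp add: Q_def powr_realpow[symmetric] powr_powr)

text \<open>Without exponents the sum is 0, with a single one it is below 1. At least two exponents
  are what makes the number of pieces grow with \<open>n\<close>.\<close>

lemma two_le_m: "2 \<le> m"
proof (rule ccontr)
  assume "\<not> 2 \<le> m"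
  then consider "m = 0" | "m = 1" by linarith
  then show False
  proof cases
    case 1
    then show False using Q_s unfolding Q_def by simp
  next
    case 2
    have "r powr s < 1"
      using powr_less_mono2[of s r 1] r s_pos by simp
    then have "(r powr s) ^ l 1 < 1"
      using l_pos[of 1] 2 power_strict_mono[of "r powr s" 1 "l 1"] by simp
    then show False using Q_s 2 unfolding Q_def by simp
  qed
qed

lemma Q_gt_1:
  assumes "t < s"
  shows "1 < Q t"
proof -
  have "Q s < Q t"
    unfolding Q_def
  proof (intro sum_strict_mono)
    fix k assume k: "k \<in> {1..m}"
    have "r powr s < r powr t"
      using r assms by (intro powr_less_mono') auto
    then show "(r powr s) ^ l k < (r powr t) ^ l k"
      using l_pos[OF k] by (intro power_strict_mono) auto
  qed (use two_le_m in auto)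
  then show ?thesis by (simp add: Q_s)
qed

section \<open>Effect of the splitting on dimension, semigroup and semiring\<close>

lemma sum_list_split:
  "(\<Sum>a\<leftarrow>ratio_list n. f a) = (\<Sum>a\<leftarrow>remove1 r rs. f a) + (\<Sum>a\<leftarrow>fold_sums l m n. f (r ^ Suc a))"
  by (simp add: split_list_def o_def)

lemma sum_powr_fold_sums: "(\<Sum>a\<leftarrow>fold_sums l m n. (r ^ Suc a) powr t) = r powr t * Q t ^ n"
proof -
  have "(r ^ Suc a) powr t = r powr t * (r powr t) ^ a" for a
    using r by (simp add: powr_mult powr_realpow[symmetric] powr_powr mult.commute)
  then show ?thesis
    by (simp add: sum_list_const_mult sum_list_power_fold_sums Q_def del: power_Suc)
qed

lemma sum_ratio_list: "(\<Sum>a\<leftarrow>ratio_list n. a powr s) = 1"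
  using sum_list_map_remove1[OF r_mem, of "\<lambda>a. a powr s"]
  unfolding sum_list_split sum_powr_fold_sums by (simp add: Q_s sum_rs)

lemma mult_mem_exponents: "r ^ Suc (n * l 1) \<in> set (ratio_list n)"
  using mult_mem_fold_sums[of m n l] two_le_m by (auto simp: split_list_def simp del: power_Suc)

lemma ratio_list_in: "a \<in> set (ratio_list n) \<Longrightarrow> 0 < a \<and> a < 1"
proof -
  assume "a \<in> set (ratio_list n)"
  then consider "a \<in> set rs" | k where "a = r ^ Suc k"
    using set_remove1_subset[of r rs] by (auto simp: split_list_def simp del: power_Suc)
  then show ?thesis
    using r rs by cases (auto simp: power_Suc_less_one simp del: power_Suc)
qed

lemma length_ratio_list: "2 \<le> length (ratio_list n)"
proof -
  have "fold_sums l m n \<noteq> []"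
    using mult_mem_fold_sums[of m n l] two_le_m by force
  then show ?thesis
    using length_rs r_mem by (cases "fold_sums l m n") (auto simp: split_list_def length_remove1)
qed

lemma ratio_list_subset: "set (ratio_list n) \<subseteq> mult_semigroup (set rs)"
proof
  fix a assume "a \<in> set (ratio_list n)"
  then consider "a \<in> set rs" | k where "a = r ^ Suc k"
    using set_remove1_subset[of r rs] by (auto simp: split_list_def simp del: power_Suc)
  then show "a \<in> mult_semigroup (set rs)"
    using r_mem by cases (auto intro: mult_semigroup.base intro!: power_mem_mult_semigroup simp del: power_Suc)
qed

text \<open>Only \<open>r\<close> can disappear from the generators, and its power with exponent
  \<open>Suc (n * l 1)\<close> is among the new ones. The exponent is the same for all elements, as
  the equivalence of semigroups demands.\<close>

lemma power_mem_ratio_semigroup: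
  assumes "g \<in> mult_semigroup (set rs)"
  shows "g ^ Suc (n * l 1) \<in> mult_semigroup (set (ratio_list n))"
  using assms
proof induction
  case (base a)
  show ?case
  proof (cases "a = r")
    case True
    then show ?thesis using mult_mem_exponents by (auto intro: mult_semigroup.base simp del: power_Suc)
  next
    case False
    with base have "a \<in> set (remove1 r rs)" by (simp add: in_set_remove1)
    then show ?thesis
      by (intro power_mem_mult_semigroup mult_semigroup.base) (auto simp: split_list_def)
  qed
next
  case (mult a b)
  then show ?case unfolding power_mult_distrib by (intro mult_semigroup.mult)
qed

lemma semigroup_equiv_ratio_list:
  "semigroup_equiv (mult_semigroup (set (ratio_list n))) (mult_semigroup (set rs))"
  unfolding semigroup_equiv_def
proof (intro exI conjI ballI)
  show "g ^ 1 \<in> mult_semigroup (set rs)" if "g \<in> mult_semigroup (set (ratio_list n))" for g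
    using mult_semigroup_subset[OF ratio_list_subset] that by auto
  show "g ^ Suc (n * l 1) \<in> mult_semigroup (set (ratio_list n))" if "g \<in> mult_semigroup (set rs)" for g
    by (rule power_mem_ratio_semigroup[OF that])
qed simp_all

text \<open>New generators are powers of old ones. Conversely the only generator that can be lost,
  \<open>r powr s\<close>, is the sum of the s-th powers of its pieces, because
  \<open>Q s = 1\<close>.\<close>

lemma pos_int_semiring_ratio_list:
  "pos_int_semiring ((\<lambda>a. a powr s) ` set (ratio_list n)) = pos_int_semiring ((\<lambda>a. a powr s) ` set rs)"
  (is "?L = ?R")
proof
  have pow: "(r ^ Suc a) powr s = (r powr s) ^ Suc a" for a
  proof -
    have "(r ^ Suc a) powr s = (r powr real (Suc a)) powr s"
      by (simp only: powr_realpow[OF r(1)])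
    also have "\<dots> = (r powr s) powr real (Suc a)"
      by (simp only: powr_powr mult.commute)
    also have "\<dots> = (r powr s) ^ Suc a"
      using r(1) by (intro powr_realpow) simp
    finally show ?thesis .
  qed
  show "?L \<subseteq> ?R"
  proof (rule pos_int_semiring_subset, clarify)
    fix a assume "a \<in> set (ratio_list n)"
    then consider "a \<in> set rs" | k where "a = r ^ Suc k"
      using set_remove1_subset[of r rs] by (auto simp: split_list_def simp del: power_Suc)
    then show "a powr s \<in> ?R"
    proof cases
      case 1
      then show ?thesis by (intro pos_int_semiring.base imageI)
    next
      case 2
      show ?thesis
        unfolding 2 pow by (intro power_mem_pos_int_semiring pos_int_semiring.base imageI r_mem)
    qed
  qed
  show "?R \<subseteq> ?L"
  proof (rule pos_int_semiring_subset, clarify)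
    fix a assume a: "a \<in> set rs"
    show "a powr s \<in> ?L"
    proof (cases "a = r")
      case True
      have "r powr s = (\<Sum>a\<leftarrow>fold_sums l m n. (r ^ Suc a) powr s)"
        by (simp add: sum_powr_fold_sums Q_s del: power_Suc)
      also have "\<dots> \<in> ?L"
      proof (rule sum_list_mem_pos_int_semiring)
        show "map (\<lambda>a. (r ^ Suc a) powr s) (fold_sums l m n) \<noteq> []"
          using mult_mem_fold_sums[of m n l] two_le_m by force
        show "set (map (\<lambda>a. (r ^ Suc a) powr s) (fold_sums l m n)) \<subseteq> ?L"
          by (auto simp: split_list_def simp del: power_Suc intro!: pos_int_semiring.base)
      qed
      finally show ?thesis using True by simp
    next
      case False
      with a have "a \<in> set (ratio_list n)" by (simp add: split_list_def in_set_remove1)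
      then show ?thesis by (intro pos_int_semiring.base imageI)
    qed
  qed
qed

section \<open>Good ratios: power sums and completions\<close>

lemma good_power: "good (r ^ Suc k)"
proof -
  have "r ^ Suc k * r \<in> mult_semigroup {r}"
    unfolding power_Suc2[symmetric] by (intro power_mem_mult_semigroup mult_semigroup.base) simp_all
  then show ?thesis
    unfolding good_def by (rule bexI) (rule mult_semigroup.base[OF r_mem])
qed

definition P :: "nat \<Rightarrow> real \<Rightarrow> real" where
  "P n t = (\<Sum>a\<leftarrow>ratio_list n. if good a then a powr t else 0)"

text \<open>The pieces of the split map are powers of \<open>r\<close>, hence all good, so
  \<open>n\<close> enters only through \<open>Q t ^ n\<close>.\<close>

lemma P_eq:
  "P n t = (\<Sum>a\<leftarrow>remove1 r rs. if good a then a powr t else 0) + r powr t * Q t ^ n"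
proof -
  have "(\<Sum>a\<leftarrow>fold_sums l m n. if good (r ^ Suc a) then (r ^ Suc a) powr t else 0)
      = (\<Sum>a\<leftarrow>fold_sums l m n. (r ^ Suc a) powr t)"
    using good_power by (simp del: power_Suc)
  then show ?thesis
    unfolding P_def sum_list_split sum_powr_fold_sums by simp
qed

lemma P_less:
  assumes "t < s" "i < j"
  shows "P i t < P j t"
  using Q_gt_1[OF assms(1)] r assms(2) by (simp add: P_eq power_strict_increasing)

text \<open>The full power sum is 1 and a bad ratio takes a positive share of it. That ratio differs
  from \<open>r\<close>, which is good, so it survives the splitting.\<close>

lemma P_s_less_1: "P n s < 1"
proof -
  obtain b where b: "b \<in> set rs" "\<not> good b"
    using ex_bad by (auto simp: good_def)
  then have "b \<noteq> r" using good_power[of 0] by auto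
  with b have mem: "b \<in> set (remove1 r rs)" by (simp add: in_set_remove1)
  have "(\<Sum>a\<leftarrow>remove1 r rs. if good a then a powr s else 0)
      = (\<Sum>a\<leftarrow>remove1 b (remove1 r rs). if good a then a powr s else 0)"
    using sum_list_map_remove1[OF mem, of "\<lambda>a. if good a then a powr s else 0"] b by simp
  also have "\<dots> \<le> (\<Sum>a\<leftarrow>remove1 b (remove1 r rs). a powr s)"
    by (intro sum_list_mono) simp
  also have "\<dots> < b powr s + (\<Sum>a\<leftarrow>remove1 b (remove1 r rs). a powr s)"
    using rs[OF b(1)] by simp
  also have "\<dots> = (\<Sum>a\<leftarrow>remove1 r rs. a powr s)"
    by (rule sum_list_map_remove1[OF mem, symmetric])
  also have "\<dots> = 1 - r powr s"
    using sum_list_map_remove1[OF r_mem, of "\<lambda>a. a powr s"] sum_rs by simp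
  finally show ?thesis by (simp add: P_eq Q_s)
qed

text \<open>At \<open>t = 0\<close> the pieces alone contribute \<open>m ^ n \<ge> 2\<close>, which
  uses \<open>n \<ge> 1\<close>, and at \<open>s\<close> the value is below 1.\<close>

lemma ex_P_eq_1:
  assumes "1 \<le> n"
  obtains t where "0 < t" "t < s" "P n t = 1"
proof -
  have "(2::real) \<le> real m" using two_le_m by simp
  also have "\<dots> = real m ^ 1" by simp
  also have "\<dots> \<le> real m ^ n"
    using assms two_le_m by (intro power_increasing) auto
  also have "\<dots> = r powr 0 * Q 0 ^ n"
    using r by (simp add: Q_def)
  also have "\<dots> \<le> P n 0"
    unfolding P_eq by (auto intro!: sum_list_nonneg)
  finally have P0: "1 < P n 0" by simp
  have "continuous_on {0..s} (P n)"
  proof -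
    have "continuous_on {0..s} (\<lambda>t. \<Sum>a\<leftarrow>xs. if good a then a powr t else 0)"
      if "\<And>a. a \<in> set xs \<Longrightarrow> 0 < a" for xs
      using that
    proof (induction xs)
      case (Cons a xs)
      have "continuous_on {0..s} (\<lambda>t. if good a then a powr t else 0)"
        using Cons.prems[of a] by (cases "good a") (auto intro!: continuous_intros)
      then have "continuous_on {0..s} (\<lambda>t. (if good a then a powr t else 0)
          + (\<Sum>a\<leftarrow>xs. if good a then a powr t else 0))"
        using Cons.prems by (intro continuous_on_add Cons.IH) auto
      then show ?case by simp
    qed simp
    from this[of "ratio_list n"] show ?thesis
      unfolding P_def[abs_def] using ratio_list_in by simp
  qed
  then obtain t where t: "0 \<le> t" "t \<le> s" "P n t = 1"
    using IVT2'[of "P n" s 1 0] P0 P_s_less_1[of n] s_pos by (auto simp: less_imp_le)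
  then have "t \<noteq> 0" "t \<noteq> s" using P0 P_s_less_1[of n] by auto
  with t that[of t] show thesis by simp
qed

text \<open>The completing \<open>g\<close> comes from the original semigroup, and only its power
  \<open>Suc ?u\<close> is known to lie in that of the list. In the same power of
  \<open>a * g\<close> one factor \<open>a\<close> is set aside and the rest is
  \<open>h\<close>.\<close>

lemma good_completion:
  assumes "a \<in> set (ratio_list n)" "good a"
  obtains h where "h \<in> mult_semigroup (set (ratio_list n))" "a * h \<in> mult_semigroup {r}"
proof -
  let ?S = "mult_semigroup (set (ratio_list n))" and ?u = "n * l 1"
  obtain g where g: "g \<in> mult_semigroup (set rs)" "a * g \<in> mult_semigroup {r}"
    using assms(2) by (auto simp: good_def)
  have gu: "g ^ Suc ?u \<in> ?S" by (rule power_mem_ratio_semigroup[OF g(1)])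
  have "a ^ ?u * g ^ Suc ?u \<in> ?S"
  proof (cases "?u = 0")
    case False
    then have "a ^ ?u \<in> ?S"
      using assms(1) by (intro power_mem_mult_semigroup mult_semigroup.base) auto
    then show ?thesis using gu by (rule mult_semigroup.mult)
  next
    case True
    then have "a ^ ?u = 1" by (simp only: power_0)
    with gu show ?thesis by (simp only: mult_1_left)
  qed
  moreover have "a * (a ^ ?u * g ^ Suc ?u) = (a * g) ^ Suc ?u"
    by (simp add: power_mult_distrib mult_ac)
  moreover have "(a * g) ^ Suc ?u \<in> mult_semigroup {r}"
    by (rule power_mem_mult_semigroup[OF g(2)]) simp
  ultimately show thesis using that by metis
qed

text \<open>Weights ignore the order of the letters, so the completions of the single letters can be
  collected behind the word.\<close>

lemma good_word_completion:
  assumes "set u \<subseteq> {i. i < length (ratio_list n) \<and> good (ratio_list n ! i)}"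
  shows "\<exists>c k. set c \<subseteq> {..<length (ratio_list n)} \<and> wt ((!) (ratio_list n)) (u @ c) = r ^ k"
  using assms
proof (induction u)
  case Nil
  show ?case by (intro exI[of _ "[]"] exI[of _ 0]) simp
next
  case (Cons i u)
  let ?q = "(!) (ratio_list n)"
  obtain c k where c: "set c \<subseteq> {..<length (ratio_list n)}" "wt ?q (u @ c) = r ^ k"
    using Cons by auto
  have i: "ratio_list n ! i \<in> set (ratio_list n)" "good (ratio_list n ! i)"
    using Cons.prems by auto
  obtain h where h: "h \<in> mult_semigroup (set (ratio_list n))" "ratio_list n ! i * h \<in> mult_semigroup {r}"
    by (rule good_completion[OF i])
  have "set (ratio_list n) = ?q ` {..<length (ratio_list n)}"
    by (auto simp: set_conv_nth)
  then obtain c' where c': "set c' \<subseteq> {..<length (ratio_list n)}" "wt ?q c' = h"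
    using h(1) mult_semigroup_eq_wt[of h ?q] by metis
  obtain k' where "ratio_list n ! i * h = r ^ k'"
    using h(2) by (auto simp: mult_semigroup_singleton)
  then have "wt ?q ((i # u) @ (c @ c')) = r ^ (k' + k)"
    using c c' by (simp add: power_add mult_ac)
  with c c' show ?case
    by (intro exI[of _ "c @ c'"] exI[of _ "k' + k"]) simp
qed

text \<open>If such a product were a power of \<open>r\<close>, the product without one occurrence
  of a bad letter would complete that letter and make it good.\<close>

lemma bad_product:
  assumes "\<exists>i<length (ratio_list n). \<not> good (ratio_list n ! i) \<and> 0 < e i"
  shows "(\<Prod>i<length (ratio_list n). (ratio_list n ! i) ^ e i) \<noteq> r ^ k"
proof
  let ?q = "(!) (ratio_list n)" and ?N = "length (ratio_list n)"
  assume eq: "(\<Prod>i<?N. ?q i ^ e i) = r ^ k"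
  obtain b where b: "b < ?N" "\<not> good (?q b)" "0 < e b"
    using assms by blast
  define h where "h = (\<Prod>i<?N. ?q i ^ (e(b := e b - 1)) i)"
  have "(\<Prod>i<?N. ?q i ^ e i) = (\<Prod>i<?N. (if i = b then ?q b else 1) * ?q i ^ (e(b := e b - 1)) i)"
    using b(3) by (intro prod.cong) (auto simp: power_eq_if)
  also have "\<dots> = ?q b * h"
    using b(1) by (simp add: prod.distrib h_def)
  \<comment> \<open>The extra \<open>r\<close> puts the completing factor into the semigroup even if
    \<open>h\<close> is the empty product 1.\<close>
  finally have "?q b * (h * r) = r ^ Suc k"
    using eq by (simp add: mult_ac)
  moreover have "r ^ Suc k \<in> mult_semigroup {r}"
    by (intro power_mem_mult_semigroup mult_semigroup.base) simp_all
  moreover have "h * r \<in> mult_semigroup (set rs)"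
  proof -
    have "h \<in> insert 1 (mult_semigroup (set (ratio_list n)))"
      unfolding h_def by (intro prod_power_mem_mult_semigroup) auto
    then have "h \<in> insert 1 (mult_semigroup (set rs))"
      using mult_semigroup_subset[OF ratio_list_subset, of n] by blast
    then show ?thesis
      using r_mem by (auto intro: mult_semigroup.intros)
  qed
  ultimately have "good (?q b)" unfolding good_def by metis
  with b show False by simp
qed

lemma P_eq_sum: "P n t = (\<Sum>i | i < length (ratio_list n) \<and> good (ratio_list n ! i). (ratio_list n ! i) powr t)"
  unfolding P_def sum_list_sum_nth
  by (rule sum.mono_neutral_cong_right) auto

lemma ratio_system_ratio_list: "ratio_system (length (ratio_list n)) ((!) (ratio_list n))"
  using length_ratio_list[of n] ratio_list_in[OF nth_mem, of _ n] by unfold_locales simp_all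

lemma sum_nth_ratio_list: "(\<Sum>i<length (ratio_list n). (ratio_list n ! i) powr s) = 1"
  using sum_ratio_list[of n] by (simp add: sum_list_sum_nth atLeast0LessThan)

text \<open>At the root \<open>t\<close> of \<open>P j t = 1\<close> the transfer along
  \<open>f\<close> forces \<open>P i t \<ge> 1\<close>, against the strict growth of
  \<open>P\<close> in the index for \<open>t < s\<close>. The common exponent \<open>s\<close> of
  both lists provides the measure.\<close>

lemma no_bilipschitz_coding:
  assumes "1 \<le> i" "i < j"
    and bilip: "bilipschitz_coding (length (ratio_list j)) ((!) (ratio_list j))
      (length (ratio_list i)) ((!) (ratio_list i)) f L"
  shows False
proof -
  let ?N = "length (ratio_list i)" and ?q = "(!) (ratio_list i)"
  obtain \<nu> where \<nu>: "prob_space \<nu>" "\<And>w. set w \<subseteq> {..<?N} \<Longrightarrow> cyl ?N w \<in> sets \<nu> \<and> measure \<nu> (cyl ?N w) = wt ?q w powr s"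
    using ratio_system.ex_self_similar_measure[OF ratio_system_ratio_list sum_nth_ratio_list[of i]] by metis
  interpret bilipschitz_measure "length (ratio_list j)" "(!) (ratio_list j)" ?N ?q f L \<nu> s
    by (intro bilipschitz_measure.intro bilip bilipschitz_measure_axioms.intro s_pos sum_nth_ratio_list \<nu>)
  obtain t where t: "0 < t" "t < s" "P j t = 1"
    using ex_P_eq_1[of j] assms by auto
  have "1 \<le> (\<Sum>k | k < ?N \<and> \<not> \<not> good (?q k). ?q k powr t)"
  proof (rule good_sum_transfer[OF r t(1)])
    show "1 \<le> (\<Sum>k | k < length (ratio_list j) \<and> good (ratio_list j ! k). (ratio_list j ! k) powr t)"
      using t(3) by (simp add: P_eq_sum)
  qed (use good_word_completion bad_product in blast)+
  then have "1 \<le> P i t" by (simp add: P_eq_sum)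
  with P_less[OF t(2) assms(2)] t(3) show False by simp
qed

end

theorem proposition2p1:
  fixes S :: ifs and s r :: real
  assumes "is_IFS S"
    and "strong_separation S"
    and "s = dimH S"
    and "r \<in> ratios S"
    and "maps_meeting S (mult_semigroup {r}) \<noteq> maps S"
    and "\<exists>(m::nat) l :: nat \<Rightarrow> nat.
           (\<forall>k\<in>{1..m}. l k > 0) \<and> (\<Sum>k=1..m. r powr (s * real (l k))) = 1"
  shows "\<exists>T :: nat \<Rightarrow> ifs.
           (\<forall>n\<ge>1. is_IFS (T n) \<and> strong_separation (T n) \<and>
                  dimH (T n) = s \<and>
                  semigroup_equiv (sgp (T n)) (sgp S) \<and>
                  ifs_semiring (T n) = ifs_semiring S) \<and>
           (\<forall>i\<ge>1. \<forall>j\<ge>1. i \<noteq> j \<longrightarrow>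
                  \<not> Lipschitz_equivalent (attractor_space (T i)) (attractor_space (T j)))"
proof -
  obtain m :: nat and l :: "nat \<Rightarrow> nat" where ml: "\<forall>k\<in>{1..m}. l k > 0" "(\<Sum>k=1..m. r powr (s * real (l k))) = 1"
    using assms(6) by blast
  define rs where "rs = map (ratio (ambient_dim S)) (maps S)"
  have set_rs: "set rs = ratios S"
    by (simp add: rs_def ratios_def)
  interpret split_system l m r s rs
  proof
    show "2 \<le> length rs" using assms(1) by (simp add: rs_def is_IFS_def)
    show "0 < a \<and> a < 1" if a: "a \<in> set rs" for a
    proof -
      obtain f where f: "f \<in> set (maps S)" "a = ratio (ambient_dim S) f"
        using a by (auto simp: rs_def)
      then obtain i where "i < length (maps S)" "f = maps S ! i"
        unfolding in_set_conv_nth by blast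
      with f show ?thesis using is_IFS_D(2,3)[OF assms(1)] by simp
    qed
    show "r \<in> set rs" using assms(4) by (simp add: set_rs)
    show "0 < s" unfolding assms(3) by (rule sum_powr_dimH(1)[OF assms(1,2)])
    show "(\<Sum>a\<leftarrow>rs. a powr s) = 1"
      using sum_powr_dimH(2)[OF assms(1,2)]
      unfolding rs_def assms(3) sum_list_sum_nth atLeast0LessThan by simp
    show "0 < l k" if "k \<in> {1..m}" for k using ml(1) that by blast
    show "(\<Sum>k=1..m. r powr (s * real (l k))) = 1" by (rule ml(2))
    \<comment> \<open>A filter that changes the list drops some map; the ratio of that map is the
      bad one.\<close>
    have "\<exists>f\<in>set (maps S). \<forall>g\<in>sgp S. ratio (ambient_dim S) f * g \<notin> mult_semigroup {r}"
    proof (rule ccontr)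
      assume "\<not> ?thesis"
      then have "\<forall>f\<in>set (maps S). (\<lambda>g. ratio (ambient_dim S) f * g) ` sgp S \<inter> mult_semigroup {r} \<noteq> {}"
        by blast
      then have "maps_meeting S (mult_semigroup {r}) = maps S"
        unfolding maps_meeting_def by (rule filter_True)
      with assms(5) show False by contradiction
    qed
    then show "\<exists>a\<in>set rs. \<forall>g\<in>mult_semigroup (set rs). a * g \<notin> mult_semigroup {r}"
      unfolding rs_def set_map sgp_def ratios_def by blast
  qed
  have "\<exists>T. is_IFS T \<and> strong_separation T \<and> map (ratio (ambient_dim T)) (maps T) = ratio_list n" for n
  proof -
    obtain T where "is_IFS T" "strong_separation T" "map (ratio (ambient_dim T)) (maps T) = ratio_list n"
      by (rule ex_IFS_with_ratios[OF length_ratio_list[of n] ratio_list_in[of _ n]])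
    then show ?thesis by blast
  qed
  then have "\<forall>n. \<exists>T. is_IFS T \<and> strong_separation T \<and> map (ratio (ambient_dim T)) (maps T) = ratio_list n"
    by blast
  from choice[OF this] obtain T where T: "\<And>n. is_IFS (T n)" "\<And>n. strong_separation (T n)"
    "\<And>n. map (ratio (ambient_dim (T n))) (maps (T n)) = ratio_list n"
    by blast
  have ratios_T: "ratios (T n) = set (ratio_list n)" for n
    using arg_cong[OF T(3)[of n], of set] by (simp add: ratios_def)
  have len: "length (maps (T n)) = length (ratio_list n)" for n
    using arg_cong[OF T(3)[of n], of length] by simp
  have nth: "ratio (ambient_dim (T n)) (maps (T n) ! i) = ratio_list n ! i" if "i < length (ratio_list n)" for n i
    using arg_cong[OF T(3)[of n], of "\<lambda>xs. xs ! i"] that by (simp add: len)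
  have dim: "dimH (T n) = s" for n
    using sum_nth_ratio_list[of n] by (intro dimH_eq T s_pos) (simp add: len nth)
  have coded: "coded (length (ratio_list n)) ((!) (ratio_list n)) (eucl (ambient_dim (T n))) (attractor (T n))" for n
    using coded_attractor[OF T(1,2), of n] unfolding len by (rule coded_cong[rotated]) (rule nth)
  have not_equiv: "\<not> Lipschitz_equivalent (attractor_space (T j)) (attractor_space (T i))"
    if "1 \<le> i" "i < j" for i j
  proof
    assume "Lipschitz_equivalent (attractor_space (T j)) (attractor_space (T i))"
    then show False
      by (rule bilipschitz_coding_of_Lipschitz_equivalent[OF ratio_system_ratio_list coded
            ratio_system_ratio_list coded])
        (rule no_bilipschitz_coding[OF that])
  qed
  show ?thesis
  proof (intro exI[of _ T] conjI allI impI)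
    fix n
    show "is_IFS (T n)" by (rule T(1))
    show "strong_separation (T n)" by (rule T(2))
    show "dimH (T n) = s" by (rule dim)
    show "semigroup_equiv (sgp (T n)) (sgp S)"
      using semigroup_equiv_ratio_list by (simp add: sgp_def ratios_T set_rs[symmetric])
    show "ifs_semiring (T n) = ifs_semiring S"
      using pos_int_semiring_ratio_list by (simp add: ifs_semiring_def ratios_T set_rs[symmetric] dim assms(3)[symmetric])
  next
    fix i j :: nat assume "1 \<le> i" "1 \<le> j" "i \<noteq> j"
    then consider "i < j" | "j < i" by linarith
    then show "\<not> Lipschitz_equivalent (attractor_space (T i)) (attractor_space (T j))"
    proof cases
      case 1
      then show ?thesis
        using not_equiv[OF \<open>1 \<le> i\<close>] Lipschitz_equivalent_sym by blast
    next
      case 2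
      then show ?thesis by (rule not_equiv[OF \<open>1 \<le> j\<close>])
    qed
  qed
qed

end
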